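(* Let $n\ge1$ and let $A\in\hat{\mathbb H}^{n\times n}$ be a dual quaternion Hermitian matrix with eigenvalues $\lambda_1,\dots,\lambda_n$. Then $$\mathrm{Cdet}(A)=\prod_{i=1}^n\lambda_i$$ and $$\mathrm{Cdet}(A^*A)=\mathrm{Cdet}(A)^2=\prod_{i=1}^n\lambda_i^2,$$ where $\mathrm{Cdet}$ is the Chen determinant.
   Context: $\mathbb H$ denotes the real quaternions with conjugation $q\mapsto q^*$. A dual quaternion is $q=q_s+q_d\epsilon$ with $q_s,q_d\in\mathbb H$, where $\epsilon\neq 0$, $\epsilon^2=0$, and $\epsilon$ commutes with all quaternions; the set of dual quaternions is $\hat{\mathbb H}$, and $q^*=q_s^*+q_d^*\epsilon$. If $q_s,q_d\in\mathbb R$, $q$ is called a dual number. For $A=(a_{ij})\in\hat{\mathbb H}^{n\times n}$, $A^*=(a_{ji}^* )$; $A$ is Hermitian if $A^*=A$, and unitary if $A^*A=I_n$. Eigenvalues: $\lambda\in\hat{\mathbb H}$ is a right eigenvalue of $A$ if $A\mathbf x=\mathbf x\lambda$ for some vector $\mathbf x=\mathbf x_s+\mathbf x_d\epsilon\in\hat{\mathbb H}^n$ with $\mathbf x_s\ne 0$. It is known that an $n\times n$ dual quaternion Hermitian matrix $A$ has exactly $n$ right eigenvalues (counted with multiplicity), all of which are dual numbers and also left eigenvalues; they are simply called the eigenvalues $\lambda_1,\dots,\lambda_n$ of $A$, and there is a unitary $U\in\hat{\mathbb H}^{n\times n}$ with $UAU^*=\mathrm{diag}(\lambda_1,\dots,\lambda_n)$.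 Chen determinant: write a permutation $\sigma$ of $\{1,\dots,n\}$ as an ordered product of disjoint cycles (fixed points included) $$\sigma=(n_{11}\cdots n_{1l_1})(n_{21}\cdots n_{2l_2})\cdots(n_{r1}\cdots n_{rl_r}),$$ where $(i_1\cdots i_k)$ means $i_1\mapsto i_2\mapsto\cdots\mapsto i_k\mapsto i_1$, arranged (uniquely) so that $n_{i1}>n_{ij}$ for all $j>1$ and $i=1,\dots,r$, and $n=n_{11}>n_{21}>\cdots>n_{r1}$. Set $$a_\sigma=(a_{n_{11}n_{12}}a_{n_{12}n_{13}}\cdots a_{n_{1l_1}n_{11}})(a_{n_{21}n_{22}}\cdots a_{n_{2l_2}n_{21}})\cdots(a_{n_{r1}n_{r2}}\cdots a_{n_{rl_r}n_{r1}})$$ (product in the indicated order). For an arbitrary $A=(a_{ij})\in\hat{\mathbb H}^{n\times n}$, $\mathrm{Cdet}(A)=\sum_\sigma(-1)^{n-r}a_\sigma$, summed over all permutations $\sigma$ of $\{1,\dots,n\}$, where $r$ is the number of cycles of $\sigma$. *)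

theory Defs
  imports
    Complex_Main
    "HOL-Combinatorics.Permutations"
    "HOL-Combinatorics.Orbits"
    "Jordan_Normal_Form.Matrix"
begin

section \<open>Quaternions\<close>

datatype quat = Quat (qre: real) (qi: real) (qj: real) (qk: real)

lemma quat_eq_iff:
  "p = q \<longleftrightarrow> qre p = qre q \<and> qi p = qi q \<and> qj p = qj q \<and> qk p = qk q"
  by (cases p; cases q) auto

instantiation quat :: ring_1
begin

definition "0 = Quat 0 0 0 0"
definition "1 = Quat 1 0 0 0"
definition "p + q = Quat (qre p + qre q) (qi p + qi q) (qj p + qj q) (qk p + qk q)"
definition "- p = Quat (- qre p) (- qi p) (- qj p) (- qk p)"
definition "p - q = Quat (qre p - qre q) (qi p - qi q) (qj p - qj q) (qk p - qk q)"
definition "p * q = Quat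
  (qre p * qre q - qi p * qi q - qj p * qj q - qk p * qk q)
  (qre p * qi q + qi p * qre q + qj p * qk q - qk p * qj q)
  (qre p * qj q - qi p * qk q + qj p * qre q + qk p * qi q)
  (qre p * qk q + qi p * qj q - qj p * qi q + qk p * qre q)"

instance
  by standard
    (simp_all add: zero_quat_def one_quat_def plus_quat_def uminus_quat_def minus_quat_def
      times_quat_def quat_eq_iff algebra_simps)

end

definition qcnj :: "quat \<Rightarrow> quat" where
  "qcnj q = Quat (qre q) (- qi q) (- qj q) (- qk q)"


section \<open>Dual quaternions\<close>

text \<open>\<open>Dual a b\<close> stands for \<open>a + b\<epsilon>\<close>, where \<open>\<epsilon>\<close> is central and \<open>\<epsilon>\<^sup>2 = 0\<close>.\<close>

datatype 'a dual = Dual (std_part: 'a) (dual_part: 'a)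

lemma dual_eq_iff: "p = q \<longleftrightarrow> std_part p = std_part q \<and> dual_part p = dual_part q"
  by (cases p; cases q) auto

instantiation dual :: (ring_1) ring_1
begin

definition "0 = Dual 0 0"
definition "1 = Dual 1 0"
definition "p + q = Dual (std_part p + std_part q) (dual_part p + dual_part q)"
definition "- p = Dual (- std_part p) (- dual_part p)"
definition "p - q = Dual (std_part p - std_part q) (dual_part p - dual_part q)"
definition "p * q = Dual (std_part p * std_part q)
  (std_part p * dual_part q + dual_part p * std_part q)"

instance
  by standard
    (simp_all add: zero_dual_def one_dual_def plus_dual_def uminus_dual_def minus_dual_def
      times_dual_def dual_eq_iff algebra_simps)

end

type_synonym dquat = "quat dual"

definition dqcnj :: "dquat \<Rightarrow> dquat" where
  "dqcnj q = Dual (qcnj (std_part q)) (qcnj (dual_part q))"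

text \<open>The library's \<open>mat_adjoint\<close> is not available here: its type class demands
  \<open>conjugate (a * b) = conjugate a * conjugate b\<close>.\<close>

definition dq_adjoint :: "dquat mat \<Rightarrow> dquat mat" where
  "dq_adjoint A = mat (dim_col A) (dim_row A) (\<lambda>(i, j). dqcnj (A $$ (j, i)))"

definition dq_hermitian :: "dquat mat \<Rightarrow> bool" where
  "dq_hermitian A \<longleftrightarrow> dq_adjoint A = A"


section \<open>Right eigenvalues\<close>

definition right_eigenvector :: "dquat mat \<Rightarrow> dquat vec \<Rightarrow> dquat \<Rightarrow> bool" where
  "right_eigenvector A x \<mu> \<longleftrightarrow>
     x \<in> carrier_vec (dim_row A) \<and>
     map_vec std_part x \<noteq> 0\<^sub>v (dim_row A) \<and>
     A *\<^sub>v x = map_vec (\<lambda>c. c * \<mu>) x"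

definition right_eigenvalue :: "dquat mat \<Rightarrow> dquat \<Rightarrow> bool" where
  "right_eigenvalue A \<mu> \<longleftrightarrow> (\<exists>x. right_eigenvector A x \<mu>)"

definition right_lin_indep :: "nat \<Rightarrow> dquat vec list \<Rightarrow> bool" where
  "right_lin_indep n xs \<longleftrightarrow>
     (\<forall>c :: nat \<Rightarrow> dquat.
        (\<forall>i<n. (\<Sum>j<length xs. (xs ! j) $ i * c j) = 0) \<longrightarrow> (\<forall>j<length xs. c j = 0))"

text \<open>The multiplicity of \<open>\<mu>\<close> is the largest number of right linearly independent eigenvectors
  belonging to \<open>\<mu>\<close>. The set below contains \<open>0\<close> and is bounded by the dimension of \<open>A\<close>. Vectors are
  right linearly independent over the dual quaternions iff their standard parts are right linearly
  independent over the quaternions. In particular, if \<open>U * A * dq_adjoint U\<close> is, for some unitary \<open>U\<close>,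
  diagonal with dual numbers (real standard and dual parts) on the diagonal, then the multiplicity
  of \<open>\<mu>\<close> is the number of times it occurs there.\<close>

definition eigenvalue_mult :: "dquat mat \<Rightarrow> dquat \<Rightarrow> nat" where
  "eigenvalue_mult A \<mu> =
     Max {length xs | xs. (\<forall>x \<in> set xs. right_eigenvector A x \<mu>) \<and> right_lin_indep (dim_row A) xs}"

definition eigenvalue_list :: "dquat mat \<Rightarrow> dquat list \<Rightarrow> bool" where
  "eigenvalue_list A ls \<longleftrightarrow>
     length ls = dim_row A \<and>
     set ls = {\<mu>. right_eigenvalue A \<mu>} \<and>
     (\<forall>\<mu> \<in> set ls. count_list ls \<mu> = eigenvalue_mult A \<mu>)"


section \<open>The Chen determinant\<close>

text \<open>Indices run over \<open>{0..<n}\<close> instead of \<open>{1..n}\<close>; the definition depends only on their order.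
  A cycle \<open>(i\<^sub>1 \<dots> i\<^sub>k)\<close>, meaning \<open>i\<^sub>1 \<mapsto> i\<^sub>2 \<mapsto> \<dots> \<mapsto> i\<^sub>k \<mapsto> i\<^sub>1\<close>, is the list \<open>[i\<^sub>1, \<dots>, i\<^sub>k]\<close>. Each cycle of \<open>\<sigma>\<close>
  (fixed points included) is started at its largest element, and the cycles are listed by
  decreasing first element.\<close>

definition cycle_from :: "(nat \<Rightarrow> nat) \<Rightarrow> nat \<Rightarrow> nat list" where
  "cycle_from \<sigma> m = map (\<lambda>k. (\<sigma> ^^ k) m) [0..<card (orbit \<sigma> m)]"

definition chen_cycles :: "nat \<Rightarrow> (nat \<Rightarrow> nat) \<Rightarrow> nat list list" where
  "chen_cycles n \<sigma> = map (cycle_from \<sigma>) (filter (\<lambda>m. m = Max (orbit \<sigma> m)) (rev [0..<n]))"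

text \<open>\<open>cycle_prod A [i\<^sub>1, \<dots>, i\<^sub>k]\<close> is \<open>A $$ (i\<^sub>1, i\<^sub>2) * A $$ (i\<^sub>2, i\<^sub>3) * \<dots> * A $$ (i\<^sub>k, i\<^sub>1)\<close>. As
  multiplication does not commute, \<open>prod_list\<close> is used for products throughout.\<close>

definition cycle_prod :: "'a::ring_1 mat \<Rightarrow> nat list \<Rightarrow> 'a" where
  "cycle_prod A c = prod_list (map2 (\<lambda>i j. A $$ (i, j)) c (rotate1 c))"

definition chen_term :: "'a::ring_1 mat \<Rightarrow> (nat \<Rightarrow> nat) \<Rightarrow> 'a" where
  "chen_term A \<sigma> = prod_list (map (cycle_prod A) (chen_cycles (dim_row A) \<sigma>))"

definition Cdet :: "'a::ring_1 mat \<Rightarrow> 'a" where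
  "Cdet A = (\<Sum>\<sigma> | \<sigma> permutes {0..<dim_row A}.
     (- 1) ^ (dim_row A - length (chen_cycles (dim_row A) \<sigma>)) * chen_term A \<sigma>)"

end

theory Submission
  imports Defs
begin

text \<open>Self-adjoint dual quaternions are central, and this is what makes a determinant of Hermitian matrices
behave as over a commutative ring.

\<^bold>\<open>The determinant.\<close> Splitting off the cycle through the largest index, one vertex at a time, turns the
Chen sum over permutations into a recursion over finite index sets (\<open>set_det\<close>, with the auxiliary path
sums \<open>path_det\<close>); this is \<open>Cdet_eq_set_det\<close>. If \<open>A\<close> is Hermitian, the path sums with prescribed end
points are the entries of a Hermitian matrix \<open>C\<close> of cofactors, and \<open>A C = d 1\<close>, where \<open>d\<close> is the
determinant (\<open>dquat_cramer\<close>). The off-diagonal entries of \<open>A C\<close> vanish by induction on the index set.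
Its diagonal entries \<open>d\<^sub>k\<close> are self-adjoint, and bracketing \<open>A C A\<close> in two ways gives
\<open>(d\<^sub>k - d\<^sub>l) a\<^sub>k\<^sub>l = 0\<close>; adding a real parameter to \<open>a\<^sub>k\<^sub>l\<close> makes it invertible, and continuity in the
parameter gives \<open>d\<^sub>k = d\<^sub>l\<close>. So the determinant can be expanded along the border at any index, not only
at the largest one, and completing the square there shows that it does not change when \<open>A\<close> is
replaced by \<open>P A P\<^sup>*\<close> with \<open>P\<close> a product of elementary matrices (\<open>set_det_congr\<close>).

\<^bold>\<open>Diagonalization.\<close> Such a \<open>P\<close> diagonalizes a Hermitian \<open>A\<close> and a positive definite \<open>B\<close> simultaneously:
an eigenvector of the pencil \<open>(A, B)\<close> is made a row of \<open>P\<close>, and its index splits off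
(\<open>simultaneous_diagonalization\<close>). Working with pencils keeps \<open>P\<close> a product of unipotent matrices, where
a unitary one would have to be factored first. Eigenvectors exist over the quaternions because, once
all indices but one are diagonalized, the eigenvalue equation is a real secular equation, solved by
the intermediate value theorem (\<open>quat_eigenpair\<close>). Over the dual quaternions the standard parts are
diagonalized first; within one eigenspace an eigenvector of the dual part is chosen, and this choice
is exactly what makes the first-order correction solvable (\<open>dquat_eigenpair\<close>).

\<^bold>\<open>Conclusion.\<close> For \<open>B = 1\<close> this gives \<open>P P\<^sup>* = diag \<beta>\<close> and \<open>A P\<^sup>* = P\<^sup>* diag \<mu>\<close>. Then \<open>1\<close>, \<open>A\<close> and
\<open>A\<^sup>2 = A\<^sup>* A\<close> are congruent to \<open>diag \<beta>\<close>, \<open>diag (\<beta>\<^sub>i \<mu>\<^sub>i)\<close> and \<open>diag (\<beta>\<^sub>i \<mu>\<^sub>i\<^sup>2)\<close>, so that the product of the \<open>\<beta>\<^sub>i\<close>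
is \<open>1\<close> and the determinants of \<open>A\<close> and \<open>A\<^sup>2\<close> are the products of the \<open>\<mu>\<^sub>i\<close> and of the \<open>\<mu>\<^sub>i\<^sup>2\<close>. The
columns of \<open>P\<^sup>*\<close> form a basis of eigenvectors; coordinates in it show that the \<open>\<mu>\<^sub>i\<close> are the
eigenvalues with their multiplicities (\<open>eigenbasis\<close>).\<close>

section \<open>The Chen determinant as a recursion over index sets\<close>

text \<open>The signed sum over all simple paths from \<open>x\<close> through \<open>S\<close>, where a path that ends in \<open>i\<close> contributes the
product of its entries, then \<open>c i\<close>, then the determinant on the indices of \<open>S\<close> that it misses. With \<open>c\<close>
the column of \<open>x\<close> the path closes up to a cycle through \<open>x\<close>, and with \<open>c\<close> a unit vector it is a
cofactor; keeping \<open>c\<close> arbitrary lets one recursion serve both. The expression in the first summand is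
the determinant on \<open>S\<close> itself, spelled out so that a single function suffices.\<close>

function path_det :: "(nat \<Rightarrow> nat \<Rightarrow> 'a::ring_1) \<Rightarrow> nat set \<Rightarrow> nat \<Rightarrow> (nat \<Rightarrow> 'a) \<Rightarrow> 'a" where
  "path_det A S x c = (if finite S then
     c x * (if S = {} then 1 else path_det A (S - {Max S}) (Max S) (\<lambda>i. A i (Max S)))
     - (\<Sum>l\<in>S. A x l * path_det A (S - {l}) l c) else 0)"
  by auto
termination
proof (relation "measure (\<lambda>(A, S, x, c). card S)")
qed (simp_all add: card_Diff1_less del: card_Diff_insert card_Diff_singleton)

declare path_det.simps [simp del]

definition set_det :: "(nat \<Rightarrow> nat \<Rightarrow> 'a::ring_1) \<Rightarrow> nat set \<Rightarrow> 'a" where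
  "set_det A S = (if S = {} then 1 else path_det A (S - {Max S}) (Max S) (\<lambda>i. A i (Max S)))"

lemma path_det_rec:
  assumes "finite S"
  shows "path_det A S x c = c x * set_det A S - (\<Sum>l\<in>S. A x l * path_det A (S - {l}) l c)"
  using assms by (subst path_det.simps) (simp add: set_det_def)

lemma set_det_empty [simp]: "set_det A {} = 1"
  by (simp add: set_det_def)

fun path_prod :: "(nat \<Rightarrow> nat \<Rightarrow> 'a::ring_1) \<Rightarrow> (nat \<Rightarrow> 'a) \<Rightarrow> nat list \<Rightarrow> 'a" where
  "path_prod A c [] = 1"
| "path_prod A c [x] = c x"
| "path_prod A c (x # y # ys) = A x y * path_prod A c (y # ys)"

lemma path_prod_Cons:
  "ys \<noteq> [] \<Longrightarrow> path_prod A c (x # ys) = A x (hd ys) * path_prod A c ys"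
  by (cases ys) auto

text \<open>A list that \<open>\<sigma>\<close> traverses and closes is the cycle of \<open>\<sigma>\<close>. Cycles of a modified permutation
are computed from this.\<close>

lemma cycle_from_eqI:
  assumes "distinct xs" "xs \<noteq> []" "hd xs = a"
    and step: "\<And>i. Suc i < length xs \<Longrightarrow> \<sigma> (xs ! i) = xs ! Suc i"
    and clos: "\<sigma> (last xs) = a"
  shows "orbit \<sigma> a = set xs" "cycle_from \<sigma> a = xs"
proof -
  have pow: "(\<sigma> ^^ i) a = xs ! i" if "i < length xs" for i
    using that
  proof (induction i)
    case 0
    then show ?case using assms by (simp add: hd_conv_nth)
  next
    case (Suc i)
    then show ?case using step by simp
  qed
  have len: "0 < length xs" using assms(2) by simp
  have "(\<sigma> ^^ length xs) a = \<sigma> ((\<sigma> ^^ (length xs - 1)) a)"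
    using len by (metis Suc_diff_1 comp_apply funpow.simps(2))
  also have "\<dots> = a"
    using pow[of "length xs - 1"] clos assms(2) by (simp add: last_conv_nth)
  finally have returns: "(\<sigma> ^^ length xs) a = a" .
  have "orbit \<sigma> a = {(\<sigma> ^^ m) a | m. m < length xs}"
    using orbit_altdef_bounded[OF returns len] .
  also have "\<dots> = set xs"
    by (auto simp: set_conv_nth pow) (metis pow)
  finally show orb: "orbit \<sigma> a = set xs" .
  show "cycle_from \<sigma> a = xs"
    unfolding cycle_from_def orb distinct_card[OF assms(1)]
    by (rule nth_equalityI) (auto simp: pow)
qed

lemma cycle_from_props:
  assumes "permutation \<sigma>"
  shows "distinct (cycle_from \<sigma> a)" "cycle_from \<sigma> a \<noteq> []" "hd (cycle_from \<sigma> a) = a"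
    "set (cycle_from \<sigma> a) = orbit \<sigma> a"
    "\<forall>i. Suc i < length (cycle_from \<sigma> a) \<longrightarrow> \<sigma> (cycle_from \<sigma> a ! i) = cycle_from \<sigma> a ! Suc i"
    "\<sigma> (last (cycle_from \<sigma> a)) = a"
proof -
  define n where "n = (LEAST n. 0 < n \<and> (\<sigma> ^^ n) a = a)"
  have "\<exists>n. 0 < n \<and> (\<sigma> ^^ n) a = a"
    using permutation_self[OF assms, of a] by blast
  then have n: "0 < n" "(\<sigma> ^^ n) a = a"
    unfolding n_def by (metis (mono_tags, lifting) LeastI)+
  have least: "(\<sigma> ^^ m) a \<noteq> a" if "0 < m" "m < n" for m
    using that not_less_Least n_def by blast
  define xs where "xs = map (\<lambda>k. (\<sigma> ^^ k) a) [0..<n]"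
  have bij: "inj (\<sigma> ^^ m)" for m
    using assms by (simp add: bij_is_inj permutation_bijective bij_fn inj_fn)
  have ne: "(\<sigma> ^^ i) a \<noteq> (\<sigma> ^^ j) a" if "i < j" "j < n" for i j
  proof
    assume eq: "(\<sigma> ^^ i) a = (\<sigma> ^^ j) a"
    have "(\<sigma> ^^ i) ((\<sigma> ^^ (j - i)) a) = (\<sigma> ^^ i) a"
      using that eq by (metis funpow_add comp_apply le_add_diff_inverse less_imp_le)
    then have "(\<sigma> ^^ (j - i)) a = a" using bij by (meson injD)
    then show False using least[of "j - i"] that by simp
  qed
  have "inj_on (\<lambda>k. (\<sigma> ^^ k) a) {0..<n}"
    by (rule inj_onI) (metis atLeastLessThan_iff linorder_neqE_nat ne)
  then have d: "distinct xs" unfolding xs_def by (simp add: distinct_map)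
  have ne0: "xs \<noteq> []" using n by (simp add: xs_def)
  have hd: "hd xs = a" using n by (simp add: xs_def hd_map)
  have st: "\<sigma> (xs ! i) = xs ! Suc i" if "Suc i < length xs" for i
    using that by (simp add: xs_def)
  have cl: "\<sigma> (last xs) = a"
  proof -
    have "last xs = (\<sigma> ^^ (n - 1)) a" using n by (simp add: xs_def last_map)
    then show ?thesis using n by (metis Suc_diff_1 comp_apply funpow.simps(2))
  qed
  note e = cycle_from_eqI[OF d ne0 hd st cl]
  show "distinct (cycle_from \<sigma> a)" "cycle_from \<sigma> a \<noteq> []" "hd (cycle_from \<sigma> a) = a"
    "set (cycle_from \<sigma> a) = orbit \<sigma> a"
    "\<forall>i. Suc i < length (cycle_from \<sigma> a) \<longrightarrow> \<sigma> (cycle_from \<sigma> a ! i) = cycle_from \<sigma> a ! Suc i"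
    "\<sigma> (last (cycle_from \<sigma> a)) = a"
    using e d ne0 hd st cl by simp_all
qed

lemma cycle_from_cong:
  assumes "permutation \<sigma>" "\<And>y. y \<in> orbit \<sigma> a \<Longrightarrow> \<tau> y = \<sigma> y"
  shows "orbit \<tau> a = orbit \<sigma> a" "cycle_from \<tau> a = cycle_from \<sigma> a"
proof -
  note p = cycle_from_props[OF assms(1), of a]
  have mem: "cycle_from \<sigma> a ! i \<in> orbit \<sigma> a" if "i < length (cycle_from \<sigma> a)" for i
    using that p(4) nth_mem by blast
  have e: "orbit \<tau> a = set (cycle_from \<sigma> a)" "cycle_from \<tau> a = cycle_from \<sigma> a"
    using cycle_from_eqI[of "cycle_from \<sigma> a" a \<tau>] p assms(2) mem
    by (metis Suc_lessD last_in_set)+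
  then show "orbit \<tau> a = orbit \<sigma> a" "cycle_from \<tau> a = cycle_from \<sigma> a" using p(4) by simp_all
qed

text \<open>The first elements of the Chen cycles within \<open>T\<close>. Ranging over sets that need not be initial segments
allows cycles to be removed one by one.\<close>

definition leaders :: "nat set \<Rightarrow> (nat \<Rightarrow> nat) \<Rightarrow> nat list" where
  "leaders T \<sigma> = rev (sorted_list_of_set {m \<in> T. m = Max (orbit \<sigma> m)})"

definition closed_prod :: "(nat \<Rightarrow> nat \<Rightarrow> 'a::ring_1) \<Rightarrow> (nat \<Rightarrow> nat) \<Rightarrow> nat \<Rightarrow> 'a" where
  "closed_prod A \<sigma> m = path_prod A (\<lambda>i. A i m) (cycle_from \<sigma> m)"

definition cycles_prod :: "(nat \<Rightarrow> nat \<Rightarrow> 'a::ring_1) \<Rightarrow> nat set \<Rightarrow> (nat \<Rightarrow> nat) \<Rightarrow> 'a" where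
  "cycles_prod A T \<sigma> = prod_list (map (closed_prod A \<sigma>) (leaders T \<sigma>))"

lemma length_leaders_le: "finite T \<Longrightarrow> length (leaders T \<sigma>) \<le> card T"
  by (simp add: leaders_def card_mono)

lemma set_leaders: "finite T \<Longrightarrow> set (leaders T \<sigma>) \<subseteq> T"
  by (auto simp: leaders_def)

lemma leaders_cong:
  assumes "\<And>m. m \<in> T \<Longrightarrow> orbit \<tau> m = orbit \<sigma> m"
  shows "leaders T \<tau> = leaders T \<sigma>"
proof -
  have "{m \<in> T. m = Max (orbit \<tau> m)} = {m \<in> T. m = Max (orbit \<sigma> m)}" using assms by auto
  then show ?thesis by (simp add: leaders_def)
qed

lemma cycles_prod_cong:
  assumes "finite T" "permutation \<sigma>" "\<And>m y. m \<in> T \<Longrightarrow> y \<in> orbit \<sigma> m \<Longrightarrow> \<tau> y = \<sigma> y"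
  shows "leaders T \<tau> = leaders T \<sigma>" "cycles_prod A T \<tau> = cycles_prod A T \<sigma>"
proof -
  have c: "orbit \<tau> m = orbit \<sigma> m" "cycle_from \<tau> m = cycle_from \<sigma> m" if "m \<in> T" for m
    using cycle_from_cong[OF assms(2), of m \<tau>] assms(3) that by blast+
  show l: "leaders T \<tau> = leaders T \<sigma>" using c by (intro leaders_cong)
  show "cycles_prod A T \<tau> = cycles_prod A T \<sigma>"
    unfolding cycles_prod_def l
    using c set_leaders[OF assms(1), of \<sigma>]
    by (intro arg_cong[of _ _ prod_list] map_cong) (auto simp: closed_prod_def)
qed

text \<open>The largest index leads its own cycle, and this cycle comes first in the Chen order.\<close>

lemma leaders_Max:
  assumes "finite S" "S \<noteq> {}" "\<sigma> permutes S"
  shows "leaders S \<sigma> = Max S # leaders (S - orbit \<sigma> (Max S)) \<sigma>"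
proof -
  let ?k = "Max S"
  have perm: "permutation \<sigma>" using assms permutation_permutes by blast
  have kS: "?k \<in> S" using assms by simp
  have self: "m \<in> orbit \<sigma> m" for m by (rule permutation_self_in_orbit[OF perm])
  have fin: "finite (orbit \<sigma> m)" for m by (rule finite_orbit[OF self])
  have osub: "orbit \<sigma> m \<subseteq> S" if "m \<in> S" for m by (rule permutes_orbit_subset[OF assms(3) that])
  have kmax: "Max (orbit \<sigma> ?k) = ?k"
    using osub[OF kS] self fin assms(1) kS by (intro Max_eqI) (auto)
  have same: "orbit \<sigma> m = orbit \<sigma> ?k" if "m \<in> orbit \<sigma> ?k" for m
    using that cyclic_on_orbit'[OF perm, of ?k] by (simp add: orbit_cyclic_eq3)
  have set: "{m \<in> S. m = Max (orbit \<sigma> m)} =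
      insert ?k {m \<in> S - orbit \<sigma> ?k. m = Max (orbit \<sigma> m)}"
    using kS kmax same by force
  let ?R = "{m \<in> S - orbit \<sigma> ?k. m = Max (orbit \<sigma> m)}"
  have finR: "finite ?R" and lt: "\<forall>m\<in>?R. m < ?k"
    using assms(1) self by (auto simp: less_le)
  have "sorted_list_of_set (insert ?k ?R) = sorted_list_of_set ?R @ [?k]"
    using finR lt
    by (intro sorted_distinct_set_unique)
      (auto simp: sorted_append less_imp_le simp del: sorted_list_of_set_insert_remove)
  then show ?thesis unfolding leaders_def set by simp
qed

definition chen_sum :: "(nat \<Rightarrow> nat \<Rightarrow> 'a::ring_1) \<Rightarrow> nat set \<Rightarrow> 'a" where
  "chen_sum A S = (\<Sum>\<sigma> | \<sigma> permutes S.
     (- 1) ^ (card S - length (leaders S \<sigma>)) * cycles_prod A S \<sigma>)"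

text \<open>The combinatorial counterpart of \<open>path_det\<close>: permutations of \<open>insert x S\<close> whose cycle through \<open>x\<close> is
opened up at its end, where the return to \<open>x\<close> is replaced by the factor from \<open>c\<close>.\<close>

definition chen_path_sum :: "(nat \<Rightarrow> nat \<Rightarrow> 'a::ring_1) \<Rightarrow> nat set \<Rightarrow> nat \<Rightarrow> (nat \<Rightarrow> 'a) \<Rightarrow> 'a" where
  "chen_path_sum A S x c = (\<Sum>\<sigma> | \<sigma> permutes insert x S.
     (- 1) ^ (card S - length (leaders (insert x S - orbit \<sigma> x) \<sigma>)) *
       (path_prod A c (cycle_from \<sigma> x) * cycles_prod A (insert x S - orbit \<sigma> x) \<sigma>))"

lemma chen_sum_eq_path_sum:
  assumes "finite S" "S \<noteq> {}"
  shows "chen_sum A S = chen_path_sum A (S - {Max S}) (Max S) (\<lambda>i. A i (Max S))"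
proof -
  have kS: "Max S \<in> S" using assms by simp
  have ins: "insert (Max S) (S - {Max S}) = S" using kS by auto
  have card: "card S = Suc (card (S - {Max S}))" using card.remove[OF assms(1) kS] .
  show ?thesis
    unfolding chen_sum_def chen_path_sum_def ins
    by (rule sum.cong) (simp_all add: cycles_prod_def leaders_Max[OF assms] closed_prod_def card)
qed

text \<open>Composing with a transposition inserts \<open>x\<close> in front of \<open>l\<close> into the cycle of \<open>l\<close>, and leaves the other
cycles alone.\<close>

lemma cycle_from_insert:
  assumes "finite S" "x \<notin> S" "l \<in> S" "q permutes S"
  defines "\<sigma> \<equiv> transpose x l \<circ> q"
  shows "cycle_from \<sigma> x = x # cycle_from q l" "orbit \<sigma> x = insert x (orbit q l)"
    "\<And>y. y \<in> S - orbit q l \<Longrightarrow> \<sigma> y = q y"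
proof -
  have perm: "permutation q" using assms permutation_permutes by blast
  note p = cycle_from_props[OF perm, of l]
  have osub: "orbit q l \<subseteq> S" by (rule permutes_orbit_subset[OF assms(4) assms(3)])
  let ?c = "cycle_from q l"
  have qS: "q y \<in> S" if "y \<in> S" for y using assms(4) that by (simp add: permutes_in_image)
  have qx: "q x = x" using assms(2,4) by (simp add: permutes_def)
  have d: "distinct (x # ?c)" using p osub assms(2) by auto
  have st: "\<sigma> ((x # ?c) ! i) = (x # ?c) ! Suc i" if i: "Suc i < length (x # ?c)" for i
  proof (cases i)
    case 0
    then show ?thesis using p qx by (simp add: \<sigma>_def transpose_def hd_conv_nth)
  next
    case (Suc j)
    have j: "Suc j < length ?c" using i Suc by simp
    then have q: "q (?c ! j) = ?c ! Suc j" using p by simp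
    have "?c ! Suc j \<noteq> ?c ! 0"
      using p(1) j by (metis nat.distinct(1) nth_eq_iff_index_eq zero_less_Suc less_trans)
    then have nl: "?c ! Suc j \<noteq> l" using p by (simp add: hd_conv_nth)
    have nx: "?c ! Suc j \<noteq> x" using d j by (auto dest: nth_mem)
    show ?thesis using Suc q nl nx by (simp add: \<sigma>_def transpose_def)
  qed
  have cl: "\<sigma> (last (x # ?c)) = x"
    using p by (simp add: \<sigma>_def transpose_def)
  note e = cycle_from_eqI[of "x # ?c" x \<sigma>, OF d _ _ st cl]
  show "cycle_from \<sigma> x = x # cycle_from q l" using e by simp
  show "orbit \<sigma> x = insert x (orbit q l)" using e p by simp
  fix y assume y: "y \<in> S - orbit q l"
  have "q y \<noteq> l"
  proof
    assume "q y = l"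
    then have "l \<in> orbit q y" by (metis orbit.base)
    then have "y \<in> orbit q l"
      using permutation_self_in_orbit[OF perm, of y] orbit_swap by metis
    then show False using y by simp
  qed
  moreover have "q y \<noteq> x" using qS y assms(2) by auto
  ultimately show "\<sigma> y = q y" by (simp add: \<sigma>_def transpose_def)
qed

text \<open>Every permutation of \<open>insert x S\<close> is \<open>transpose x l \<circ> q\<close> for a unique \<open>l\<close>, the image of \<open>x\<close>, and a unique
permutation \<open>q\<close> of \<open>S\<close>. For \<open>l = x\<close> the path stops at \<open>x\<close>; otherwise it moves on to \<open>l\<close>, with one
index fewer and the same number of cycles, hence the opposite sign.\<close>

lemma chen_path_sum_rec:
  assumes "finite S" "x \<notin> S"
  shows "chen_path_sum A S x c =
    c x * chen_sum A S - (\<Sum>l\<in>S. A x l * chen_path_sum A (S - {l}) l c)"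
proof -
  define f where "f \<sigma> = (- 1) ^ (card S - length (leaders (insert x S - orbit \<sigma> x) \<sigma>)) *
       (path_prod A c (cycle_from \<sigma> x) * cycles_prod A (insert x S - orbit \<sigma> x) \<sigma>)" for \<sigma>
  have sum: "chen_path_sum A S x c =
      (\<Sum>b\<in>insert x S. \<Sum>q | q permutes S. f (transpose x b \<circ> q))"
    unfolding chen_path_sum_def f_def[symmetric]
    by (rule sum_over_permutations_insert[OF assms])
  \<comment> \<open>signs are central\<close>
  have comm: "(- 1) ^ k * (b * z) = b * ((- 1) ^ k * z)" for k and b z :: 'a
    by (metis mult.assoc mult_1_left mult_minus1_right mult_minus1 mult_minus_left neg_one_even_power
        neg_one_odd_power minus_mult_right)
  have fixed: "f q = c x * ((- 1) ^ (card S - length (leaders S q)) * cycles_prod A S q)"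
    if q: "q permutes S" for q
  proof -
    have qx: "q x = x" using q assms by (simp add: permutes_def)
    then have orb: "orbit q x = {x}" by (simp add: orbit_eq_singleton_iff)
    have "cycle_from q x = [x]" by (simp add: cycle_from_def orb)
    moreover have "insert x S - orbit q x = S" using assms orb by auto
    ultimately show ?thesis by (simp add: f_def comm[of _ "c x"])
  qed
  have moved: "f (transpose x l \<circ> q) = - (A x l *
      ((- 1) ^ (card (S - {l}) - length (leaders (insert l (S - {l}) - orbit q l) q)) *
       (path_prod A c (cycle_from q l) * cycles_prod A (insert l (S - {l}) - orbit q l) q)))"
    if l: "l \<in> S" and q: "q permutes S" for l q
  proof -
    let ?s = "transpose x l \<circ> q"
    have perm: "permutation q" using assms q permutation_permutes by blast
    note ci = cycle_from_insert[OF assms l q]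
    have T: "insert x S - orbit ?s x = S - orbit q l" using ci assms by auto
    have T': "insert l (S - {l}) = S" using l by auto
    have disj: "y \<in> S - orbit q l" if "m \<in> S - orbit q l" "y \<in> orbit q m" for m y
    proof -
      have "y \<in> S" using that permutes_orbit_subset[OF q] by blast
      moreover have "y \<notin> orbit q l"
        using that cyclic_on_orbit'[OF perm] permutation_self_in_orbit[OF perm]
        by (metis DiffD2 orbit_cyclic_eq3)
      ultimately show ?thesis by simp
    qed
    note cc = cycles_prod_cong[of "S - orbit q l" q ?s, OF _ perm]
    have L: "leaders (S - orbit q l) ?s = leaders (S - orbit q l) q"
      "cycles_prod A (S - orbit q l) ?s = cycles_prod A (S - orbit q l) q"
      using cc assms(1) ci(3) disj by blast+
    have "S - orbit q l \<subseteq> S - {l}" using permutation_self_in_orbit[OF perm] by auto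
    then have le: "length (leaders (S - orbit q l) q) \<le> card (S - {l})"
      using length_leaders_le[of "S - orbit q l" q] assms(1) card_mono[of "S - {l}" "S - orbit q l"]
      by simp
    have card: "card S = Suc (card (S - {l}))" using card.remove[OF assms(1) l] .
    have pp: "path_prod A c (cycle_from ?s x) = A x l * path_prod A c (cycle_from q l)"
      using ci cycle_from_props[OF perm, of l] by (simp add: path_prod_Cons)
    have e: "(- 1) ^ (card S - r) = - ((- 1) ^ (card (S - {l}) - r) :: 'a)"
      if "r \<le> card (S - {l})" for r
      using that unfolding card by (simp add: Suc_diff_le)
    show ?thesis
      unfolding f_def T T' L pp e[OF le]
      by (simp only: mult.assoc comm mult_minus_left mult_minus_right)
  qed
  have stay: "sum f {q. q permutes S} = c x * chen_sum A S"
    unfolding chen_sum_def sum_distrib_left using fixed by (intro sum.cong) simp_all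
  have rest: "(\<Sum>q | q permutes S. f (transpose x l \<circ> q)) =
      - (A x l * chen_path_sum A (S - {l}) l c)" if l: "l \<in> S" for l
  proof -
    have "insert l (S - {l}) = S" using l by auto
    then show ?thesis
      unfolding chen_path_sum_def sum_distrib_left sum_negf[symmetric]
      using moved[OF l] by (intro sum.cong) simp_all
  qed
  show ?thesis
    unfolding sum sum.insert[OF assms] transpose_same id_comp
    using rest stay by (simp add: sum_negf cong: sum.cong)
qed

lemma path_det_eq_chen_path_sum:
  assumes "finite S" "x \<notin> S"
  shows "path_det A S x c = chen_path_sum A S x c"
  using assms
proof (induction "card S" arbitrary: S x c rule: less_induct)
  case less
  have D: "set_det A S = chen_sum A S"
  proof (cases "S = {}")
    case True
    then show ?thesis by (simp add: chen_sum_def cycles_prod_def leaders_def)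
  next
    case False
    then have "card (S - {Max S}) < card S" using less.prems by (intro card_Diff1_less) simp_all
    then show ?thesis
      using less.hyps[of "S - {Max S}" "Max S"] less.prems False
      by (simp add: set_det_def chen_sum_eq_path_sum)
  qed
  have "path_det A (S - {l}) l c = chen_path_sum A (S - {l}) l c" if "l \<in> S" for l
    using less.hyps[of "S - {l}"] less.prems that card_Diff1_less[of S l] by simp
  then show ?case
    unfolding path_det_rec[OF less.prems(1)] chen_path_sum_rec[OF less.prems] D
    by (simp cong: sum.cong)
qed

lemma set_det_eq_chen_sum:
  assumes "finite S"
  shows "set_det A S = chen_sum A S"
proof (cases "S = {}")
  case True
  then show ?thesis by (simp add: chen_sum_def cycles_prod_def leaders_def)
next
  case False
  then show ?thesis using assms by (simp add: set_det_def chen_sum_eq_path_sum path_det_eq_chen_path_sum)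
qed

text \<open>Entries are extended by zero, so that a Hermitian matrix gives a function that is Hermitian at all
indices.\<close>

definition entry :: "'a::zero mat \<Rightarrow> nat \<Rightarrow> nat \<Rightarrow> 'a" where
  "entry A i j = (if i < dim_row A \<and> j < dim_col A then A $$ (i, j) else 0)"

lemma cycle_prod_path_prod:
  assumes "xs \<noteq> []" "set xs \<subseteq> {0..<n}" "A \<in> carrier_mat n n"
  shows "cycle_prod A xs = path_prod (entry A) (\<lambda>i. entry A i (hd xs)) xs"
proof -
  obtain x ys where xs: "xs = x # ys" using assms by (cases xs) auto
  have gen: "prod_list (map2 (\<lambda>i j. A $$ (i, j)) (y # ys) (ys @ [z])) =
      path_prod (entry A) (\<lambda>i. entry A i z) (y # ys)"
    if "set (y # ys) \<subseteq> {0..<n}" "z < n" for y z ys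
    using that assms(3)
    by (induction ys arbitrary: y) (auto simp: entry_def)
  show ?thesis using gen[of x ys x] assms by (simp add: xs cycle_prod_def)
qed

text \<open>Both sides sum over the same permutations, so only the listing of cycle leaders has to be compared.\<close>

theorem Cdet_eq_set_det:
  assumes "A \<in> carrier_mat n n"
  shows "Cdet A = set_det (entry A) {0..<n}"
proof -
  have dim: "dim_row A = n" using assms by simp
  have L: "filter (\<lambda>m. m = Max (orbit \<sigma> m)) (rev [0..<n]) = leaders {0..<n} \<sigma>" for \<sigma>
  proof -
    have "sorted_list_of_set {m \<in> {0..<n}. m = Max (orbit \<sigma> m)} =
        filter (\<lambda>m. m = Max (orbit \<sigma> m)) [0..<n]"
      by (rule sorted_distinct_set_unique) (auto intro: sorted_wrt_filter)
    then show ?thesis by (simp add: leaders_def rev_filter)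
  qed
  have "Cdet A = chen_sum (entry A) {0..<n}"
    unfolding Cdet_def chen_sum_def dim
  proof (rule sum.cong, rule refl)
    fix \<sigma> assume "\<sigma> \<in> {\<sigma>. \<sigma> permutes {0..<n}}"
    then have s: "\<sigma> permutes {0..<n}" by simp
    then have perm: "permutation \<sigma>" using permutation_permutes by blast
    have "cycle_prod A (cycle_from \<sigma> m) = closed_prod (entry A) \<sigma> m" if "m \<in> {0..<n}" for m
      using cycle_from_props[OF perm, of m] permutes_orbit_subset[OF s that]
        cycle_prod_path_prod[of "cycle_from \<sigma> m" n A] assms
      by (simp add: closed_prod_def)
    then have "chen_term A \<sigma> = cycles_prod (entry A) {0..<n} \<sigma>"
      unfolding chen_term_def cycles_prod_def chen_cycles_def dim L map_map
      using set_leaders[of "{0..<n}" \<sigma>] by (intro arg_cong[of _ _ prod_list] map_cong) auto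
    then show "(- 1) ^ (n - length (chen_cycles n \<sigma>)) * chen_term A \<sigma> =
       (- 1) ^ (card {0..<n} - length (leaders {0..<n} \<sigma>)) * cycles_prod (entry A) {0..<n} \<sigma>"
      by (simp add: chen_cycles_def L)
  qed
  then show ?thesis by (simp add: set_det_eq_chen_sum)
qed

section \<open>Cofactors of Hermitian matrices\<close>

text \<open>The common ground of quaternions and dual quaternions: an involution whose self-adjoint elements are
central.\<close>

locale central_star_ring =
  fixes cnj :: "'a::ring_1 \<Rightarrow> 'a"
  assumes cnj_add: "cnj (a + b) = cnj a + cnj b"
    and cnj_mult: "cnj (a * b) = cnj b * cnj a"
    and cnj_cnj [simp]: "cnj (cnj a) = a"
    and selfadjoint_commute: "cnj a = a \<Longrightarrow> a * b = b * a"
begin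

lemma cnj_zero [simp]: "cnj 0 = 0"
  using cnj_add[of 0 0] by simp

lemma cnj_minus: "cnj (- a) = - cnj a"
  using cnj_add[of a "- a"] by (simp add: eq_neg_iff_add_eq_0 add.commute)

lemma cnj_diff: "cnj (a - b) = cnj a - cnj b"
  using cnj_add[of a "- b"] by (simp add: cnj_minus)

lemma cnj_sum: "cnj (sum f I) = (\<Sum>i\<in>I. cnj (f i))"
  by (induction I rule: infinite_finite_induct) (simp_all add: cnj_add)

lemma cnj_one [simp]: "cnj 1 = 1"
  using cnj_mult[of "cnj 1" 1] by simp

end

lemma qcnj_central_star: "central_star_ring qcnj"
  by unfold_locales
    (auto simp: qcnj_def quat_eq_iff plus_quat_def times_quat_def algebra_simps)

interpretation quat: central_star_ring qcnj
  by (rule qcnj_central_star)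

interpretation dquat: central_star_ring dqcnj
proof
  fix a b :: dquat
  show "dqcnj (a + b) = dqcnj a + dqcnj b"
    by (simp add: dqcnj_def plus_dual_def quat.cnj_add)
  show "dqcnj (a * b) = dqcnj b * dqcnj a"
    by (simp add: dqcnj_def times_dual_def quat.cnj_add quat.cnj_mult add.commute)
  show "dqcnj (dqcnj a) = a" by (simp add: dqcnj_def)
  show "a * b = b * a" if "dqcnj a = a"
  proof -
    have "qcnj (std_part a) = std_part a" "qcnj (dual_part a) = dual_part a"
      using that by (simp_all add: dqcnj_def dual_eq_iff)
    then have "std_part a * x = x * std_part a" "dual_part a * x = x * dual_part a" for x
      using quat.selfadjoint_commute by blast+
    then show ?thesis by (simp add: times_dual_def add.commute)
  qed
qed

text \<open>Signed sum over the simple paths from \<open>l\<close> to \<open>m\<close> in \<open>S\<close>, each followed by the determinant on the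
remaining indices: the adjugate entry that the commutative theory obtains from minors.\<close>

definition cofactor :: "(nat \<Rightarrow> nat \<Rightarrow> 'a::ring_1) \<Rightarrow> nat set \<Rightarrow> nat \<Rightarrow> nat \<Rightarrow> 'a" where
  "cofactor A S l m = path_det A (S - {l}) l (\<lambda>i. if i = m then 1 else 0)"

context central_star_ring
begin

definition hermitian_fun :: "(nat \<Rightarrow> nat \<Rightarrow> 'a) \<Rightarrow> bool" where
  "hermitian_fun A \<longleftrightarrow> (\<forall>i j. cnj (A i j) = A j i)"

definition cramer :: "(nat \<Rightarrow> nat \<Rightarrow> 'a) \<Rightarrow> nat set \<Rightarrow> bool" where
  "cramer A S \<longleftrightarrow> cnj (set_det A S) = set_det A S \<and>
     (\<forall>l\<in>S. \<forall>m\<in>S. cnj (cofactor A S l m) = cofactor A S m l) \<and>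
     (\<forall>k\<in>S. \<forall>m\<in>S. (\<Sum>l\<in>S. A k l * cofactor A S l m) = (if k = m then set_det A S else 0))"

text \<open>Path sums are linear in the end vector \<open>c\<close>, because the determinant that follows the factor \<open>c m\<close> is
central and can be moved in front of it. The last part splits off the first step of a path.\<close>

lemma cofactor_expansion:
  assumes "finite S" "x \<in> S" "\<And>T. T \<subset> S \<Longrightarrow> cnj (set_det A T) = set_det A T"
  shows "(\<forall>c. path_det A (S - {x}) x c = (\<Sum>m\<in>S. cofactor A S x m * c m)) \<and>
    cofactor A S x x = set_det A (S - {x}) \<and>
    (\<forall>m\<in>S - {x}. cofactor A S x m = - (\<Sum>l\<in>S - {x}. A x l * cofactor A (S - {x}) l m))"
  using assms
proof (induction "card S" arbitrary: S x rule: less_induct)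
  case less
  let ?S = "S - {x}"
  have fin: "finite ?S" using less.prems by simp
  have real: "cnj (set_det A ?S) = set_det A ?S" using less.prems by blast
  have IH: "path_det A (?S - {l}) l c = (\<Sum>m\<in>?S. cofactor A ?S l m * c m)" if "l \<in> ?S" for l c
  proof -
    have "card ?S < card S" by (rule card_Diff1_less[OF less.prems(1,2)])
    moreover have "\<And>T. T \<subset> ?S \<Longrightarrow> cnj (set_det A T) = set_det A T" using less.prems(3) by blast
    ultimately show ?thesis using less.hyps[of ?S l] fin that by blast
  qed
  have P: "path_det A ?S x c = set_det A ?S * c x -
      (\<Sum>l\<in>?S. A x l * (\<Sum>m\<in>?S. cofactor A ?S l m * c m))" for c
    unfolding path_det_rec[OF fin] using selfadjoint_commute[OF real, of "c x"]
    by (simp add: IH del: Diff_iff cong: sum.cong)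
  have diag: "cofactor A S x x = set_det A ?S"
    unfolding cofactor_def[of A S] P by (auto intro!: sum.neutral)
  have "(\<Sum>m\<in>?S. cofactor A ?S l m * (if m = m' then 1 else 0)) = cofactor A ?S l m'"
    if "m' \<in> ?S" for l m'
    using that fin by (simp add: if_distrib[of "(*) _"] sum.delta cong: if_cong)
  then have off: "cofactor A S x m = - (\<Sum>l\<in>?S. A x l * cofactor A ?S l m)" if "m \<in> ?S" for m
    using that unfolding cofactor_def[of A S] P by auto
  have "path_det A ?S x c = (\<Sum>m\<in>S. cofactor A S x m * c m)" for c
  proof -
    have "(\<Sum>l\<in>?S. A x l * (\<Sum>m\<in>?S. cofactor A ?S l m * c m)) =
        (\<Sum>m\<in>?S. (\<Sum>l\<in>?S. A x l * cofactor A ?S l m) * c m)"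
      unfolding sum_distrib_left sum_distrib_right by (subst sum.swap) (simp add: mult.assoc)
    also have "\<dots> = (\<Sum>m\<in>?S. - (cofactor A S x m * c m))"
      using off by (intro sum.cong) auto
    finally show ?thesis
      unfolding P using diag less.prems by (simp add: sum.remove[of S x] sum_negf)
  qed
  then show ?case using diag off by blast
qed

text \<open>The inductive step of Cramer's rule, up to the equality of the diagonal entries \<open>d k\<close> of the product of
\<open>A\<close> with its cofactor matrix. Expanding a path at both ends shows that the cofactor matrix is Hermitian,
since the same expression on a smaller set is. A last-step expansion then makes the off-diagonal
entries cancel by the rule on \<open>S - {m}\<close>. Bracketing \<open>A C A\<close> in two ways gives the final claim.\<close>

lemma cramer_step:
  assumes A: "hermitian_fun A" and fin: "finite S"
    and smaller: "\<And>T. T \<subset> S \<Longrightarrow> cramer A T"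
  defines "d \<equiv> \<lambda>k. \<Sum>l\<in>S. A k l * cofactor A S l k"
  shows "\<And>l m. l \<in> S \<Longrightarrow> m \<in> S \<Longrightarrow> cnj (cofactor A S l m) = cofactor A S m l"
    and "\<And>k m. k \<in> S \<Longrightarrow> m \<in> S \<Longrightarrow> k \<noteq> m \<Longrightarrow> (\<Sum>l\<in>S. A k l * cofactor A S l m) = 0"
    and "\<And>k. k \<in> S \<Longrightarrow> cnj (d k) = d k"
    and "\<And>k. k \<in> S \<Longrightarrow> d k = A k k * set_det A (S - {k}) -
      (\<Sum>j\<in>S - {k}. \<Sum>l\<in>S - {k}. A k l * cofactor A (S - {k}) l j * A j k)"
    and "S \<noteq> {} \<Longrightarrow> set_det A S = d (Max S)"
    and "\<And>k l. k \<in> S \<Longrightarrow> l \<in> S \<Longrightarrow> (d k - d l) * A k l = 0"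
proof -
  have h: "cnj (A i j) = A j i" for i j using A by (simp add: hermitian_fun_def)
  have real: "cnj (set_det A T) = set_det A T" if "T \<subset> S" for T
    using smaller[OF that] by (simp add: cramer_def)
  have herm: "cnj (cofactor A T l m) = cofactor A T m l" if "T \<subset> S" "l \<in> T" "m \<in> T" for T l m
    using smaller[OF that(1)] that by (simp add: cramer_def)
  have cr: "(\<Sum>l\<in>T. A k l * cofactor A T l m) = (if k = m then set_det A T else 0)"
    if "T \<subset> S" "k \<in> T" "m \<in> T" for T k m
    using smaller[OF that(1)] that by (simp add: cramer_def)
  have sub: "S - {x} \<subset> S" if "x \<in> S" for x using that by blast
  have diag: "cofactor A T x x = set_det A (T - {x})"
    and first: "\<And>m. m \<in> T \<Longrightarrow> m \<noteq> x \<Longrightarrow>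
      cofactor A T x m = - (\<Sum>l\<in>T - {x}. A x l * cofactor A (T - {x}) l m)"
    if "T \<subseteq> S" "x \<in> T" for T x
    using that cofactor_expansion[of T x A] real finite_subset[OF that(1) fin] by blast+
  have last: "cofactor A T x m = - (\<Sum>l\<in>T - {m}. cofactor A (T - {m}) x l * A l m)"
    if T: "T \<subset> S" "x \<in> T" "m \<in> T" "m \<noteq> x" for T x m
  proof -
    have "T - {m} \<subset> S" using T by blast
    note h' = herm[OF this]
    have "cofactor A T x m = cnj (cofactor A T m x)" using T herm by simp
    also have "\<dots> = - (\<Sum>l\<in>T - {m}. cofactor A (T - {m}) x l * A l m)"
      using T first[of T m x] h'[of _ x]
      by (auto simp: cnj_minus cnj_sum cnj_mult h intro!: sum.cong)
    finally show ?thesis .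
  qed
  \<comment> \<open>split off the first and the last step of the path from \<open>x\<close> to \<open>m\<close>\<close>
  have both: "cofactor A S x m = - (A x m * set_det A (S - {x} - {m})) +
      (\<Sum>j\<in>S - {x} - {m}. \<Sum>i\<in>S - {x} - {m}. A x j * cofactor A (S - {x} - {m}) j i * A i m)"
    if xm: "x \<in> S" "m \<in> S" "m \<noteq> x" for x m
  proof -
    have "cofactor A S x m = - (\<Sum>l\<in>S - {x}. A x l * cofactor A (S - {x}) l m)"
      using first[of S x m] xm by simp
    also have "\<dots> = - (A x m * cofactor A (S - {x}) m m) -
        (\<Sum>l\<in>S - {x} - {m}. A x l * cofactor A (S - {x}) l m)"
      using xm fin by (subst sum.remove[of _ m]) auto
    also have "cofactor A (S - {x}) m m = set_det A (S - {x} - {m})"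
      using diag[of "S - {x}" m] xm by auto
    also have "(\<Sum>l\<in>S - {x} - {m}. A x l * cofactor A (S - {x}) l m) =
        (\<Sum>l\<in>S - {x} - {m}. A x l * - (\<Sum>i\<in>S - {x} - {m}. cofactor A (S - {x} - {m}) l i * A i m))"
      using last[OF sub[OF xm(1)]] xm by (intro sum.cong) auto
    finally show ?thesis by (simp add: sum_distrib_left sum_negf mult.assoc)
  qed
  show H: "cnj (cofactor A S l m) = cofactor A S m l" if lm: "l \<in> S" "m \<in> S" for l m
  proof (cases "l = m")
    case True
    then show ?thesis using diag[of S l] real[OF sub] lm by simp
  next
    case False
    let ?T = "S - {l} - {m}"
    have T: "?T \<subset> S" using lm by blast
    have T': "S - {m} - {l} = ?T" by blast
    have "cnj (cofactor A S l m) = - (set_det A ?T * A m l) +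
        (\<Sum>j\<in>?T. \<Sum>i\<in>?T. A m i * cofactor A ?T i j * A j l)"
      unfolding both[OF lm False[symmetric]] cnj_add cnj_minus cnj_sum cnj_mult h real[OF T]
      using herm[OF T] by (auto simp: mult.assoc intro!: sum.cong)
    also have "\<dots> = cofactor A S m l"
      using both[of m l] lm False selfadjoint_commute[OF real[OF T], of "A m l"]
      unfolding T' by (subst sum.swap) simp
    finally show ?thesis .
  qed
  have lastS: "cofactor A S x m = - (\<Sum>l\<in>S - {m}. cofactor A (S - {m}) x l * A l m)"
    if "x \<in> S" "m \<in> S" "m \<noteq> x" for x m
  proof -
    have "cofactor A S x m = cnj (cofactor A S m x)" using that H by simp
    also have "\<dots> = - (\<Sum>l\<in>S - {m}. cofactor A (S - {m}) x l * A l m)"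
      using that first[of S m x] herm[OF sub, of m]
      by (auto simp: cnj_minus cnj_sum cnj_mult h intro!: sum.cong)
    finally show ?thesis .
  qed
  have colsum: "(\<Sum>l\<in>S. A k l * cofactor A S l m) = A k m * set_det A (S - {m}) -
      (\<Sum>j\<in>S - {m}. (\<Sum>l\<in>S - {m}. A k l * cofactor A (S - {m}) l j) * A j m)"
    if "k \<in> S" "m \<in> S" for k m
  proof -
    have "(\<Sum>l\<in>S. A k l * cofactor A S l m) =
        A k m * cofactor A S m m + (\<Sum>l\<in>S - {m}. A k l * cofactor A S l m)"
      using fin that by (simp add: sum.remove[of S m])
    also have "cofactor A S m m = set_det A (S - {m})" using diag[of S m] that by simp
    also have "(\<Sum>l\<in>S - {m}. A k l * cofactor A S l m) =
        (\<Sum>l\<in>S - {m}. A k l * - (\<Sum>j\<in>S - {m}. cofactor A (S - {m}) l j * A j m))"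
      using lastS that by (intro sum.cong) auto
    also have "\<dots> = - (\<Sum>j\<in>S - {m}. (\<Sum>l\<in>S - {m}. A k l * cofactor A (S - {m}) l j) * A j m)"
      unfolding mult_minus_right sum_negf sum_distrib_left sum_distrib_right
      by (subst sum.swap) (simp add: mult.assoc)
    finally show ?thesis by simp
  qed
  show off: "(\<Sum>l\<in>S. A k l * cofactor A S l m) = 0" if km: "k \<in> S" "m \<in> S" "k \<noteq> m" for k m
  proof -
    have "(\<Sum>j\<in>S - {m}. (\<Sum>l\<in>S - {m}. A k l * cofactor A (S - {m}) l j) * A j m) =
        (\<Sum>j\<in>S - {m}. if j = k then set_det A (S - {m}) * A k m else 0)"
      using cr[OF sub[OF km(2)], of k] km by (intro sum.cong) auto
    also have "\<dots> = A k m * set_det A (S - {m})"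
      using fin km selfadjoint_commute[OF real[OF sub[OF km(2)]], of "A k m"] by simp
    finally show ?thesis using colsum[OF km(1,2)] by simp
  qed
  show border: "d k = A k k * set_det A (S - {k}) -
      (\<Sum>j\<in>S - {k}. \<Sum>l\<in>S - {k}. A k l * cofactor A (S - {k}) l j * A j k)"
    if k: "k \<in> S" for k
    unfolding d_def colsum[OF k k] by (simp add: sum_distrib_right)
  show dreal: "cnj (d k) = d k" if k: "k \<in> S" for k
  proof -
    have "cnj (\<Sum>j\<in>S - {k}. \<Sum>l\<in>S - {k}. A k l * cofactor A (S - {k}) l j * A j k) =
      (\<Sum>j\<in>S - {k}. \<Sum>l\<in>S - {k}. A k l * cofactor A (S - {k}) l j * A j k)"
      using herm[OF sub[OF k]]
      by (subst (2) sum.swap) (auto simp: cnj_sum cnj_mult h mult.assoc intro!: sum.cong)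
    then show ?thesis
      unfolding border[OF k] using selfadjoint_commute[OF real[OF sub[OF k]]]
      by (simp add: cnj_diff cnj_mult h real[OF sub[OF k]])
  qed
  have rowsum: "(\<Sum>l\<in>S. cofactor A S k l * A l m) = (if k = m then d k else 0)"
    if "k \<in> S" "m \<in> S" for k m
  proof -
    have "(\<Sum>l\<in>S. cofactor A S k l * A l m) = cnj (\<Sum>l\<in>S. A m l * cofactor A S l k)"
      using that H by (auto simp: cnj_sum cnj_mult h intro!: sum.cong)
    then show ?thesis using off[of m k] that dreal[of k] by (auto simp: d_def)
  qed
  show "set_det A S = d (Max S)" if "S \<noteq> {}"
  proof -
    have "Max S \<in> S" using that fin by simp
    then show ?thesis
      using cofactor_expansion[of S "Max S" A] rowsum[of "Max S" "Max S"] fin real that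
      by (simp add: set_det_def)
  qed
  show "(d k - d l) * A k l = 0" if kl: "k \<in> S" "l \<in> S" for k l
  proof -
    have "d k * A k l = (\<Sum>j\<in>S. (\<Sum>i\<in>S. A k i * cofactor A S i j) * A j l)"
    proof -
      have "(\<Sum>j\<in>S. (\<Sum>i\<in>S. A k i * cofactor A S i j) * A j l) =
          (\<Sum>j\<in>S. if j = k then d k * A k l else 0)"
        using off kl by (intro sum.cong) (auto simp: d_def)
      then show ?thesis using fin kl by simp
    qed
    also have "\<dots> = (\<Sum>i\<in>S. A k i * (\<Sum>j\<in>S. cofactor A S i j * A j l))"
      unfolding sum_distrib_left sum_distrib_right by (subst sum.swap) (simp add: mult.assoc)
    also have "\<dots> = (\<Sum>i\<in>S. if i = l then A k l * d l else 0)"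
      using rowsum kl by (intro sum.cong) auto
    also have "\<dots> = d l * A k l"
      using fin kl selfadjoint_commute[OF dreal[OF kl(2)], of "A k l"] by simp
    finally show ?thesis by (simp add: left_diff_distrib)
  qed
qed

end

section \<open>Invariance of the determinant under row operations\<close>

lemma quat_inverse:
  assumes "q \<noteq> (0::quat)"
  shows "\<exists>r. q * r = 1 \<and> r * q = 1"
proof -
  define N where "N = qre q ^ 2 + qi q ^ 2 + qj q ^ 2 + qk q ^ 2"
  have "N \<noteq> 0"
    using assms unfolding N_def
    by (auto simp: quat_eq_iff zero_quat_def add_nonneg_eq_0_iff)
  then have N: "x * (y / N) + z = w \<longleftrightarrow> x * y + N * z = N * w" for x y z w
    by (auto simp: field_simps)
  define r where "r = Quat (qre q / N) (- qi q / N) (- qj q / N) (- qk q / N)"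
  have "qre q * qre q / N + qi q * qi q / N + qj q * qj q / N + qk q * qk q / N = 1"
    using \<open>N \<noteq> 0\<close> by (simp add: N_def power2_eq_square flip: add_divide_distrib)
  then have "q * r = 1 \<and> r * q = 1"
    by (simp add: r_def quat_eq_iff times_quat_def one_quat_def)
  then show ?thesis by blast
qed

lemma dquat_inverse:
  assumes "std_part (q::dquat) \<noteq> 0"
  shows "\<exists>r. q * r = 1 \<and> r * q = 1"
proof -
  obtain r where r: "std_part q * r = 1" "r * std_part q = 1"
    using quat_inverse[OF assms] by blast
  define s where "s = Dual r (- (r * dual_part q * r))"
  have "std_part q * (r * dual_part q * r) = dual_part q * r"
    by (metis mult.assoc mult_1_left r(1))
  moreover have "r * dual_part q * r * std_part q = r * dual_part q"
    by (metis mult.assoc mult_1_right r(2))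
  ultimately have "q * s = 1" "s * q = 1"
    using r by (simp_all add: s_def times_dual_def one_dual_def dual_eq_iff)
  then show ?thesis by blast
qed

text \<open>Componentwise continuity in a real parameter, for the perturbation of an entry in Cramer's rule.\<close>

definition cont_quat :: "(real \<Rightarrow> quat) \<Rightarrow> bool" where
  "cont_quat f \<longleftrightarrow> continuous_on UNIV (\<lambda>t. qre (f t)) \<and> continuous_on UNIV (\<lambda>t. qi (f t)) \<and>
     continuous_on UNIV (\<lambda>t. qj (f t)) \<and> continuous_on UNIV (\<lambda>t. qk (f t))"

definition cont :: "(real \<Rightarrow> dquat) \<Rightarrow> bool" where
  "cont f \<longleftrightarrow> cont_quat (\<lambda>t. std_part (f t)) \<and> cont_quat (\<lambda>t. dual_part (f t))"

lemma cont_quat_intros: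
  "cont_quat (\<lambda>t. c)"
  "cont_quat f \<Longrightarrow> cont_quat g \<Longrightarrow> cont_quat (\<lambda>t. f t + g t)"
  "cont_quat f \<Longrightarrow> cont_quat g \<Longrightarrow> cont_quat (\<lambda>t. f t - g t)"
  "cont_quat f \<Longrightarrow> cont_quat g \<Longrightarrow> cont_quat (\<lambda>t. f t * g t)"
  by (auto simp: cont_quat_def plus_quat_def minus_quat_def times_quat_def
      intro!: continuous_intros)

lemma cont_intros:
  "cont (\<lambda>t. c)"
  "cont f \<Longrightarrow> cont g \<Longrightarrow> cont (\<lambda>t. f t + g t)"
  "cont f \<Longrightarrow> cont g \<Longrightarrow> cont (\<lambda>t. f t - g t)"
  "cont f \<Longrightarrow> cont g \<Longrightarrow> cont (\<lambda>t. f t * g t)"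
  by (auto simp: cont_def plus_dual_def minus_dual_def times_dual_def intro!: cont_quat_intros)

lemma cont_sum: "(\<And>i. i \<in> I \<Longrightarrow> cont (f i)) \<Longrightarrow> cont (\<lambda>t. \<Sum>i\<in>I. f i t)"
  by (induction I rule: infinite_finite_induct) (auto intro!: cont_intros)

lemma cont_path_det:
  assumes "\<And>i j. cont (\<lambda>t. A t i j)" "\<And>i. cont (\<lambda>t. c t i)"
  shows "cont (\<lambda>t. path_det (A t) S x (c t))"
  using assms(2)
proof (induction "card S" arbitrary: S x c rule: less_induct)
  case less
  show ?case
  proof (cases "finite S")
    case False
    then show ?thesis by (subst path_det.simps) (simp add: cont_intros)
  next
    case True
    have smaller: "cont (\<lambda>t. path_det (A t) (S - {l}) l (c t))" if "l \<in> S"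
      "\<And>i. cont (\<lambda>t. c t i)" for l c
      using less.hyps[of "S - {l}" c l] that True by (simp add: card_Diff1_less del: card_Diff_insert card_Diff_singleton)
    have "cont (\<lambda>t. set_det (A t) S)"
      using smaller[of "Max S" "\<lambda>t i. A t i (Max S)"] assms(1) True
      by (cases "S = {}") (simp_all add: set_det_def cont_intros)
    then show ?thesis
      unfolding path_det_rec[OF True]
      using smaller less.prems assms(1) by (intro cont_intros cont_sum) auto
  qed
qed

lemma continuous_zero_off_point:
  fixes g :: "real \<Rightarrow> real"
  assumes "continuous_on UNIV g" "\<And>t. t \<noteq> 0 \<Longrightarrow> g t = 0"
  shows "g 0 = 0"
proof -
  have "(g \<longlongrightarrow> g 0) (at 0)" using assms(1) by (simp add: continuous_on_def)
  moreover have "(g \<longlongrightarrow> 0) (at 0)"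
    by (rule Lim_transform_eventually[of "\<lambda>_. 0"])
      (auto simp: eventually_at_filter assms(2))
  ultimately show ?thesis using LIM_unique by blast
qed

lemma cont_zero_off_point:
  assumes "cont f" "\<And>t. t \<noteq> 0 \<Longrightarrow> f t = 0"
  shows "f 0 = 0"
proof -
  have zero: "p (f 0) = 0" if "continuous_on UNIV (\<lambda>t. p (f t))" "p 0 = 0" for p :: "dquat \<Rightarrow> real"
    using continuous_zero_off_point[OF that(1)] assms(2) that(2) by simp
  note c = assms(1)[unfolded cont_def cont_quat_def]
  have "std_part (f 0) = 0"
    using c zero[of "\<lambda>x. qre (std_part x)"] zero[of "\<lambda>x. qi (std_part x)"]
      zero[of "\<lambda>x. qj (std_part x)"] zero[of "\<lambda>x. qk (std_part x)"]
    unfolding quat_eq_iff by (simp add: zero_dual_def zero_quat_def)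
  moreover have "dual_part (f 0) = 0"
    using c zero[of "\<lambda>x. qre (dual_part x)"] zero[of "\<lambda>x. qi (dual_part x)"]
      zero[of "\<lambda>x. qj (dual_part x)"] zero[of "\<lambda>x. qk (dual_part x)"]
    unfolding quat_eq_iff by (simp add: zero_dual_def zero_quat_def)
  ultimately show ?thesis unfolding dual_eq_iff by (simp add: zero_dual_def)
qed

text \<open>By \<open>cramer_step\<close> it remains to see that the diagonal entries \<open>d k\<close> and \<open>d l\<close> agree, and this holds when
the entry at \<open>(k, l)\<close> is invertible. If its standard part vanishes, a nonzero real number added at
\<open>(k, l)\<close> and \<open>(l, k)\<close> makes it invertible, and letting that number tend to \<open>0\<close> gives the claim.\<close>

theorem dquat_cramer:
  assumes "dquat.hermitian_fun A" "finite S"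
  shows "dquat.cramer A S"
  using assms
proof (induction "card S" arbitrary: A S rule: less_induct)
  case less
  have smaller: "dquat.cramer B T" if "dquat.hermitian_fun B" "T \<subset> S" for B T
  proof (rule less.hyps)
    show "card T < card S" by (rule psubset_card_mono[OF less.prems(2) that(2)])
    show "finite T" using that(2) less.prems(2) by (auto intro: finite_subset)
  qed (rule that(1))
  define d where "d B k = (\<Sum>l\<in>S. B k l * cofactor B S l k)" for B :: "nat \<Rightarrow> nat \<Rightarrow> dquat" and k
  have step: "(d B k - d B l) * B k l = 0" if "dquat.hermitian_fun B" "k \<in> S" "l \<in> S" for B k l
    using dquat.cramer_step(6)[OF that(1) less.prems(2) smaller[OF that(1)] that(2,3)]
    by (simp add: d_def)
  have unit: "d B k = d B l"
    if "dquat.hermitian_fun B" "k \<in> S" "l \<in> S" "std_part (B k l) \<noteq> 0" for B k l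
  proof -
    have "\<exists>r. B k l * r = 1" using dquat_inverse[of "B k l"] that by blast
    then obtain r where "B k l * r = 1" ..
    then have "d B k - d B l = (d B k - d B l) * B k l * r" by (simp add: mult.assoc)
    then show ?thesis using step[OF that(1-3)] by simp
  qed
  have eq: "d A k = d A l" if kl: "k \<in> S" "l \<in> S" for k l
  proof (cases "k = l \<or> std_part (A k l) \<noteq> 0")
    case True
    then show ?thesis using unit less.prems kl by blast
  next
    case False
    define B where "B t i j = A i j + (if (i = k \<and> j = l) \<or> (i = l \<and> j = k)
      then Dual (Quat t 0 0 0) 0 else 0)" for t i j
    have hB: "dquat.hermitian_fun (B t)" for t
      using less.prems(1)
      by (auto simp: dquat.hermitian_fun_def B_def dquat.cnj_add)
        (auto simp: dqcnj_def qcnj_def zero_quat_def)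
    have "std_part (B t k l) \<noteq> 0" if "t \<noteq> 0" for t
      using that False by (simp add: B_def plus_dual_def zero_quat_def plus_quat_def)
    then have off: "d (B t) k - d (B t) l = 0" if "t \<noteq> 0" for t
      using unit[OF hB kl] that by simp
    have contB: "cont (\<lambda>t. B t i j)" for i j
    proof -
      have "cont (\<lambda>t. Dual (Quat t 0 0 0) 0)"
        by (simp add: cont_def cont_quat_def zero_quat_def)
      then have "cont (\<lambda>t. if b then Dual (Quat t 0 0 0) 0 else 0)" for b
        by (cases b) (simp_all add: cont_intros)
      then show ?thesis unfolding B_def by (intro cont_intros)
    qed
    have "cont (\<lambda>t. d (B t) k - d (B t) l)"
      unfolding d_def cofactor_def by (intro cont_intros cont_sum cont_path_det contB)
    then have "d (B 0) k - d (B 0) l = 0" using off by (rule cont_zero_off_point)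
    moreover have "B 0 = A"
      by (auto simp: B_def fun_eq_iff dual_eq_iff plus_dual_def zero_dual_def zero_quat_def
          plus_quat_def quat_eq_iff)
    ultimately show ?thesis by simp
  qed
  note c = dquat.cramer_step[OF less.prems smaller[OF less.prems(1)]]
  have det: "set_det A S = d A k" if "k \<in> S" for k
  proof -
    have ne: "S \<noteq> {}" using that by blast
    have "Max S \<in> S" by (rule Max_in[OF less.prems(2) ne])
    then show ?thesis using c(5) ne eq[OF that, of "Max S"] by (simp add: d_def)
  qed
  have real: "dqcnj (set_det A S) = set_det A S"
  proof (cases "S = {}")
    case False
    then obtain k where "k \<in> S" by blast
    then show ?thesis using c(3)[of k] det[of k] by (simp add: d_def)
  qed simp
  show ?case
    unfolding dquat.cramer_def using real c(1,2) det by (auto simp: d_def)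
qed

lemma path_det_cong:
  assumes "\<And>i j. i \<in> insert x S \<Longrightarrow> j \<in> S \<Longrightarrow> A i j = B i j"
    and "\<And>i. i \<in> insert x S \<Longrightarrow> c i = d i"
  shows "path_det A S x c = path_det B S x d"
  using assms
proof (induction "card S" arbitrary: S x c d rule: less_induct)
  case less
  show ?case
  proof (cases "finite S")
    case False
    then have "path_det E S x e = 0" for E :: "nat \<Rightarrow> nat \<Rightarrow> 'a" and e
      by (subst path_det.simps) (simp only: if_False)
    then show ?thesis by simp
  next
    case True
    have smaller: "path_det A (S - {l}) l c = path_det B (S - {l}) l d"
      if l: "l \<in> S" and col: "\<And>i. i \<in> S \<Longrightarrow> c i = d i" for l c d
    proof (rule less.hyps)
      show "card (S - {l}) < card S" by (rule card_Diff1_less[OF True l])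
    next
      fix i j assume "i \<in> insert l (S - {l})" "j \<in> S - {l}"
      then have "i \<in> insert x S" "j \<in> S" using l by blast+
      then show "A i j = B i j" by (rule less.prems(1))
    next
      fix i assume "i \<in> insert l (S - {l})"
      then have "i \<in> S" using l by blast
      then show "c i = d i" by (rule col)
    qed
    have "set_det A S = set_det B S"
    proof (cases "S = {}")
      case False
      then have "Max S \<in> S" by (rule Max_in[OF True])
      then have "path_det A (S - {Max S}) (Max S) (\<lambda>i. A i (Max S)) =
          path_det B (S - {Max S}) (Max S) (\<lambda>i. B i (Max S))"
      proof (rule smaller)
        fix i assume "i \<in> S"
        then have "i \<in> insert x S" by simp
        then show "A i (Max S) = B i (Max S)" using \<open>Max S \<in> S\<close> by (rule less.prems(1))
      qed
      then show ?thesis using False by (simp only: set_det_def if_False)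
    qed simp
    moreover have "(\<Sum>l\<in>S. A x l * path_det A (S - {l}) l c) = (\<Sum>l\<in>S. B x l * path_det B (S - {l}) l d)"
    proof (rule sum.cong)
      fix l assume l: "l \<in> S"
      have "path_det A (S - {l}) l c = path_det B (S - {l}) l d"
        by (rule smaller[OF l], rule less.prems(2), rule insertI2)
      moreover have "A x l = B x l" by (rule less.prems(1)[OF insertI1 l])
      ultimately show "A x l * path_det A (S - {l}) l c = B x l * path_det B (S - {l}) l d"
        by (simp only:)
    qed (rule refl)
    moreover have "c x = d x" by (rule less.prems(2)[OF insertI1])
    ultimately show ?thesis unfolding path_det_rec[OF True] by (simp only:)
  qed
qed

lemma set_det_cong:
  assumes "\<And>i j. i \<in> S \<Longrightarrow> j \<in> S \<Longrightarrow> A i j = B i j" "finite S"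
  shows "set_det A S = set_det B S"
proof (cases "S = {}")
  case False
  then have "Max S \<in> S" using assms(2) by simp
  then show ?thesis using assms(1) False by (auto simp: set_det_def intro!: path_det_cong)
qed simp

lemma cofactor_cong:
  assumes "\<And>i j. i \<in> S \<Longrightarrow> j \<in> S \<Longrightarrow> A i j = B i j" "l \<in> S"
  shows "cofactor A S l m = cofactor B S l m"
  using assms by (auto simp: cofactor_def intro!: path_det_cong)

text \<open>Expansion at an arbitrary index, where the definition only allows the largest one.\<close>

lemma set_det_bordered:
  assumes A: "dquat.hermitian_fun A" and "finite T" "i \<notin> T"
  shows "set_det A (insert i T) = A i i * set_det A T -
    (\<Sum>j\<in>T. (\<Sum>l\<in>T. A i l * cofactor A T l j) * A j i)"
proof -
  let ?S = "insert i T"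
  have c: "dquat.cramer A U" if "U \<subset> ?S" for U
    using that assms finite_subset by (intro dquat_cramer) auto
  have "set_det A ?S = (\<Sum>l\<in>?S. A i l * cofactor A ?S l i)"
    using dquat_cramer[OF A, of ?S] assms by (simp add: dquat.cramer_def)
  also have "\<dots> = A i i * set_det A T - (\<Sum>j\<in>T. (\<Sum>l\<in>T. A i l * cofactor A T l j) * A j i)"
    using dquat.cramer_step(4)[OF A _ c, of ?S i] assms by (simp add: sum_distrib_right)
  finally show ?thesis .
qed

text \<open>Adding a combination \<open>y\<close> of the other rows to row \<open>i\<close>, and likewise for the columns, shifts the argument
\<open>u\<close> of the Hermitian form \<open>u C u\<^sup>*\<close> in the bordered expansion. Since \<open>C\<close> is inverse to the inner block up to its
determinant, the extra terms are those by which the corner entry grows.\<close>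

lemma set_det_row_add:
  fixes y :: "nat \<Rightarrow> dquat"
  assumes A: "dquat.hermitian_fun A" and B: "dquat.hermitian_fun B"
    and T: "finite T" "i \<notin> T"
    and inner: "\<And>a b. a \<in> T \<Longrightarrow> b \<in> T \<Longrightarrow> B a b = A a b"
    and row: "\<And>b. b \<in> T \<Longrightarrow> B i b = A i b + (\<Sum>c\<in>T. y c * A c b)"
    and corner: "B i i = A i i + (\<Sum>c\<in>T. y c * A c i) + (\<Sum>c\<in>T. A i c * dqcnj (y c)) +
      (\<Sum>c\<in>T. \<Sum>b\<in>T. y c * A c b * dqcnj (y b))"
  shows "set_det B (insert i T) = set_det A (insert i T)"
proof -
  define D where "D = set_det A T"
  define C where "C = cofactor A T"
  have cr: "dquat.cramer A T" using A T by (intro dquat_cramer)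
  have D: "D * x = x * D" for x
    using cr dquat.selfadjoint_commute by (simp add: dquat.cramer_def D_def)
  have h: "dqcnj (A a b) = A b a" for a b using A by (simp add: dquat.hermitian_fun_def)
  have hC: "dqcnj (C a b) = C b a" if "a \<in> T" "b \<in> T" for a b
    using cr that by (simp add: dquat.cramer_def C_def)
  have AC: "(\<Sum>l\<in>T. A c l * C l j) = (if c = j then D else 0)" if "c \<in> T" "j \<in> T" for c j
    using cr that by (simp add: dquat.cramer_def C_def D_def)
  have CA: "(\<Sum>j\<in>T. C l j * A j c) = (if l = c then D else 0)" if "l \<in> T" "c \<in> T" for c l
  proof -
    have "(\<Sum>j\<in>T. C l j * A j c) = dqcnj (\<Sum>j\<in>T. A c j * C j l)"
      using that by (auto simp: dquat.cnj_sum dquat.cnj_mult h hC intro!: sum.cong)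
    moreover have "dqcnj D = D" using cr by (simp add: dquat.cramer_def D_def)
    ultimately show ?thesis using AC[OF that(2,1)] by auto
  qed
  have yD: "y j * D * z = y j * z * D" for j z by (simp only: mult.assoc D)
  define u where "u j = (\<Sum>l\<in>T. A i l * C l j)" for j
  have uA: "(\<Sum>j\<in>T. u j * A j c) = A i c * D" if "c \<in> T" for c
  proof -
    have "(\<Sum>j\<in>T. u j * A j c) = (\<Sum>l\<in>T. A i l * (\<Sum>j\<in>T. C l j * A j c))"
      unfolding u_def sum_distrib_left sum_distrib_right by (subst sum.swap) (simp add: mult.assoc)
    also have "\<dots> = (\<Sum>l\<in>T. if l = c then A i c * D else 0)"
      using CA that by (intro sum.cong) auto
    finally show ?thesis using T that by simp
  qed
  have uB: "(\<Sum>l\<in>T. B i l * C l j) = u j + y j * D" if "j \<in> T" for j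
  proof -
    have "(\<Sum>l\<in>T. B i l * C l j) = u j + (\<Sum>l\<in>T. (\<Sum>c\<in>T. y c * A c l) * C l j)"
      using row by (simp add: u_def distrib_right sum.distrib cong: sum.cong)
    also have "(\<Sum>l\<in>T. (\<Sum>c\<in>T. y c * A c l) * C l j) = (\<Sum>c\<in>T. y c * (\<Sum>l\<in>T. A c l * C l j))"
      unfolding sum_distrib_left sum_distrib_right by (subst sum.swap) (simp add: mult.assoc)
    also have "\<dots> = (\<Sum>c\<in>T. if c = j then y j * D else 0)"
      using AC that by (intro sum.cong) auto
    finally show ?thesis using T that by simp
  qed
  have col: "B j i = A j i + (\<Sum>c\<in>T. A j c * dqcnj (y c))" if "j \<in> T" for j
  proof -
    have "B j i = dqcnj (B i j)" using B by (simp add: dquat.hermitian_fun_def)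
    then show ?thesis using row[OF that] by (simp add: dquat.cnj_add dquat.cnj_sum dquat.cnj_mult h)
  qed
  have incr: "B i i - A i i = (\<Sum>c\<in>T. y c * A c i) + (\<Sum>c\<in>T. A i c * dqcnj (y c)) +
      (\<Sum>c\<in>T. \<Sum>b\<in>T. y c * A c b * dqcnj (y b))"
    by (simp add: corner add.assoc)
  have "(\<Sum>j\<in>T. (\<Sum>l\<in>T. B i l * C l j) * B j i) =
      (\<Sum>j\<in>T. (u j + y j * D) * (A j i + (\<Sum>c\<in>T. A j c * dqcnj (y c))))"
    using uB col by (intro sum.cong) auto
  also have "\<dots> = (\<Sum>j\<in>T. u j * A j i) + (\<Sum>j\<in>T. u j * (\<Sum>c\<in>T. A j c * dqcnj (y c))) +
      (\<Sum>j\<in>T. y j * D * A j i) + (\<Sum>j\<in>T. y j * D * (\<Sum>c\<in>T. A j c * dqcnj (y c)))"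
    by (simp add: distrib_left distrib_right sum.distrib add.assoc)
  also have "(\<Sum>j\<in>T. u j * (\<Sum>c\<in>T. A j c * dqcnj (y c))) = (\<Sum>c\<in>T. (\<Sum>j\<in>T. u j * A j c) * dqcnj (y c))"
    unfolding sum_distrib_left sum_distrib_right by (subst sum.swap) (simp add: mult.assoc)
  also have "\<dots> = (\<Sum>c\<in>T. A i c * dqcnj (y c)) * D"
    using uA by (simp add: sum_distrib_right mult.assoc D[of "dqcnj _"] cong: sum.cong)
  also have "(\<Sum>j\<in>T. y j * D * A j i) = (\<Sum>j\<in>T. y j * A j i) * D"
    by (simp only: sum_distrib_right yD)
  also have "(\<Sum>j\<in>T. y j * D * (\<Sum>c\<in>T. A j c * dqcnj (y c))) =
      (\<Sum>c\<in>T. \<Sum>b\<in>T. y c * A c b * dqcnj (y b)) * D"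
    unfolding yD by (simp add: sum_distrib_left sum_distrib_right mult.assoc)
  finally have "(\<Sum>j\<in>T. (\<Sum>l\<in>T. B i l * C l j) * B j i) =
     (\<Sum>j\<in>T. u j * A j i) + (B i i - A i i) * D"
    unfolding incr by (simp only: distrib_right add_ac)
  moreover have "set_det B (insert i T) = B i i * D - (\<Sum>j\<in>T. (\<Sum>l\<in>T. B i l * C l j) * B j i)"
  proof -
    have "set_det B T = D" unfolding D_def using inner T by (intro set_det_cong)
    moreover have "cofactor B T l j = C l j" if "l \<in> T" for l j
      unfolding C_def using inner that by (intro cofactor_cong)
    ultimately show ?thesis
      unfolding set_det_bordered[OF B T] by (simp cong: sum.cong)
  qed
  moreover have "set_det A (insert i T) = A i i * D - (\<Sum>j\<in>T. u j * A j i)"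
    unfolding set_det_bordered[OF A T] D_def u_def C_def ..
  ultimately show ?thesis by (simp add: left_diff_distrib)
qed

section \<open>Simultaneous diagonalization by elementary congruences\<close>

definition unit :: "'a::ring_1 \<Rightarrow> bool" where
  "unit a \<longleftrightarrow> (\<exists>b. a * b = 1 \<and> b * a = 1)"

text \<open>The identity matrix with \<open>y\<close> added to row \<open>i\<close>. It is unipotent if \<open>y i = 0\<close>.\<close>

definition row_add :: "nat \<Rightarrow> nat \<Rightarrow> (nat \<Rightarrow> 'a::ring_1) \<Rightarrow> 'a mat" where
  "row_add n i y = mat n n (\<lambda>(a, b). (if a = b then 1 else 0) + (if a = i then y b else 0))"

lemma row_add_carrier [simp]: "row_add n i y \<in> carrier_mat n n"
  by (simp add: row_add_def)

lemma row_add_mult_carrier [simp]: "M \<in> carrier_mat n k \<Longrightarrow> row_add n i y * M \<in> carrier_mat n k"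
  by (rule mult_carrier_mat[OF row_add_carrier])

lemma mult_mat_entry:
  assumes "A \<in> carrier_mat l m" "B \<in> carrier_mat m k" "a < l" "b < k"
  shows "(A * B) $$ (a, b) = (\<Sum>c<m. A $$ (a, c) * B $$ (c, b))"
  using assms by (auto simp: scalar_prod_def lessThan_atLeast0 intro!: sum.cong)

lemma row_add_mult:
  assumes "M \<in> carrier_mat n k" "a < n" "b < k"
  shows "(row_add n i y * M) $$ (a, b) = M $$ (a, b) + (if a = i then \<Sum>c<n. y c * M $$ (c, b) else 0)"
proof -
  have "(\<Sum>c<n. (if a = c then 1 else 0) * M $$ (c, b)) = (\<Sum>c<n. if c = a then M $$ (a, b) else 0)"
    by (intro sum.cong) auto
  then show ?thesis
    using assms
    by (subst mult_mat_entry[of _ n n _ k])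
      (auto simp: row_add_def distrib_right sum.distrib sum.delta')
qed

text \<open>Products of row operations that involve only the indices in \<open>S\<close>. Recording the factorization, and not
just invertibility, is what lets invariance of the determinant pass from \<open>S - {i}\<close> to \<open>S\<close>.\<close>

inductive elementary_prod :: "nat \<Rightarrow> nat set \<Rightarrow> 'a::ring_1 mat \<Rightarrow> bool" for n S where
  one: "elementary_prod n S (1\<^sub>m n)"
| step: "elementary_prod n S P \<Longrightarrow> i \<in> S \<Longrightarrow> i < n \<Longrightarrow> (\<And>b. b \<notin> S - {i} \<Longrightarrow> y b = 0) \<Longrightarrow>
    elementary_prod n S (row_add n i y * P)"

lemma elementary_prod_carrier: "elementary_prod n S P \<Longrightarrow> P \<in> carrier_mat n n"
  by (induction rule: elementary_prod.induct) simp_all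

lemma elementary_prod_mult:
  assumes "elementary_prod n S P" "elementary_prod n S Q"
  shows "elementary_prod n S (P * Q)"
  using assms
proof (induction rule: elementary_prod.induct)
  case one
  then show ?case using elementary_prod_carrier by fastforce
next
  case (step P i y)
  have "row_add n i y * P * Q = row_add n i y * (P * Q)"
    using step elementary_prod_carrier by (intro assoc_mult_mat[of _ n n _ n _ n]) auto
  then show ?case using step elementary_prod.step by metis
qed

lemma elementary_prod_mono:
  assumes "elementary_prod n S P" "S \<subseteq> T"
  shows "elementary_prod n T P"
  using assms by (induction rule: elementary_prod.induct) (auto intro!: elementary_prod.intros)

lemma elementary_prod_row_add:
  assumes "i \<in> S" "i < n" "\<And>b. b \<notin> S - {i} \<Longrightarrow> y b = 0"
  shows "elementary_prod n S (row_add n i y)"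
  using elementary_prod.step[OF elementary_prod.one, of i S n y] assms
  unfolding right_mult_one_mat[OF row_add_carrier] by auto

lemma elementary_prod_entry:
  assumes "elementary_prod n S P" "a < n" "b < n" "a \<notin> S \<or> b \<notin> S"
  shows "P $$ (a, b) = (if a = b then 1 else 0)"
  using assms
proof (induction arbitrary: a b rule: elementary_prod.induct)
  case one
  then show ?case by simp
next
  case (step P i y)
  have "(\<Sum>c<n. y c * P $$ (c, b)) = 0" if "b \<notin> S"
  proof (rule sum.neutral, rule ballI)
    fix c assume "c \<in> {..<n}"
    then show "y c * P $$ (c, b) = 0"
      using step.IH[of c b] step.hyps(4)[of c] step.prems that by (cases "c \<in> S") auto
  qed
  then show ?case
    using step.prems step.IH[of a b] step.hyps elementary_prod_carrier[OF step.hyps(1)]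
    by (auto simp: row_add_mult)
qed

lemma row_add_inverse:
  assumes "y i = 0" "i < n"
  shows "row_add n i y * row_add n i (\<lambda>b. - y b) = 1\<^sub>m n"
proof (rule eq_matI)
  fix a b assume ab: "a < dim_row (1\<^sub>m n :: 'a mat)" "b < dim_col (1\<^sub>m n :: 'a mat)"
  have "(\<Sum>c<n. y c * row_add n i (\<lambda>b. - y b) $$ (c, b)) = (\<Sum>c<n. if c = b then y b else 0)"
    using ab assms by (intro sum.cong) (auto simp: row_add_def)
  then show "(row_add n i y * row_add n i (\<lambda>b. - y b)) $$ (a, b) = 1\<^sub>m n $$ (a, b)"
    using ab assms by (subst row_add_mult[where k = n]) (auto simp: row_add_def)
qed (simp_all add: row_add_def)

lemma elementary_prod_inverse:
  assumes "elementary_prod n S P"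
  shows "\<exists>Q. elementary_prod n S Q \<and> P * Q = 1\<^sub>m n \<and> Q * P = 1\<^sub>m n"
  using assms
proof (induction rule: elementary_prod.induct)
  case one
  show ?case by (rule exI[of _ "1\<^sub>m n"]) (simp add: elementary_prod.one)
next
  case (step P i y)
  then obtain Q where Q: "elementary_prod n S Q" "P * Q = 1\<^sub>m n" "Q * P = 1\<^sub>m n" by blast
  let ?R = "row_add n i y" and ?R' = "row_add n i (\<lambda>b. - y b)"
  have y: "y i = 0" using step by simp
  have RR: "?R * ?R' = 1\<^sub>m n" "?R' * ?R = 1\<^sub>m n"
    using row_add_inverse[of y i n] row_add_inverse[of "\<lambda>b. - y b" i n] y step by simp_all
  have c: "P \<in> carrier_mat n n" "Q \<in> carrier_mat n n" "?R \<in> carrier_mat n n" "?R' \<in> carrier_mat n n"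
    using step Q elementary_prod_carrier by auto
  have e: "elementary_prod n S (Q * ?R')"
    using step by (intro elementary_prod_mult Q elementary_prod_row_add) auto
  have "?R * P * (Q * ?R') = ?R * (P * Q) * ?R'"
    using c by (simp add: assoc_mult_mat[of _ n n _ n _ n] mult_carrier_mat[of _ n n _ n])
  then have 1: "?R * P * (Q * ?R') = 1\<^sub>m n" using RR Q right_mult_one_mat[OF c(3)] by simp
  have "Q * ?R' * (?R * P) = Q * (?R' * ?R) * P"
    using c by (simp add: assoc_mult_mat[of _ n n _ n _ n] mult_carrier_mat[of _ n n _ n])
  then have 2: "Q * ?R' * (?R * P) = 1\<^sub>m n" using RR Q right_mult_one_mat[OF c(2)] by simp
  show ?case using e 1 2 by blast
qed

text \<open>The operation that clears column \<open>i\<close> below and above a pivot: multiples of row \<open>i\<close> are added to all rows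
in \<open>T\<close> at once.\<close>

definition col_add :: "nat \<Rightarrow> nat \<Rightarrow> nat set \<Rightarrow> (nat \<Rightarrow> 'a::ring_1) \<Rightarrow> 'a mat" where
  "col_add n i T z = mat n n (\<lambda>(a, b). (if a = b then 1 else 0) + (if b = i \<and> a \<in> T then z a else 0))"

lemma col_add_carrier [simp]: "col_add n i T z \<in> carrier_mat n n"
  by (simp add: col_add_def)

lemma col_add_mult_carrier [simp]: "M \<in> carrier_mat n k \<Longrightarrow> col_add n i T z * M \<in> carrier_mat n k"
  by (rule mult_carrier_mat[OF col_add_carrier])

lemma elementary_prod_col_add:
  assumes "finite T" "T \<subseteq> S - {i}" "S \<subseteq> {..<n}" "i \<in> S"
  shows "elementary_prod n S (col_add n i T z)"
  using assms(1,2)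
proof (induction T)
  case empty
  have "col_add n i {} z = 1\<^sub>m n" by (rule eq_matI) (auto simp: col_add_def)
  then show ?case by (simp add: elementary_prod.one)
next
  case (insert j T)
  have j: "j \<in> S" "j < n" "j \<noteq> i" "i < n" using insert assms by auto
  let ?y = "\<lambda>b. if b = i then z j else 0"
  have "col_add n i (insert j T) z = row_add n j ?y * col_add n i T z"
  proof (rule eq_matI)
    fix a b assume "a < dim_row (row_add n j ?y * col_add n i T z)"
      "b < dim_col (row_add n j ?y * col_add n i T z)"
    then have ab: "a < n" "b < n" by (simp_all add: row_add_def col_add_def)
    have "(\<Sum>c<n. ?y c * col_add n i T z $$ (c, b)) =
        (\<Sum>c<n. if c = i then z j * col_add n i T z $$ (i, b) else 0)"
      by (intro sum.cong) auto
    then show "col_add n i (insert j T) z $$ (a, b) = (row_add n j ?y * col_add n i T z) $$ (a, b)"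
      using ab insert j by (subst row_add_mult[where k = n]) (auto simp: col_add_def)
  qed (simp_all add: row_add_def col_add_def)
  moreover have "elementary_prod n S (row_add n j ?y)"
    using j assms by (intro elementary_prod_row_add) auto
  ultimately show ?case using insert elementary_prod_mult by auto
qed

lemma col_add_mult:
  assumes "M \<in> carrier_mat n k" "a < n" "b < k" "i < n"
  shows "(col_add n i T z * M) $$ (a, b) = M $$ (a, b) + (if a \<in> T then z a * M $$ (i, b) else 0)"
proof -
  have "(\<Sum>c<n. (if a = c then 1 else 0) * M $$ (c, b)) = (\<Sum>c<n. if c = a then M $$ (a, b) else 0)"
    by (intro sum.cong) auto
  moreover have "(\<Sum>c<n. (if c = i \<and> a \<in> T then z a else 0) * M $$ (c, b)) =
      (\<Sum>c<n. if c = i then (if a \<in> T then z a * M $$ (i, b) else 0) else 0)"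
    by (intro sum.cong) auto
  ultimately show ?thesis
    using assms
    by (subst mult_mat_entry[of _ n n _ k])
      (auto simp: col_add_def distrib_right sum.distrib)
qed

context central_star_ring
begin

definition adj :: "'a mat \<Rightarrow> 'a mat" where
  "adj A = mat (dim_col A) (dim_row A) (\<lambda>(i, j). cnj (A $$ (j, i)))"

lemma adj_carrier [simp]: "A \<in> carrier_mat n m \<Longrightarrow> adj A \<in> carrier_mat m n"
  by (auto simp: adj_def)

lemma adj_entry: "A \<in> carrier_mat n m \<Longrightarrow> a < m \<Longrightarrow> b < n \<Longrightarrow> adj A $$ (a, b) = cnj (A $$ (b, a))"
  by (auto simp: adj_def)

lemma adj_adj [simp]: "adj (adj A) = A"
  by (rule eq_matI) (auto simp: adj_def)

lemma adj_mult:
  assumes "A \<in> carrier_mat l m" "B \<in> carrier_mat m k"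
  shows "adj (A * B) = adj B * adj A"
proof (rule eq_matI)
  note c = assms adj_carrier[OF assms(1)] adj_carrier[OF assms(2)]
  fix a b assume "a < dim_row (adj B * adj A)" "b < dim_col (adj B * adj A)"
  then have ab: "a < k" "b < l" using c by auto
  have "adj (A * B) $$ (a, b) = cnj ((A * B) $$ (b, a))"
    using ab assms by (intro adj_entry[of _ l k]) auto
  also have "\<dots> = (adj B * adj A) $$ (a, b)"
    unfolding mult_mat_entry[OF assms ab(2,1)] mult_mat_entry[OF c(4,3) ab]
    using ab assms by (auto simp: cnj_sum cnj_mult adj_entry intro!: sum.cong)
  finally show "adj (A * B) $$ (a, b) = (adj B * adj A) $$ (a, b)" .
qed (use assms in \<open>auto simp: adj_def\<close>)

lemma adj_one [simp]: "adj (1\<^sub>m n) = 1\<^sub>m n"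
  by (rule eq_matI) (auto simp: adj_def)

definition hermitian :: "nat \<Rightarrow> 'a mat \<Rightarrow> bool" where
  "hermitian n A \<longleftrightarrow> A \<in> carrier_mat n n \<and> adj A = A"

lemma hermitian_carrier: "hermitian n A \<Longrightarrow> A \<in> carrier_mat n n"
  by (simp add: hermitian_def)

lemma hermitian_entry: "hermitian n A \<Longrightarrow> a < n \<Longrightarrow> b < n \<Longrightarrow> cnj (A $$ (a, b)) = A $$ (b, a)"
  using adj_entry[of A n n b a] by (simp add: hermitian_def)

definition congr :: "'a mat \<Rightarrow> 'a mat \<Rightarrow> 'a mat" where
  "congr P M = P * M * adj P"

lemma congr_carrier: "P \<in> carrier_mat k n \<Longrightarrow> M \<in> carrier_mat n n \<Longrightarrow> congr P M \<in> carrier_mat k k"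
  by (auto simp: congr_def intro: mult_carrier_mat)

lemma congr_congr:
  assumes "P \<in> carrier_mat k n" "Q \<in> carrier_mat n n" "M \<in> carrier_mat n n"
  shows "congr P (congr Q M) = congr (P * Q) M"
proof -
  have "adj P \<in> carrier_mat n k" "adj Q \<in> carrier_mat n n" using assms by auto
  then have "P * (Q * M * adj Q) * adj P = P * Q * M * (adj Q * adj P)"
    using assms
    by (simp add: assoc_mult_mat[of _ k n _ n _ n] assoc_mult_mat[of _ k n _ n _ k]
        assoc_mult_mat[of _ n n _ n _ n] assoc_mult_mat[of _ n n _ n _ k]
        mult_carrier_mat[of _ k n _ n] mult_carrier_mat[of _ n n _ n] mult_carrier_mat[of _ n n _ k])
  then show ?thesis using assms by (simp add: congr_def adj_mult[of P k n Q n])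
qed

lemma hermitian_congr:
  assumes "P \<in> carrier_mat k n" "hermitian n M"
  shows "hermitian k (congr P M)"
proof -
  have M: "M \<in> carrier_mat n n" "adj M = M" using assms by (auto simp: hermitian_def)
  have "adj P \<in> carrier_mat n k" using assms by auto
  then have "adj (congr P M) = congr P M"
    using assms M
    by (simp add: congr_def adj_mult[of P k n "M * adj P" k] adj_mult[of M n n "adj P" k]
        assoc_mult_mat[of _ k n _ n _ k] mult_carrier_mat[of _ k n _ n] mult_carrier_mat[of _ n n _ k])
  then show ?thesis using congr_carrier[OF assms(1) M(1)] by (simp add: hermitian_def)
qed

lemma mult_adj_row_add:
  assumes "M \<in> carrier_mat k n" "a < k" "b < n"
  shows "(M * adj (row_add n i y)) $$ (a, b) =
    M $$ (a, b) + (if b = i then \<Sum>c<n. M $$ (a, c) * cnj (y c) else 0)"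
proof -
  have "(M * adj (row_add n i y)) = adj (row_add n i y * adj M)"
    using assms by (simp add: adj_mult[of _ n n _ k])
  moreover have "adj (row_add n i y * adj M) $$ (a, b) = cnj ((row_add n i y * adj M) $$ (b, a))"
    using assms by (intro adj_entry[of _ n k]) (auto intro: mult_carrier_mat)
  ultimately show ?thesis
    using assms by (auto simp: row_add_mult[where k = k] cnj_add cnj_sum cnj_mult adj_entry intro!: sum.cong)
qed

lemma mult_adj_col_add:
  assumes "M \<in> carrier_mat k n" "a < k" "b < n" "i < n"
  shows "(M * adj (col_add n i T z)) $$ (a, b) =
    M $$ (a, b) + (if b \<in> T then M $$ (a, i) * cnj (z b) else 0)"
proof -
  have "(M * adj (col_add n i T z)) = adj (col_add n i T z * adj M)"
    using assms by (simp add: adj_mult[of _ n n _ k])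
  moreover have "adj (col_add n i T z * adj M) $$ (a, b) = cnj ((col_add n i T z * adj M) $$ (b, a))"
    using assms by (intro adj_entry[of _ n k]) (auto intro: mult_carrier_mat)
  ultimately show ?thesis
    using assms by (auto simp: col_add_mult[where k = k] cnj_add cnj_mult adj_entry)
qed

definition diag_on :: "nat set \<Rightarrow> 'a mat \<Rightarrow> bool" where
  "diag_on S M \<longleftrightarrow> (\<forall>i\<in>S. \<forall>j\<in>S. i \<noteq> j \<longrightarrow> M $$ (i, j) = 0)"

text \<open>Vectors are kept as rows, since an eigenvector is going to be a row of the transforming matrix. The
unit entry replaces being nonzero: over the dual quaternions it says that the standard part is
nonzero.\<close>

definition row_on :: "nat \<Rightarrow> nat set \<Rightarrow> 'a mat \<Rightarrow> bool" where
  "row_on n S w \<longleftrightarrow> w \<in> carrier_mat 1 n \<and> (\<forall>j<n. j \<notin> S \<longrightarrow> w $$ (0, j) = 0) \<and>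
     (\<exists>i\<in>S. unit (w $$ (0, i)))"

text \<open>The eigenvalue equation of the pencil \<open>(A, B)\<close> restricted to the block \<open>S\<close>, in row form.\<close>

definition eigenpair :: "nat \<Rightarrow> nat set \<Rightarrow> 'a mat \<Rightarrow> 'a mat \<Rightarrow> 'a mat \<Rightarrow> 'a \<Rightarrow> bool" where
  "eigenpair n S A B w \<mu> \<longleftrightarrow> row_on n S w \<and> cnj \<mu> = \<mu> \<and>
     (\<forall>j\<in>S. (w * A) $$ (0, j) = \<mu> * (w * B) $$ (0, j))"

end

text \<open>The nonunits are closed under sums and right multiples, as they are over a division ring and over its
dual numbers. The predicate \<open>pos\<close> singles out
the values that a positive definite form may take.\<close>

locale local_star_ring = central_star_ring cnj for cnj :: "'a::ring_1 \<Rightarrow> 'a" +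
  fixes pos :: "'a \<Rightarrow> bool"
  assumes pos_unit: "pos a \<Longrightarrow> unit a"
    and nonunit_add: "\<not> unit a \<Longrightarrow> \<not> unit b \<Longrightarrow> \<not> unit (a + b)"
    and nonunit_mult: "\<not> unit a \<Longrightarrow> \<not> unit (a * b)"
begin

definition posdef :: "nat \<Rightarrow> nat set \<Rightarrow> 'a mat \<Rightarrow> bool" where
  "posdef n S B \<longleftrightarrow> (\<forall>w. row_on n S w \<longrightarrow> pos (congr w B $$ (0, 0)))"

lemma nonunit_zero: "\<not> unit (0 :: 'a)"
  by (simp add: unit_def)

lemma nonunit_sum: "(\<And>i. i \<in> I \<Longrightarrow> \<not> unit (f i)) \<Longrightarrow> \<not> unit (sum f I :: 'a)"
  by (induction I rule: infinite_finite_induct) (auto simp: nonunit_zero nonunit_add)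

text \<open>An invertible matrix cannot turn a row with a unit entry into one without, because the inverse would
express each unit by nonunits.\<close>

lemma row_on_mult:
  assumes "row_on n S w" "elementary_prod n S P" "S \<subseteq> {..<n}"
  shows "row_on n S (w * P)"
proof -
  have w: "w \<in> carrier_mat 1 n" "\<And>j. j < n \<Longrightarrow> j \<notin> S \<Longrightarrow> w $$ (0, j) = 0"
    using assms(1) by (auto simp: row_on_def)
  obtain i where i: "i \<in> S" "unit (w $$ (0, i))" using assms(1) by (auto simp: row_on_def)
  have P: "P \<in> carrier_mat n n" by (rule elementary_prod_carrier[OF assms(2)])
  obtain Q where Q: "elementary_prod n S Q" "P * Q = 1\<^sub>m n"
    using elementary_prod_inverse[OF assms(2)] by blast
  have Qc: "Q \<in> carrier_mat n n" by (rule elementary_prod_carrier[OF Q(1)])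
  have wP: "w * P \<in> carrier_mat 1 n" using w P by auto
  have supp: "(w * P) $$ (0, j) = 0" if j: "j < n" "j \<notin> S" for j
  proof -
    have "w $$ (0, c) * P $$ (c, j) = 0" if "c < n" for c
      using w(2)[of c] elementary_prod_entry[OF assms(2), of c j] that j by (cases "c \<in> S") auto
    then show ?thesis by (subst mult_mat_entry[OF w(1) P]) (auto simp: j)
  qed
  have "\<exists>i\<in>S. unit ((w * P) $$ (0, i))"
  proof (rule ccontr)
    assume neg: "\<not> ?thesis"
    then have all: "\<not> unit ((w * P) $$ (0, c))" if "c < n" for c
      using supp[of c] that nonunit_zero by (cases "c \<in> S") auto
    have "w * P * Q = w" using w P Qc Q(2) by (simp add: assoc_mult_mat[of _ 1 n _ n _ n])
    then have "w $$ (0, i) = (\<Sum>c<n. (w * P) $$ (0, c) * Q $$ (c, i))"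
      using mult_mat_entry[OF wP Qc, of 0 i] i assms(3) by auto
    then have "\<not> unit (w $$ (0, i))" using nonunit_sum[of "{..<n}"] nonunit_mult all by auto
    then show False using i by simp
  qed
  then show ?thesis using wP supp by (auto simp: row_on_def)
qed

lemma posdef_congr:
  assumes "posdef n S B" "B \<in> carrier_mat n n" "elementary_prod n S P" "S \<subseteq> {..<n}"
  shows "posdef n S (congr P B)"
  unfolding posdef_def
proof (intro allI impI)
  fix w assume w: "row_on n S w"
  have "w \<in> carrier_mat 1 n" using w by (simp add: row_on_def)
  then have "congr w (congr P B) = congr (w * P) B"
    using assms elementary_prod_carrier by (intro congr_congr[of _ 1 n]) auto
  then show "pos (congr w (congr P B) $$ (0, 0))"
    using assms row_on_mult[OF w] by (simp add: posdef_def)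
qed

lemma row_on_mono:
  assumes "row_on n T w" "T \<subseteq> S"
  shows "row_on n S w"
  using assms by (auto simp: row_on_def)

lemma posdef_mono: "posdef n S B \<Longrightarrow> T \<subseteq> S \<Longrightarrow> posdef n T B"
  using row_on_mono by (auto simp: posdef_def)

lemma posdef_diagonal:
  assumes "posdef n S B" "B \<in> carrier_mat n n" "i \<in> S" "S \<subseteq> {..<n}"
  shows "pos (B $$ (i, i))"
proof -
  let ?e = "mat 1 n (\<lambda>(a, b). if b = i then 1 else 0) :: 'a mat"
  have "i < n" using assms by auto
  have ec: "?e \<in> carrier_mat 1 n" by simp
  have 1: "(?e * B) $$ (0, b) = B $$ (i, b)" if "b < n" for b
  proof -
    have "(?e * B) $$ (0, b) = (\<Sum>c<n. if c = i then B $$ (i, b) else 0)"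
      unfolding mult_mat_entry[OF ec assms(2) less_one[THEN iffD2, OF refl] that] using that
      by (intro sum.cong) auto
    then show ?thesis using \<open>i < n\<close> by simp
  qed
  have "congr ?e B $$ (0, 0) = (\<Sum>c<n. (?e * B) $$ (0, c) * adj ?e $$ (c, 0))"
    unfolding congr_def using ec assms by (intro mult_mat_entry[of _ 1 n _ 1]) auto
  also have "\<dots> = (\<Sum>c<n. if c = i then B $$ (i, i) else 0)"
  proof (rule sum.cong)
    fix c assume "c \<in> {..<n}"
    then show "(?e * B) $$ (0, c) * adj ?e $$ (c, 0) = (if c = i then B $$ (i, i) else 0)"
      using 1[of c] adj_entry[OF ec, of c 0] by auto
  qed simp
  finally have "congr ?e B $$ (0, 0) = B $$ (i, i)" using \<open>i < n\<close> by simp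
  moreover have "row_on n S ?e"
    using assms by (auto simp: row_on_def unit_def intro!: bexI[of _ i])
  ultimately show ?thesis using assms(1) by (auto simp: posdef_def)
qed

text \<open>The inverse of \<open>P\<close> is also concentrated on \<open>S\<close>, so an equation restricted to the block \<open>S\<close> can be
transported through \<open>P\<close> although the other entries are unknown.\<close>

lemma row_zero_of_mult_adj:
  assumes P: "elementary_prod n S P" and S: "S \<subseteq> {..<n}" and u: "u \<in> carrier_mat 1 n"
    and zero: "\<And>j. j \<in> S \<Longrightarrow> (u * adj P) $$ (0, j) = 0" and j: "j \<in> S"
  shows "u $$ (0, j) = 0"
proof -
  obtain Q where Q: "elementary_prod n S Q" "Q * P = 1\<^sub>m n"
    using elementary_prod_inverse[OF P] by blast
  have c: "P \<in> carrier_mat n n" "Q \<in> carrier_mat n n"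
    using P Q elementary_prod_carrier by auto
  have "j < n" using j S by auto
  have "u * adj P * adj Q = u * adj (Q * P)"
    using c u by (simp add: adj_mult[of _ n n _ n] assoc_mult_mat[of _ 1 n _ n _ n])
  then have "u = u * adj P * adj Q" using Q u by simp
  then have "u $$ (0, j) = (\<Sum>d<n. (u * adj P) $$ (0, d) * adj Q $$ (d, j))"
    using mult_mat_entry[of "u * adj P" 1 n "adj Q" n 0 j] u c \<open>j < n\<close>
    by (simp add: mult_carrier_mat[of _ 1 n _ n])
  also have "\<dots> = 0"
  proof (rule sum.neutral, rule ballI)
    fix d assume "d \<in> {..<n}"
    then show "(u * adj P) $$ (0, d) * adj Q $$ (d, j) = 0"
      using zero[of d] elementary_prod_entry[OF Q(1) \<open>j < n\<close>, of d] j adj_entry[OF c(2), of d j] \<open>j < n\<close>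
      by (cases "d \<in> S") auto
  qed
  finally show ?thesis .
qed

lemma eigenpair_congr:
  assumes P: "elementary_prod n S P" and S: "S \<subseteq> {..<n}"
    and A: "A \<in> carrier_mat n n" and B: "B \<in> carrier_mat n n"
    and e: "eigenpair n S (congr P A) (congr P B) w \<mu>"
  shows "eigenpair n S A B (w * P) \<mu>"
proof -
  have w: "w \<in> carrier_mat 1 n" "row_on n S w" "cnj \<mu> = \<mu>" using e by (auto simp: eigenpair_def row_on_def)
  have Pc: "P \<in> carrier_mat n n" by (rule elementary_prod_carrier[OF P])
  have wP: "w * P \<in> carrier_mat 1 n" using w Pc by (simp add: mult_carrier_mat[of _ 1 n _ n])
  have assoc: "w * congr P M = w * P * M * adj P" if "M \<in> carrier_mat n n" for M
    unfolding congr_def using w Pc that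
    by (simp add: assoc_mult_mat[of _ 1 n _ n _ n] assoc_mult_mat[of _ n n _ n _ n]
        mult_carrier_mat[of _ 1 n _ n] mult_carrier_mat[of _ n n _ n])
  define u where "u = mat 1 n (\<lambda>(a, d). (w * P * A) $$ (0, d) - \<mu> * (w * P * B) $$ (0, d))"
  have uc: "u \<in> carrier_mat 1 n" by (simp add: u_def)
  have "(u * adj P) $$ (0, j) = 0" if j: "j \<in> S" for j
  proof -
    have jn: "j < n" using j S by auto
    have ent: "(x * adj P) $$ (0, j) = (\<Sum>d<n. x $$ (0, d) * adj P $$ (d, j))"
      if "x \<in> carrier_mat 1 n" for x
      using that Pc jn by (intro mult_mat_entry[of _ 1 n _ n]) auto
    have "(u * adj P) $$ (0, j) = (w * P * A * adj P) $$ (0, j) - \<mu> * (w * P * B * adj P) $$ (0, j)"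
      using uc A B wP
      by (simp add: ent mult_carrier_mat[of _ 1 n _ n] sum_distrib_left sum_subtractf[symmetric]
          left_diff_distrib mult.assoc u_def)
    then show ?thesis using e j by (simp add: assoc[OF A, symmetric] assoc[OF B, symmetric] eigenpair_def)
  qed
  then have "u $$ (0, j) = 0" if "j \<in> S" for j
    by (rule row_zero_of_mult_adj[OF P S uc _ that])
  then have "(w * P * A) $$ (0, j) = \<mu> * (w * P * B) $$ (0, j)" if "j \<in> S" for j
    using that S by (force simp: u_def)
  then show ?thesis using row_on_mult[OF w(2) P S] w(3) by (simp add: eigenpair_def)
qed

lemma selfadjoint_inverse:
  assumes "cnj \<beta> = \<beta>" "unit \<beta>"
  obtains \<gamma> where "cnj \<gamma> = \<gamma>" "\<beta> * \<gamma> = 1" "\<gamma> * \<beta> = 1"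
proof -
  obtain \<gamma> where g: "\<beta> * \<gamma> = 1" "\<gamma> * \<beta> = 1" using assms by (auto simp: unit_def)
  have "\<beta> * cnj \<gamma> = cnj (\<gamma> * \<beta>)" using assms by (simp add: cnj_mult)
  then have "\<beta> * cnj \<gamma> = 1" using g by simp
  then have "cnj \<gamma> = \<gamma>" by (metis g(2) mult.assoc mult_1_left mult_1_right)
  then show ?thesis using that g by blast
qed

text \<open>Scale the eigenvector to have entry \<open>1\<close> at some index \<open>i\<close> and make it row \<open>i\<close> by a row operation. Then
row \<open>i\<close> of the transformed \<open>A\<close> is \<open>\<mu>\<close> times that of the transformed \<open>B\<close>, so clearing one by means of the
invertible pivot \<open>\<beta>\<close> clears the other.\<close>

lemma eigenpair_deflation:
  assumes S: "S \<subseteq> {..<n}" and A: "hermitian n A" and B: "hermitian n B"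
    and pd: "posdef n S B" and e: "eigenpair n S A B w \<mu>"
  obtains P i where "i \<in> S" "elementary_prod n S P"
    "\<And>j. j \<in> S - {i} \<Longrightarrow> congr P A $$ (i, j) = 0" "\<And>j. j \<in> S - {i} \<Longrightarrow> congr P B $$ (i, j) = 0"
proof -
  have w: "w \<in> carrier_mat 1 n" "\<And>j. j < n \<Longrightarrow> j \<notin> S \<Longrightarrow> w $$ (0, j) = 0" and mu: "cnj \<mu> = \<mu>"
    and ew: "\<And>j. j \<in> S \<Longrightarrow> (w * A) $$ (0, j) = \<mu> * (w * B) $$ (0, j)"
    using e by (auto simp: eigenpair_def row_on_def)
  obtain i where i: "i \<in> S" "unit (w $$ (0, i))" using e by (auto simp: eigenpair_def row_on_def)
  then have "i < n" using S by auto
  obtain r where r: "r * w $$ (0, i) = 1" using i by (auto simp: unit_def)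
  define v where "v j = r * w $$ (0, j)" for j
  have v: "v i = 1" "\<And>j. j < n \<Longrightarrow> j \<notin> S \<Longrightarrow> v j = 0" using r w by (simp_all add: v_def)
  have vM: "(\<Sum>c<n. v c * M $$ (c, j)) = r * (w * M) $$ (0, j)" if "M \<in> carrier_mat n n" "j < n" for M j
    using mult_mat_entry[OF w(1) that(1), of 0 j] that
    by (simp add: v_def sum_distrib_left mult.assoc)
  define y where "y b = (if b \<in> S - {i} then v b else 0)" for b
  define R where "R = row_add n i y"
  have R: "elementary_prod n S R"
    unfolding R_def using i S by (intro elementary_prod_row_add) (auto simp: y_def)
  have Rc: "R \<in> carrier_mat n n" by (simp add: R_def)
  have Ri: "R $$ (i, c) = v c" if "c < n" for c
    using that v \<open>i < n\<close> by (auto simp: R_def row_add_def y_def)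
  have Ra: "R $$ (a, c) = (if a = c then 1 else 0)" if "a < n" "c < n" "a \<noteq> i" for a c
    using that by (auto simp: R_def row_add_def)
  define A1 where "A1 = congr R A"
  define B1 where "B1 = congr R B"
  have Ac: "A \<in> carrier_mat n n" and Bc: "B \<in> carrier_mat n n"
    using A B hermitian_carrier by auto
  have RM: "(R * M) $$ (i, j) = r * (w * M) $$ (0, j)" if "M \<in> carrier_mat n n" "j < n" for M j
    unfolding mult_mat_entry[OF Rc that(1) \<open>i < n\<close> that(2)]
    using vM[OF that] Ri by simp
  have rowA: "(R * A) $$ (i, j) = \<mu> * (R * B) $$ (i, j)" if "j \<in> S" for j
  proof -
    have "j < n" using that S by auto
    then show ?thesis
      using RM[OF Ac] RM[OF Bc] ew[OF that] selfadjoint_commute[OF mu, of r]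
      by (simp flip: mult.assoc)
  qed
  have A1B1: "A1 $$ (i, j) = \<mu> * B1 $$ (i, j)" if j: "j \<in> S" for j
  proof -
    have jn: "j < n" using j S by auto
    have supp: "R $$ (j, c) = 0" if "c < n" "c \<notin> S" for c
      using elementary_prod_entry[OF R jn that(1)] that j by auto
    have "(R * M) $$ (i, c) * cnj (R $$ (j, c)) = 0" if "c < n" "c \<notin> S" for M c
      using supp[OF that] by simp
    have ent: "congr R M $$ (i, j) = (\<Sum>c<n. (R * M) $$ (i, c) * cnj (R $$ (j, c)))"
      if "M \<in> carrier_mat n n" for M
      unfolding congr_def using that Rc jn \<open>i < n\<close>
      by (subst mult_mat_entry[of _ n n _ n]) (auto simp: adj_entry)
    have "(R * A) $$ (i, c) * cnj (R $$ (j, c)) = \<mu> * ((R * B) $$ (i, c) * cnj (R $$ (j, c)))"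
      if "c < n" for c
      using rowA[of c] supp[of c] that by (cases "c \<in> S") (auto simp: mult.assoc)
    then show ?thesis
      unfolding A1_def B1_def ent[OF Ac] ent[OF Bc] by (simp add: sum_distrib_left)
  qed
  have B1h: "hermitian n B1" and A1h: "hermitian n A1"
    unfolding A1_def B1_def using A B Rc by (auto intro: hermitian_congr)
  define \<beta> where "\<beta> = B1 $$ (i, i)"
  have "B1 \<in> carrier_mat n n" by (rule hermitian_carrier[OF B1h])
  then have "pos \<beta>"
    using posdef_diagonal[OF posdef_congr[OF pd Bc R S] _ i(1) S] by (simp add: \<beta>_def B1_def)
  then have ub: "unit \<beta>" by (rule pos_unit)
  have sb: "cnj \<beta> = \<beta>" using hermitian_entry[OF B1h] \<open>i < n\<close> by (simp add: \<beta>_def)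
  obtain \<gamma> where g: "cnj \<gamma> = \<gamma>" "\<beta> * \<gamma> = 1" using selfadjoint_inverse[OF sb ub] by blast
  define z where "z j = - (B1 $$ (j, i) * \<gamma>)" for j
  define C where "C = col_add n i (S - {i}) z"
  have C: "elementary_prod n S C"
    unfolding C_def using S i finite_subset[OF S] by (intro elementary_prod_col_add) auto
  have Cc: "C \<in> carrier_mat n n" by (simp add: C_def)
  have ent: "congr C M $$ (i, j) = M $$ (i, j) + M $$ (i, i) * cnj (z j)"
    if "M \<in> carrier_mat n n" "j \<in> S - {i}" for M j
  proof -
    have "j < n" using that S by auto
    then show ?thesis
      unfolding congr_def C_def using that \<open>i < n\<close>
      by (subst mult_adj_col_add[where k = n])
        (auto simp: col_add_mult[where k = n])
  qed
  have zB: "B1 $$ (i, j) + \<beta> * cnj (z j) = 0" if "j \<in> S" for j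
  proof -
    have "j < n" using that S by auto
    then have "cnj (z j) = - (\<gamma> * B1 $$ (i, j))"
      using hermitian_entry[OF B1h, of j i] \<open>i < n\<close> g by (simp add: z_def cnj_minus cnj_mult)
    then show ?thesis using g by (simp flip: mult.assoc)
  qed
  have Bz: "congr C B1 $$ (i, j) = 0" if "j \<in> S - {i}" for j
    using ent[OF _ that, of B1] zB[of j] that B1h hermitian_carrier by (auto simp: \<beta>_def)
  have Az: "congr C A1 $$ (i, j) = 0" if "j \<in> S - {i}" for j
  proof -
    have "congr C A1 $$ (i, j) = \<mu> * (B1 $$ (i, j) + \<beta> * cnj (z j))"
      using ent[OF _ that, of A1] A1B1[of j] A1B1[of i] that i A1h hermitian_carrier
      by (auto simp: \<beta>_def distrib_left mult.assoc)
    then show ?thesis using zB[of j] that by simp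
  qed
  show thesis
  proof (rule that[OF i(1)])
    show "elementary_prod n S (C * R)" by (rule elementary_prod_mult[OF C R])
    show "congr (C * R) A $$ (i, j) = 0" "congr (C * R) B $$ (i, j) = 0" if "j \<in> S - {i}" for j
      using Az[OF that] Bz[OF that] congr_congr[OF Cc Rc] Ac Bc by (simp_all add: A1_def B1_def)
  qed
qed

text \<open>The existence of eigenpairs is a hypothesis, for all nonempty subsets of \<open>S\<close>, so that the theorem serves
both rings and can be used on smaller index sets inside the existence proof itself.\<close>

theorem simultaneous_diagonalization:
  assumes "S \<subseteq> {..<n}"
    and ex: "\<And>T A B. T \<subseteq> S \<Longrightarrow> T \<noteq> {} \<Longrightarrow> hermitian n A \<Longrightarrow> hermitian n B \<Longrightarrow> posdef n T B \<Longrightarrow>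
      \<exists>w \<mu>. eigenpair n T A B w \<mu>"
    and "hermitian n A" "hermitian n B" "posdef n S B"
  shows "\<exists>P. elementary_prod n S P \<and> diag_on S (congr P A) \<and> diag_on S (congr P B)"
  using assms
proof (induction "card S" arbitrary: S A B rule: less_induct)
  case less
  show ?case
  proof (cases "S = {}")
    case True
    then show ?thesis using elementary_prod.one by (auto simp: diag_on_def)
  next
    case False
    note S = less.prems(1) and A = less.prems(3) and B = less.prems(4)
    have fin: "finite S" using S finite_subset by blast
    obtain w \<mu> where "eigenpair n S A B w \<mu>"
      using less.prems(2)[OF subset_refl False A B less.prems(5)] by blast
    then obtain P i where i: "i \<in> S" and P: "elementary_prod n S P"
      and zA: "\<And>j. j \<in> S - {i} \<Longrightarrow> congr P A $$ (i, j) = 0"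
      and zB: "\<And>j. j \<in> S - {i} \<Longrightarrow> congr P B $$ (i, j) = 0"
      using eigenpair_deflation[OF S A B less.prems(5)] by metis
    have Pc: "P \<in> carrier_mat n n" by (rule elementary_prod_carrier[OF P])
    have c: "A \<in> carrier_mat n n" "B \<in> carrier_mat n n" using A B hermitian_carrier by auto
    have A1: "hermitian n (congr P A)" and B1: "hermitian n (congr P B)"
      using hermitian_congr[OF Pc] A B by auto
    have pd: "posdef n (S - {i}) (congr P B)"
      using posdef_mono[OF posdef_congr[OF less.prems(5) c(2) P S]] by blast
    have "\<exists>Q. elementary_prod n (S - {i}) Q \<and> diag_on (S - {i}) (congr Q (congr P A)) \<and>
        diag_on (S - {i}) (congr Q (congr P B))"
    proof (rule less.hyps[OF card_Diff1_less[OF fin i] _ _ A1 B1 pd])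
      show "S - {i} \<subseteq> {..<n}" using S by blast
      show "\<exists>w \<mu>. eigenpair n T A' B' w \<mu>" if "T \<subseteq> S - {i}" "T \<noteq> {}" "hermitian n A'"
        "hermitian n B'" "posdef n T B'" for T A' B'
        using that less.prems(2)[of T A' B'] by blast
    qed
    then obtain Q where Q: "elementary_prod n (S - {i}) Q"
      and dA: "diag_on (S - {i}) (congr Q (congr P A))" and dB: "diag_on (S - {i}) (congr Q (congr P B))"
      by blast
    have Qc: "Q \<in> carrier_mat n n" by (rule elementary_prod_carrier[OF Q])
    have "i < n" using i S by auto
    \<comment> \<open>operations on \<open>S - {i}\<close> preserve the zeros in row and column \<open>i\<close>\<close>
    have keep: "diag_on S (congr Q M)"
      if M: "hermitian n M" "\<And>j. j \<in> S - {i} \<Longrightarrow> M $$ (i, j) = 0" "diag_on (S - {i}) (congr Q M)" for M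
    proof -
      have Mc: "M \<in> carrier_mat n n" using M hermitian_carrier by auto
      have h: "hermitian n (congr Q M)" by (rule hermitian_congr[OF Qc M(1)])
      have QM: "(Q * M) $$ (i, d) = M $$ (i, d)" if "d < n" for d
      proof -
        have "(Q * M) $$ (i, d) = (\<Sum>c<n. if c = i then M $$ (i, d) else 0)"
          unfolding mult_mat_entry[OF Qc Mc \<open>i < n\<close> that]
          using elementary_prod_entry[OF Q \<open>i < n\<close>] by (intro sum.cong) auto
        then show ?thesis using \<open>i < n\<close> by simp
      qed
      have row: "congr Q M $$ (i, j) = 0" if j: "j \<in> S - {i}" for j
      proof -
        have jn: "j < n" using j S by auto
        have "M $$ (i, d) * cnj (Q $$ (j, d)) = 0" if "d < n" for d
          using elementary_prod_entry[OF Q jn that] j M(2)[of d] by (cases "d \<in> S - {i}") auto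
        then have "(\<Sum>d<n. (Q * M) $$ (i, d) * adj Q $$ (d, j)) = 0"
          using QM jn Qc by (intro sum.neutral) (auto simp: adj_entry)
        then show ?thesis
          unfolding congr_def using Qc Mc jn \<open>i < n\<close>
          by (subst mult_mat_entry[of _ n n _ n]) auto
      qed
      have col: "congr Q M $$ (j, i) = 0" if "j \<in> S - {i}" for j
      proof -
        have "j < n" using that S by auto
        then show ?thesis using hermitian_entry[OF h \<open>i < n\<close>, of j] row[OF that] by simp
      qed
      show ?thesis using M(3) row col by (auto simp: diag_on_def)
    qed
    have "elementary_prod n S (Q * P)"
      by (rule elementary_prod_mult[OF elementary_prod_mono[OF Q] P]) blast
    moreover have "diag_on S (congr (Q * P) A)"
      using keep[OF A1 zA dA] congr_congr[OF Qc Pc c(1)] by simp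
    moreover have "diag_on S (congr (Q * P) B)"
      using keep[OF B1 zB dB] congr_congr[OF Qc Pc c(2)] by simp
    ultimately show ?thesis by blast
  qed
qed

end

section \<open>Eigenvectors of quaternion pencils\<close>

lemma unit_quat_iff: "unit (a :: quat) \<longleftrightarrow> a \<noteq> 0"
  using quat_inverse by (auto simp: unit_def)

interpretation quat: local_star_ring qcnj "\<lambda>a. 0 < qre a"
proof
  fix a b :: quat
  have zd: "a = 0 \<or> b = 0" if "a * b = 0"
    by (metis that quat_inverse mult.assoc mult_1_left mult_zero_right)
  show "unit a" if "0 < qre a" using that by (auto simp: unit_quat_iff zero_quat_def)
  show "\<not> unit (a + b)" if "\<not> unit a" "\<not> unit b" using that by (simp add: unit_quat_iff)
  show "\<not> unit (a * b)" if "\<not> unit a" using that by (simp add: unit_quat_iff)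
qed

definition of_re :: "real \<Rightarrow> quat" where
  "of_re r = Quat r 0 0 0"

lemma of_re_simps:
  "of_re r + of_re s = of_re (r + s)" "of_re r - of_re s = of_re (r - s)"
  "of_re r * of_re s = of_re (r * s)" "- of_re r = of_re (- r)" "of_re 0 = 0" "of_re 1 = 1"
  "qcnj (of_re r) = of_re r" "of_re r = of_re s \<longleftrightarrow> r = s" "of_re r = 0 \<longleftrightarrow> r = 0" "qre (of_re r) = r"
  by (auto simp: of_re_def plus_quat_def minus_quat_def times_quat_def uminus_quat_def
      zero_quat_def one_quat_def qcnj_def)

lemma of_re_neg_one: "of_re (- 1) = - 1"
  using of_re_simps(4)[of 1] by (simp add: of_re_simps)

lemma of_re_commute: "of_re r * q = q * of_re r"
  by (rule quat.selfadjoint_commute) (simp add: of_re_simps)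

lemma of_re_sum: "of_re (sum f I) = (\<Sum>i\<in>I. of_re (f i))"
  by (induction I rule: infinite_finite_induct) (simp_all add: of_re_simps flip: of_re_simps(1))

lemma selfadjoint_of_re: "qcnj a = a \<Longrightarrow> of_re (qre a) = a"
  by (auto simp: qcnj_def of_re_def quat_eq_iff)

lemma mult_qcnj: "v * qcnj v = of_re (qre (v * qcnj v))" "v \<noteq> 0 \<Longrightarrow> 0 < qre (v * qcnj v)"
proof -
  show "v * qcnj v = of_re (qre (v * qcnj v))"
    by (rule selfadjoint_of_re[symmetric]) (simp add: quat.cnj_mult)
  have "qre (v * qcnj v) = qre v ^ 2 + qi v ^ 2 + qj v ^ 2 + qk v ^ 2"
    by (simp add: times_quat_def qcnj_def power2_eq_square)
  then show "0 < qre (v * qcnj v)" if "v \<noteq> 0"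
    using that by (auto simp: zero_quat_def quat_eq_iff add_nonneg_eq_0_iff less_le)
qed

text \<open>Look to the right of the largest pole \<open>\<tau>\<close> among the poles \<open>a j / b j\<close>: there the difference \<open>f\<close> of the two
sides is continuous, tends to infinity at \<open>\<tau>\<close> and to minus infinity at infinity. The points \<open>\<tau> + s\<close> and
\<open>T\<close> make both limits explicit.\<close>

lemma secular_equation_solvable:
  fixes a b m :: "nat \<Rightarrow> real"
  assumes "finite J" "\<And>j. j \<in> J \<Longrightarrow> 0 < b j" "\<And>j. j \<in> J \<Longrightarrow> 0 < m j" "0 < \<beta>"
  shows "\<exists>t. (\<forall>j\<in>J. a j - t * b j \<noteq> 0) \<and> \<alpha> - t * \<beta> = (\<Sum>j\<in>J. m j / (a j - t * b j))"
proof (cases "J = {}")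
  case True
  then show ?thesis using assms(4) by (auto intro!: exI[of _ "\<alpha> / \<beta>"])
next
  case False
  define \<tau> where "\<tau> = Max ((\<lambda>j. a j / b j) ` J)"
  have le: "a j / b j \<le> \<tau>" if "j \<in> J" for j using that assms(1) by (simp add: \<tau>_def)
  obtain j0 where j0: "j0 \<in> J" "a j0 / b j0 = \<tau>"
    using Max_in[of "(\<lambda>j. a j / b j) ` J"] assms(1) False unfolding \<tau>_def by fastforce
  have lower: "(t - \<tau>) * b j \<le> t * b j - a j" if "j \<in> J" for j t
    using le[OF that] assms(2)[OF that] by (simp add: field_simps)
  have pos: "0 < t * b j - a j" if "j \<in> J" "\<tau> < t" for j t
    using lower[OF that(1), of t] assms(2)[OF that(1)] that(2) by (smt (verit) mult_pos_pos)
  define f where "f t = \<alpha> - t * \<beta> + (\<Sum>j\<in>J. m j / (t * b j - a j))" for t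
  define c where "c = m j0 / b j0"
  have c: "0 < c" using j0 assms by (simp add: c_def)
  define C where "C = (\<Sum>j\<in>J. m j / b j)"
  have C: "0 \<le> C" unfolding C_def using assms by (intro sum_nonneg) (simp add: less_imp_le)
  define K where "K = \<bar>\<alpha>\<bar> + \<bar>\<tau> + 1\<bar> * \<beta>"
  have K: "0 \<le> K" using assms by (simp add: K_def)
  \<comment> \<open>chosen so that the term of the pole \<open>\<tau>\<close> alone, which is \<open>c / s\<close>, equals \<open>c + K\<close>\<close>
  define s where "s = c / (c + K)"
  have s: "0 < s" "s \<le> 1" using c K by (simp_all add: s_def)
  have left: "0 \<le> f (\<tau> + s)"
  proof -
    have "t * b j0 - a j0 = (t - \<tau>) * b j0" for t
      using j0 assms(2)[OF j0(1)] by (auto simp: field_simps)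
    then have "m j0 / ((\<tau> + s) * b j0 - a j0) = c / s"
      by (simp add: c_def)
    moreover have "c / s = c + K" using c K by (simp add: s_def)
    moreover have "m j0 / ((\<tau> + s) * b j0 - a j0) \<le> (\<Sum>j\<in>J. m j / ((\<tau> + s) * b j - a j))"
      using j0 assms pos s by (intro member_le_sum) (auto simp: less_imp_le)
    moreover have "(\<tau> + s) * \<beta> \<le> \<bar>\<tau> + 1\<bar> * \<beta>"
      using s assms by (intro mult_right_mono) auto
    ultimately show ?thesis using c by (simp add: f_def K_def)
  qed
  define T where "T = max (\<tau> + 1) ((\<alpha> + C) / \<beta>)"
  have right: "f T \<le> 0"
  proof -
    have "1 \<le> T - \<tau>" by (simp add: T_def)
    have "m j / (T * b j - a j) \<le> m j / b j" if "j \<in> J" for j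
    proof (rule divide_left_mono)
      show "b j \<le> T * b j - a j"
        using lower[OF that, of T] mult_right_mono[OF \<open>1 \<le> T - \<tau>\<close>, of "b j"] assms(2)[OF that]
        by (metis less_imp_le mult_1 order_trans)
      show "0 \<le> m j" using assms(3)[OF that] by simp
      show "0 < (T * b j - a j) * b j"
        using pos[OF that, of T] assms(2)[OF that] \<open>1 \<le> T - \<tau>\<close> by simp
    qed
    then have "(\<Sum>j\<in>J. m j / (T * b j - a j)) \<le> C" unfolding C_def by (rule sum_mono)
    moreover have "\<alpha> + C \<le> T * \<beta>"
      using assms(4) by (metis T_def max.cobounded2 pos_divide_le_eq)
    ultimately show ?thesis by (simp add: f_def)
  qed
  have "\<exists>t\<ge>\<tau> + s. t \<le> T \<and> f t = 0"
  proof (rule IVT2')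
    show "f T \<le> 0" "0 \<le> f (\<tau> + s)" by (fact left right)+
    show "\<tau> + s \<le> T" using s by (simp add: T_def)
    have "t * b j - a j \<noteq> 0" if "t \<in> {\<tau> + s..T}" "j \<in> J" for t j
      using pos[OF that(2), of t] that(1) s by auto
    then show "continuous_on {\<tau> + s..T} f"
      unfolding f_def by (intro continuous_intros) auto
  qed
  then obtain t where t: "\<tau> + s \<le> t" "f t = 0" by blast
  have "m j / (a j - t * b j) = - (m j / (t * b j - a j))" for j
    by (metis minus_diff_eq minus_divide_right)
  then have "\<alpha> - t * \<beta> = (\<Sum>j\<in>J. m j / (a j - t * b j))"
    using t(2) by (simp add: f_def sum_negf)
  moreover have "a j - t * b j \<noteq> 0" if "j \<in> J" for j
    using pos[OF that, of t] t s by auto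
  ultimately show ?thesis by blast
qed

text \<open>If \<open>B\<close> is diagonal and \<open>A\<close> is diagonal apart from row and column \<open>k\<close>, put \<open>x k = 1\<close>. The equations at the
other indices determine the remaining entries, and the equation at \<open>k\<close> becomes the secular equation
with the numbers \<open>m j = \<bar>v j\<bar>\<^sup>2\<close> as numerators. Indices with \<open>v j = 0\<close> are left out, as their poles
would not be there to force a sign change.\<close>

lemma arrow_eigenpair:
  fixes A B :: "quat mat"
  assumes S: "S \<subseteq> {..<n}" and k: "k \<in> S"
    and A: "quat.hermitian n A" and B: "quat.hermitian n B" and pd: "quat.posdef n S B"
    and dA: "quat.diag_on (S - {k}) A" and dB: "quat.diag_on S B"
  shows "\<exists>w \<mu>. quat.eigenpair n S A B w \<mu>"
proof -
  have Ac: "A \<in> carrier_mat n n" and Bc: "B \<in> carrier_mat n n"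
    using A B quat.hermitian_carrier by auto
  have lt: "j < n" if "j \<in> S" for j using that S by auto
  have fin: "finite S" using S finite_subset by blast
  define a where "a j = qre (A $$ (j, j))" for j
  define b where "b j = qre (B $$ (j, j))" for j
  define v where "v j = A $$ (k, j)" for j
  have Ad: "A $$ (j, j) = of_re (a j)" and Bd: "B $$ (j, j) = of_re (b j)" if "j \<in> S" for j
    unfolding a_def b_def
    using quat.hermitian_entry[OF A] quat.hermitian_entry[OF B] lt[OF that] selfadjoint_of_re by simp_all
  have b: "0 < b j" if "j \<in> S" for j
    unfolding b_def by (rule quat.posdef_diagonal[OF pd Bc that S])
  define J where "J = {j \<in> S - {k}. v j \<noteq> 0}"
  define m where "m j = qre (v j * qcnj (v j))" for j
  obtain t where t: "\<And>j. j \<in> J \<Longrightarrow> a j - t * b j \<noteq> 0"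
    and sec: "a k - t * b k = (\<Sum>j\<in>J. m j / (a j - t * b j))"
    using secular_equation_solvable[of J b m "b k" a "a k"] fin b k mult_qcnj(2)
    by (fastforce simp: J_def m_def)
  define x where "x j = (if j = k then 1 else if j \<in> J then v j * of_re (- 1 / (a j - t * b j)) else 0)" for j
  define w where "w = mat 1 n (\<lambda>(i, j). x j)"
  have wc: "w \<in> carrier_mat 1 n" by (simp add: w_def)
  have J: "J \<subseteq> S - {k}" by (auto simp: J_def)
  have row: "quat.row_on n S w"
    using k lt[OF k] J by (auto simp: quat.row_on_def w_def x_def unit_quat_iff intro!: bexI[of _ k])
  have supp: "x c = 0" if "c \<notin> insert k J" for c using that by (simp add: x_def)
  have wM: "(w * M) $$ (0, j) = M $$ (k, j) + (\<Sum>c\<in>J. x c * M $$ (c, j))"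
    if "M \<in> carrier_mat n n" "j < n" for M j
  proof -
    have "(w * M) $$ (0, j) = (\<Sum>c<n. x c * M $$ (c, j))"
      using mult_mat_entry[OF wc that(1), of 0 j] that by (simp add: w_def)
    also have "\<dots> = (\<Sum>c\<in>insert k J. x c * M $$ (c, j))"
      using J S k supp by (intro sum.mono_neutral_right) auto
    also have "\<dots> = M $$ (k, j) + (\<Sum>c\<in>J. x c * M $$ (c, j))"
      using finite_subset[OF J] fin J by (subst sum.insert) (auto simp: x_def)
    finally show ?thesis .
  qed
  have "(w * A) $$ (0, j) = of_re t * (w * B) $$ (0, j)" if j: "j \<in> S" for j
  proof (cases "j = k")
    case True
    have "(\<Sum>c\<in>J. x c * A $$ (c, k)) = (\<Sum>c\<in>J. of_re (- (m c / (a c - t * b c))))"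
    proof (rule sum.cong)
      fix c assume c: "c \<in> J"
      have "A $$ (c, k) = qcnj (v c)"
        using quat.hermitian_entry[OF A, of k c] lt k c J by (auto simp: v_def)
      then have "x c * A $$ (c, k) = of_re (- 1 / (a c - t * b c)) * (v c * qcnj (v c))"
        using c J by (auto simp: x_def of_re_commute mult.assoc)
      also have "\<dots> = of_re (- 1 / (a c - t * b c)) * of_re (m c)"
        unfolding m_def using mult_qcnj(1)[of "v c"] by simp
      finally show "x c * A $$ (c, k) = of_re (- (m c / (a c - t * b c)))"
        by (simp add: of_re_simps)
    qed simp
    also have "\<dots> = of_re (- (a k - t * b k))"
      unfolding sec by (simp add: sum_negf flip: of_re_sum)
    finally have "(w * A) $$ (0, k) = of_re (t * b k)"
      using wM[OF Ac lt[OF k]] Ad[OF k] by (simp add: of_re_simps)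
    moreover have "(\<Sum>c\<in>J. x c * B $$ (c, k)) = 0"
      using dB k J by (intro sum.neutral ballI) (force simp: quat.diag_on_def)
    ultimately show ?thesis
      using wM[OF Bc lt[OF k]] Bd[OF k] True by (simp add: of_re_simps)
  next
    case False
    have Bk: "B $$ (k, j) = 0" using dB k j False by (auto simp: quat.diag_on_def)
    have sumM: "(\<Sum>c\<in>J. x c * M $$ (c, j)) = x j * M $$ (j, j)"
      if "quat.diag_on (S - {k}) M" for M
    proof -
      have "(\<Sum>c\<in>J. x c * M $$ (c, j)) = (\<Sum>c\<in>S - {k}. x c * M $$ (c, j))"
        using J fin supp by (intro sum.mono_neutral_left) auto
      also have "\<dots> = (\<Sum>c\<in>S - {k}. if c = j then x j * M $$ (j, j) else 0)"
        using that j False by (intro sum.cong) (auto simp: quat.diag_on_def)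
      finally show ?thesis using j False fin by simp
    qed
    have dB': "quat.diag_on (S - {k}) B" using dB by (auto simp: quat.diag_on_def)
    have "v j + x j * of_re (a j - t * b j) = 0"
    proof (cases "j \<in> J")
      case True
      have "- 1 / (a j - t * b j) * (a j - t * b j) = - 1" using t[OF True] by simp
      then show ?thesis
        using True False
        by (simp only: x_def if_True if_False mult.assoc of_re_simps(3) of_re_neg_one) simp
    next
      case False
      then show ?thesis using \<open>j \<noteq> k\<close> j by (simp add: x_def J_def)
    qed
    then have "v j + x j * of_re (a j) = x j * of_re (t * b j)"
      unfolding of_re_simps(2)[symmetric] right_diff_distrib add_diff_eq by simp
    moreover have "of_re t * (x j * of_re (b j)) = x j * of_re (t * b j)"
      by (simp only: of_re_simps(3)[symmetric] mult.assoc[symmetric] of_re_commute[of t "x j"])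
    ultimately show ?thesis
      using wM[OF Ac lt[OF j]] wM[OF Bc lt[OF j]] sumM[OF dA] sumM[OF dB'] Bk Ad[OF j] Bd[OF j]
      by (simp add: v_def)
  qed
  then have "quat.eigenpair n S A B w (of_re t)"
    using row by (simp add: quat.eigenpair_def of_re_simps)
  then show ?thesis by blast
qed

text \<open>By induction the pencil is diagonalized on all indices except one index \<open>k\<close>. A further row operation at
\<open>k\<close> makes \<open>B\<close> diagonal, and \<open>A\<close> an arrow matrix.\<close>

theorem quat_eigenpair:
  fixes A B :: "quat mat"
  assumes "S \<subseteq> {..<n}" "S \<noteq> {}" "quat.hermitian n A" "quat.hermitian n B" "quat.posdef n S B"
  shows "\<exists>w \<mu>. quat.eigenpair n S A B w \<mu>"
  using assms
proof (induction "card S" arbitrary: S A B rule: less_induct)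
  case less
  note S = less.prems(1) and A = less.prems(3) and B = less.prems(4) and pd = less.prems(5)
  have fin: "finite S" using S finite_subset by blast
  obtain k where k: "k \<in> S" using less.prems(2) by blast
  have kn: "k < n" using k S by auto
  have S': "S - {k} \<subseteq> {..<n}" using S by blast
  have ex: "\<exists>w \<mu>. quat.eigenpair n T A' B' w \<mu>"
    if "T \<subseteq> S - {k}" "T \<noteq> {}" "quat.hermitian n A'" "quat.hermitian n B'" "quat.posdef n T B'" for T A' B'
  proof (rule less.hyps)
    have "T \<subset> S" using that(1) k by blast
    then show "card T < card S" by (rule psubset_card_mono[OF fin])
    show "T \<subseteq> {..<n}" using that(1) S by blast
  qed (fact that)+
  have pd': "quat.posdef n (S - {k}) B" by (rule quat.posdef_mono[OF pd]) blast
  obtain P where P: "elementary_prod n (S - {k}) P"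
    and d: "quat.diag_on (S - {k}) (quat.congr P A)" "quat.diag_on (S - {k}) (quat.congr P B)"
    using quat.simultaneous_diagonalization[OF S' ex A B pd'] by blast
  have Pc: "P \<in> carrier_mat n n" by (rule elementary_prod_carrier[OF P])
  have PS: "elementary_prod n S P" by (rule elementary_prod_mono[OF P]) blast
  have Ac: "A \<in> carrier_mat n n" and Bc: "B \<in> carrier_mat n n"
    using A B quat.hermitian_carrier by auto
  define A1 where "A1 = quat.congr P A"
  define B1 where "B1 = quat.congr P B"
  have A1: "quat.hermitian n A1" and B1: "quat.hermitian n B1"
    unfolding A1_def B1_def by (rule quat.hermitian_congr[OF Pc]; fact)+
  have A1c: "A1 \<in> carrier_mat n n" and B1c: "B1 \<in> carrier_mat n n"
    using A1 B1 quat.hermitian_carrier by auto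
  have pd1: "quat.posdef n S B1" unfolding B1_def by (rule quat.posdef_congr[OF pd Bc PS S])
  define b where "b j = qre (B1 $$ (j, j))" for j
  have Bd: "B1 $$ (j, j) = of_re (b j)" "0 < b j" if "j \<in> S" for j
  proof -
    have "j < n" using that S by auto
    then show "B1 $$ (j, j) = of_re (b j)"
      unfolding b_def using quat.hermitian_entry[OF B1, of j j] selfadjoint_of_re by simp
    show "0 < b j" unfolding b_def by (rule quat.posdef_diagonal[OF pd1 B1c that S])
  qed
  \<comment> \<open>removes the border of \<open>B1\<close>, whose inner block is diagonal with entries \<open>b j\<close>\<close>
  define y where "y j = (if j \<in> S - {k} then B1 $$ (k, j) * of_re (- 1 / b j) else 0)" for j
  define R where "R = row_add n k y"
  have Rc: "R \<in> carrier_mat n n" by (simp add: R_def)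
  have R: "elementary_prod n S R"
    unfolding R_def using k kn by (intro elementary_prod_row_add) (auto simp: y_def)
  have inner: "quat.congr R M $$ (i, j) = M $$ (i, j)"
    if "M \<in> carrier_mat n n" "i \<in> S - {k}" "j \<in> S - {k}" for M i j
  proof -
    have "i < n" "j < n" using that S by auto
    then show ?thesis
      unfolding quat.congr_def R_def using that
      by (subst quat.mult_adj_row_add[where k = n]) (auto simp: row_add_mult[where k = n])
  qed
  have dA: "quat.diag_on (S - {k}) (quat.congr R A1)"
    using d(1) inner[OF A1c] by (auto simp: quat.diag_on_def A1_def)
  have B2: "quat.hermitian n (quat.congr R B1)" by (rule quat.hermitian_congr[OF Rc B1])
  have row: "quat.congr R B1 $$ (k, j) = 0" if j: "j \<in> S - {k}" for j
  proof -
    have jn: "j < n" using j S by auto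
    have "(\<Sum>c<n. y c * B1 $$ (c, j)) = (\<Sum>c<n. if c = j then y j * B1 $$ (j, j) else 0)"
      using d(2) j by (intro sum.cong) (auto simp: y_def quat.diag_on_def B1_def)
    also have "\<dots> = - B1 $$ (k, j)"
    proof -
      have "- 1 / b j * b j = - 1" using j Bd(2)[of j] by auto
      then have "B1 $$ (k, j) * of_re (- 1 / b j) * of_re (b j) = - B1 $$ (k, j)"
        by (simp only: mult.assoc of_re_simps(3) of_re_neg_one) simp
      then show ?thesis using jn j Bd(1)[of j] by (simp add: y_def)
    qed
    finally show ?thesis
      unfolding quat.congr_def R_def using B1c jn kn j
      by (subst quat.mult_adj_row_add[where k = n]) (auto simp: row_add_mult[where k = n])
  qed
  have col: "quat.congr R B1 $$ (j, k) = 0" if j: "j \<in> S - {k}" for j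
  proof -
    have "j < n" using j S by auto
    then show ?thesis using quat.hermitian_entry[OF B2 kn, of j] row[OF j] by simp
  qed
  have dB: "quat.diag_on S (quat.congr R B1)"
    unfolding quat.diag_on_def
  proof (intro ballI impI)
    fix i j assume ij: "i \<in> S" "j \<in> S" "i \<noteq> j"
    show "quat.congr R B1 $$ (i, j) = 0"
    proof (cases "i = k \<or> j = k")
      case True
      then show ?thesis using ij row col by auto
    next
      case False
      then show ?thesis
        using ij inner[OF B1c, of i j] d(2) by (simp add: quat.diag_on_def B1_def)
    qed
  qed
  obtain w \<mu> where "quat.eigenpair n S (quat.congr R A1) (quat.congr R B1) w \<mu>"
    using arrow_eigenpair[OF S k quat.hermitian_congr[OF Rc A1] B2
        quat.posdef_congr[OF pd1 B1c R S] dA dB] by blast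
  then have "quat.eigenpair n S A1 B1 (w * R) \<mu>"
    by (rule quat.eigenpair_congr[OF R S A1c B1c])
  then have "quat.eigenpair n S A B (w * R * P) \<mu>"
    unfolding A1_def B1_def by (rule quat.eigenpair_congr[OF PS S Ac Bc])
  then show ?case by blast
qed

section \<open>Eigenvectors of dual quaternion pencils\<close>

lemma std_part_mult: "std_part (a * b :: dquat) = std_part a * std_part b"
  and dual_part_mult: "dual_part (a * b :: dquat) = std_part a * dual_part b + dual_part a * std_part b"
  by (simp_all add: times_dual_def)

lemma std_part_add: "std_part (a + b :: dquat) = std_part a + std_part b"
  and dual_part_add: "dual_part (a + b :: dquat) = dual_part a + dual_part b"
  by (simp_all add: plus_dual_def)

lemma std_part_zero [simp]: "std_part (0 :: dquat) = 0"
  and dual_part_zero [simp]: "dual_part (0 :: dquat) = 0"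
  by (simp_all add: zero_dual_def)

lemma std_part_sum: "std_part (sum f I :: dquat) = (\<Sum>i\<in>I. std_part (f i))"
  by (induction I rule: infinite_finite_induct) (simp_all add: std_part_add)

lemma dual_part_sum: "dual_part (sum f I :: dquat) = (\<Sum>i\<in>I. dual_part (f i))"
  by (induction I rule: infinite_finite_induct) (simp_all add: dual_part_add)

lemma unit_dquat_iff: "unit (a :: dquat) \<longleftrightarrow> std_part a \<noteq> 0"
proof
  assume "unit a"
  then obtain b where "a * b = 1" by (auto simp: unit_def)
  then have "std_part a * std_part b = 1" by (metis std_part_mult dual.sel(1) one_dual_def)
  then show "std_part a \<noteq> 0" by auto
next
  assume "std_part a \<noteq> 0"
  then show "unit a" using dquat_inverse by (simp add: unit_def)
qed

interpretation dquat: local_star_ring dqcnj "\<lambda>a. 0 < qre (std_part a)"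
proof
  fix a b :: dquat
  show "unit a" if "0 < qre (std_part a)"
    using that by (auto simp: unit_dquat_iff zero_quat_def)
  show "\<not> unit (a + b)" if "\<not> unit a" "\<not> unit b"
    using that by (simp add: unit_dquat_iff std_part_add)
  show "\<not> unit (a * b)" if "\<not> unit a"
    using that by (simp add: unit_dquat_iff std_part_mult)
qed

definition std_mat :: "dquat mat \<Rightarrow> quat mat" where
  "std_mat A = map_mat std_part A"

definition dual_mat :: "dquat mat \<Rightarrow> quat mat" where
  "dual_mat A = map_mat dual_part A"

lemma std_mat_carrier [simp]: "A \<in> carrier_mat n m \<Longrightarrow> std_mat A \<in> carrier_mat n m"
  and dual_mat_carrier [simp]: "A \<in> carrier_mat n m \<Longrightarrow> dual_mat A \<in> carrier_mat n m"
  by (simp_all add: std_mat_def dual_mat_def)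

lemma std_mat_entry: "A \<in> carrier_mat n m \<Longrightarrow> i < n \<Longrightarrow> j < m \<Longrightarrow> std_mat A $$ (i, j) = std_part (A $$ (i, j))"
  and dual_mat_entry: "A \<in> carrier_mat n m \<Longrightarrow> i < n \<Longrightarrow> j < m \<Longrightarrow> dual_mat A $$ (i, j) = dual_part (A $$ (i, j))"
  by (auto simp: std_mat_def dual_mat_def)

lemma std_part_mult_mat:
  assumes "A \<in> carrier_mat l m" "B \<in> carrier_mat m k" "i < l" "j < k"
  shows "std_part ((A * B) $$ (i, j)) = (std_mat A * std_mat B) $$ (i, j)"
  using assms
  by (simp add: mult_mat_entry[of _ l m _ k] std_part_sum std_part_mult std_mat_entry[of _ l m]
      std_mat_entry[of _ m k] del: index_mult_mat)

lemma dual_part_mult_mat: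
  assumes "A \<in> carrier_mat l m" "B \<in> carrier_mat m k" "i < l" "j < k"
  shows "dual_part ((A * B) $$ (i, j)) =
    (std_mat A * dual_mat B) $$ (i, j) + (dual_mat A * std_mat B) $$ (i, j)"
  using assms
  by (simp add: mult_mat_entry[of _ l m _ k] dual_part_sum dual_part_mult std_mat_entry[of _ l m]
      std_mat_entry[of _ m k] dual_mat_entry[of _ l m] dual_mat_entry[of _ m k] sum.distrib
      del: index_mult_mat)

lemma std_mat_mult:
  assumes "A \<in> carrier_mat l m" "B \<in> carrier_mat m k"
  shows "std_mat (A * B) = std_mat A * std_mat B"
proof (rule eq_matI)
  have c: "A * B \<in> carrier_mat l k" using assms by (rule mult_carrier_mat)
  fix i j assume "i < dim_row (std_mat A * std_mat B)" "j < dim_col (std_mat A * std_mat B)"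
  then have "i < l" "j < k" using assms by (auto simp: std_mat_def)
  then show "std_mat (A * B) $$ (i, j) = (std_mat A * std_mat B) $$ (i, j)"
    using std_mat_entry[OF c] std_part_mult_mat[OF assms] by simp
qed (use assms in \<open>auto simp: std_mat_def\<close>)

lemma std_mat_adj: "std_mat (dquat.adj A) = quat.adj (std_mat A)"
  by (rule eq_matI) (auto simp: std_mat_def dquat.adj_def quat.adj_def dqcnj_def)

lemma dual_mat_adj: "dual_mat (dquat.adj A) = quat.adj (dual_mat A)"
  by (rule eq_matI) (auto simp: dual_mat_def dquat.adj_def quat.adj_def dqcnj_def)

lemma hermitian_std_mat: "dquat.hermitian n A \<Longrightarrow> quat.hermitian n (std_mat A)"
  unfolding dquat.hermitian_def quat.hermitian_def by (metis std_mat_adj std_mat_carrier)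

lemma hermitian_dual_mat: "dquat.hermitian n A \<Longrightarrow> quat.hermitian n (dual_mat A)"
  unfolding dquat.hermitian_def quat.hermitian_def by (metis dual_mat_adj dual_mat_carrier)

text \<open>A quaternion row is a dual quaternion row with vanishing dual part.\<close>

lemma posdef_std_mat:
  assumes "dquat.posdef n S B" "B \<in> carrier_mat n n" "S \<subseteq> {..<n}"
  shows "quat.posdef n S (std_mat B)"
  unfolding quat.posdef_def
proof (intro allI impI)
  fix w :: "quat mat" assume w: "quat.row_on n S w"
  define v where "v = map_mat (\<lambda>a. Dual a 0) w"
  have wc: "w \<in> carrier_mat 1 n" using w by (simp add: quat.row_on_def)
  have vc: "v \<in> carrier_mat 1 n" using wc by (simp add: v_def)
  have vw: "std_mat v = w" using wc by (intro eq_matI) (auto simp: std_mat_def v_def)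
  have ent: "v $$ (0, j) = Dual (w $$ (0, j)) 0" if "j < n" for j
    using that wc by (simp add: v_def)
  obtain i where i: "i \<in> S" "unit (w $$ (0, i))" using w by (auto simp: quat.row_on_def)
  have "unit (v $$ (0, i))"
    using i assms(3) ent[of i] by (auto simp: unit_dquat_iff unit_quat_iff)
  then have "dquat.row_on n S v"
    using w vc ent i(1) by (auto simp: dquat.row_on_def quat.row_on_def zero_dual_def)
  then have "0 < qre (std_part (dquat.congr v B $$ (0, 0)))" using assms by (simp add: dquat.posdef_def)
  moreover have "std_part (dquat.congr v B $$ (0, 0)) = std_mat (dquat.congr v B) $$ (0, 0)"
    using dquat.congr_carrier[OF vc assms(2)] by (simp add: std_mat_entry[of _ 1 1])
  moreover have "std_mat (dquat.congr v B) = quat.congr w (std_mat B)"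
    using vc assms(2)
    by (simp add: dquat.congr_def quat.congr_def std_mat_mult[of _ 1 n _ 1] std_mat_mult[of _ 1 n _ n]
        std_mat_adj vw mult_carrier_mat[of _ 1 n _ n])
  ultimately show "0 < qre (quat.congr w (std_mat B) $$ (0, 0))" by simp
qed

text \<open>Writing \<open>w = ws + wd \<epsilon>\<close> and \<open>\<mu> = s + \<nu> \<epsilon>\<close>, the equation splits into \<open>ws As = s ws Bs\<close> and
\<open>wd (As - s Bs) = \<nu> ws Bs - ws C\<close>, where \<open>C = Ad - s Bd\<close>. In coordinates in which \<open>As\<close> and \<open>Bs\<close> are diagonal,
\<open>I\<close> is the set of indices with eigenvalue \<open>s\<close>. The second equation is solvable for \<open>wd\<close> as soon as its
right-hand side vanishes on \<open>I\<close>, so \<open>ws\<close> is taken as an eigenvector of the block of \<open>C\<close> on \<open>I\<close>.\<close>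

theorem dquat_eigenpair:
  fixes A B :: "dquat mat"
  assumes S: "S \<subseteq> {..<n}" and ne: "S \<noteq> {}" and A: "dquat.hermitian n A" and B: "dquat.hermitian n B"
    and pd: "dquat.posdef n S B"
  shows "\<exists>w \<mu>. dquat.eigenpair n S A B w \<mu>"
proof -
  have Ac: "A \<in> carrier_mat n n" and Bc: "B \<in> carrier_mat n n"
    using A B dquat.hermitian_carrier by auto
  have lt: "j < n" if "j \<in> S" for j using that S by auto
  define As where "As = std_mat A"
  define Bs where "Bs = std_mat B"
  define Ad where "Ad = dual_mat A"
  define Bd where "Bd = dual_mat B"
  have c: "As \<in> carrier_mat n n" "Bs \<in> carrier_mat n n" "Ad \<in> carrier_mat n n" "Bd \<in> carrier_mat n n"
    using Ac Bc by (simp_all add: As_def Bs_def Ad_def Bd_def)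
  have hAs: "quat.hermitian n As" and hBs: "quat.hermitian n Bs"
    unfolding As_def Bs_def by (intro hermitian_std_mat A B)+
  have hAd: "quat.hermitian n Ad" and hBd: "quat.hermitian n Bd"
    unfolding Ad_def Bd_def by (intro hermitian_dual_mat A B)+
  have pds: "quat.posdef n S Bs" unfolding Bs_def by (rule posdef_std_mat[OF pd Bc S])
  obtain P where P: "elementary_prod n S P"
    and dA: "quat.diag_on S (quat.congr P As)" and dB: "quat.diag_on S (quat.congr P Bs)"
    using quat.simultaneous_diagonalization[OF S _ hAs hBs pds] quat_eigenpair S
    by (metis subset_trans)
  have Pc: "P \<in> carrier_mat n n" by (rule elementary_prod_carrier[OF P])
  define A' where "A' = quat.congr P As"
  define B' where "B' = quat.congr P Bs"
  have hA': "quat.hermitian n A'" and hB': "quat.hermitian n B'"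
    unfolding A'_def B'_def by (rule quat.hermitian_congr[OF Pc]; fact)+
  have A'c: "A' \<in> carrier_mat n n" and B'c: "B' \<in> carrier_mat n n"
    using hA' hB' quat.hermitian_carrier by auto
  have pd': "quat.posdef n S B'" unfolding B'_def by (rule quat.posdef_congr[OF pds c(2) P S])
  define a where "a j = qre (A' $$ (j, j))" for j
  define b where "b j = qre (B' $$ (j, j))" for j
  have A'd: "A' $$ (j, j) = of_re (a j)" and B'd: "B' $$ (j, j) = of_re (b j)" if "j \<in> S" for j
    unfolding a_def b_def
    using quat.hermitian_entry[OF hA'] quat.hermitian_entry[OF hB'] lt[OF that] selfadjoint_of_re
    by simp_all
  have b: "0 < b j" if "j \<in> S" for j
    unfolding b_def by (rule quat.posdef_diagonal[OF pd' B'c that S])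
  obtain i0 where i0: "i0 \<in> S" using ne by blast
  define s where "s = a i0 / b i0"
  define I where "I = {j \<in> S. a j = s * b j}"
  have I: "I \<subseteq> S" "i0 \<in> I" using i0 b[OF i0] by (auto simp: I_def s_def)
  define C where "C = mat n n (\<lambda>(i, j). Ad $$ (i, j) - of_re s * Bd $$ (i, j))"
  have Cc: "C \<in> carrier_mat n n" by (simp add: C_def)
  have hC: "quat.hermitian n C"
  proof -
    have "quat.adj C = C"
      by (rule eq_matI)
        (auto simp: quat.adj_def C_def quat.cnj_diff quat.cnj_mult quat.hermitian_entry[OF hAd]
          quat.hermitian_entry[OF hBd] of_re_simps of_re_commute)
    then show ?thesis using Cc by (simp add: quat.hermitian_def)
  qed
  define C' where "C' = quat.congr P C"
  have hC': "quat.hermitian n C'" unfolding C'_def by (rule quat.hermitian_congr[OF Pc hC])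
  have C'c: "C' \<in> carrier_mat n n" using hC' quat.hermitian_carrier by auto
  have "I \<subseteq> {..<n}" "I \<noteq> {}" using I S by auto
  then obtain y \<nu> where ey: "quat.eigenpair n I C' B' y \<nu>"
    using quat_eigenpair[OF _ _ hC' hB' quat.posdef_mono[OF pd' I(1)]] by blast
  have y: "quat.row_on n I y" "qcnj \<nu> = \<nu>"
    and ey': "\<And>j. j \<in> I \<Longrightarrow> (y * C') $$ (0, j) = \<nu> * (y * B') $$ (0, j)"
    using ey by (auto simp: quat.eigenpair_def)
  have yc: "y \<in> carrier_mat 1 n" and y0: "\<And>j. j < n \<Longrightarrow> j \<notin> I \<Longrightarrow> y $$ (0, j) = 0"
    using y by (auto simp: quat.row_on_def)
  \<comment> \<open>the first-order correction; off \<open>I\<close> the coefficient \<open>a j - s * b j\<close> is nonzero\<close>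
  define z where "z = mat 1 n (\<lambda>(i, j). if j \<in> S - I
    then (y * C') $$ (0, j) * of_re (- 1 / (a j - s * b j)) else 0)"
  have zc: "z \<in> carrier_mat 1 n" by (simp add: z_def)
  have z0: "z $$ (0, j) = 0" if "j < n" "j \<notin> S - I" for j
    using that by (simp only: z_def index_mat(1) prod.case less_one if_False)
  have diag: "(x * M) $$ (0, j) = x $$ (0, j) * M $$ (j, j)"
    if "x \<in> carrier_mat 1 n" "M \<in> carrier_mat n n" "quat.diag_on S M" "j \<in> S"
      "\<And>j. j < n \<Longrightarrow> j \<notin> S \<Longrightarrow> x $$ (0, j) = 0" for x M j
  proof -
    have "(x * M) $$ (0, j) = (\<Sum>d<n. x $$ (0, d) * M $$ (d, j))"
      using that lt by (intro mult_mat_entry[of _ 1 n _ n]) auto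
    also have "\<dots> = (\<Sum>d<n. if d = j then x $$ (0, j) * M $$ (j, j) else 0)"
    proof (rule sum.cong)
      fix d assume "d \<in> {..<n}"
      then show "x $$ (0, d) * M $$ (d, j) = (if d = j then x $$ (0, j) * M $$ (j, j) else 0)"
        using that(3,4) that(5)[of d] by (cases "d \<in> S") (auto simp: quat.diag_on_def)
    qed simp
    finally show ?thesis using lt that by simp
  qed
  have dA': "quat.diag_on S A'" and dB': "quat.diag_on S B'"
    using dA dB by (simp_all add: A'_def B'_def)
  have yS: "y $$ (0, j) = 0" if "j < n" "j \<notin> S" for j using y0[OF that(1)] that I by auto
  have zS: "z $$ (0, j) = 0" if "j < n" "j \<notin> S" for j using z0[OF that(1)] that by auto
  note yA = diag[OF yc A'c dA' _ yS] and yB = diag[OF yc B'c dB' _ yS]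
    and zA = diag[OF zc A'c dA' _ zS] and zB = diag[OF zc B'c dB' _ zS]
  have mid: "of_re s * (x * of_re (b j)) = x * of_re (s * b j)" for x j
    by (simp only: of_re_simps(3)[symmetric] mult.assoc[symmetric] of_re_commute[of s x])
  have eqs: "(y * A') $$ (0, j) = of_re s * (y * B') $$ (0, j)" if j: "j \<in> S" for j
    using yA[OF j] yB[OF j] A'd[OF j] B'd[OF j] y0[OF lt[OF j]] j mid
    by (cases "j \<in> I") (auto simp: I_def)
  have eqd: "(z * A') $$ (0, j) + (y * C') $$ (0, j) =
      of_re s * (z * B') $$ (0, j) + \<nu> * (y * B') $$ (0, j)" if j: "j \<in> S" for j
  proof (cases "j \<in> I")
    case True
    then show ?thesis using zA[OF j] zB[OF j] z0[OF lt[OF j]] ey'[OF True] by simp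
  next
    case False
    have nz: "a j - s * b j \<noteq> 0" using False j by (simp add: I_def)
    then have "- 1 / (a j - s * b j) * (a j - s * b j) = - 1" by simp
    then have "z $$ (0, j) * of_re (a j - s * b j) = - (y * C') $$ (0, j)"
      using False j lt[OF j] by (simp add: z_def mult.assoc of_re_simps(3) of_re_neg_one)
    then have "z $$ (0, j) * of_re (a j) + (y * C') $$ (0, j) = z $$ (0, j) * of_re (s * b j)"
      unfolding of_re_simps(2)[symmetric] right_diff_distrib by (simp add: algebra_simps)
    then show ?thesis
      using zA[OF j] zB[OF j] yB[OF j] A'd[OF j] B'd[OF j] y0[OF lt[OF j] False] mid by simp
  qed
  define ws where "ws = y * P"
  define wd where "wd = z * P"
  have wc: "ws \<in> carrier_mat 1 n" "wd \<in> carrier_mat 1 n"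
    using yc zc Pc by (simp_all add: ws_def wd_def mult_carrier_mat[of _ 1 n _ n])
  have assoc: "x * quat.congr P M = x * P * M * quat.adj P"
    if "x \<in> carrier_mat 1 n" "M \<in> carrier_mat n n" for x M
    unfolding quat.congr_def using Pc that
    by (simp add: assoc_mult_mat[of _ 1 n _ n _ n] assoc_mult_mat[of _ n n _ n _ n]
        mult_carrier_mat[of _ 1 n _ n] mult_carrier_mat[of _ n n _ n])
  have ent: "(x * quat.adj P) $$ (0, j) = (\<Sum>d<n. x $$ (0, d) * quat.adj P $$ (d, j))"
    if "x \<in> carrier_mat 1 n" "j \<in> S" for x j
    using that Pc lt by (intro mult_mat_entry[of _ 1 n _ n]) auto
  have wMc: "ws * M \<in> carrier_mat 1 n" "wd * M \<in> carrier_mat 1 n" if "M \<in> carrier_mat n n" for M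
    using wc that by (simp_all add: mult_carrier_mat[of _ 1 n _ n])
  have es: "(ws * As) $$ (0, j) = of_re s * (ws * Bs) $$ (0, j)" if j: "j \<in> S" for j
  proof -
    define u where "u = mat 1 n (\<lambda>(i, d). (ws * As) $$ (0, d) - of_re s * (ws * Bs) $$ (0, d))"
    have uc: "u \<in> carrier_mat 1 n" by (simp add: u_def)
    have "(u * quat.adj P) $$ (0, j) = 0" if j: "j \<in> S" for j
    proof -
      have "(u * quat.adj P) $$ (0, j) = (ws * As * quat.adj P) $$ (0, j)
          - of_re s * (ws * Bs * quat.adj P) $$ (0, j)"
        using j uc wMc c
        by (simp add: ent sum_distrib_left sum_subtractf[symmetric] left_diff_distrib mult.assoc u_def)
      then show ?thesis
        using eqs[OF j] assoc[OF yc] c by (simp add: A'_def B'_def ws_def)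
    qed
    then have "u $$ (0, j) = 0" by (rule quat.row_zero_of_mult_adj[OF P S uc _ j])
    then show ?thesis using lt[OF j] by (simp add: u_def)
  qed
  have ed: "(wd * As) $$ (0, j) + (ws * C) $$ (0, j) =
      of_re s * (wd * Bs) $$ (0, j) + \<nu> * (ws * Bs) $$ (0, j)" if j: "j \<in> S" for j
  proof -
    define u where "u = mat 1 n (\<lambda>(i, d). (wd * As) $$ (0, d) + (ws * C) $$ (0, d)
      - (of_re s * (wd * Bs) $$ (0, d) + \<nu> * (ws * Bs) $$ (0, d)))"
    have uc: "u \<in> carrier_mat 1 n" by (simp add: u_def)
    have "(u * quat.adj P) $$ (0, j) = 0" if j: "j \<in> S" for j
    proof -
      have "(u * quat.adj P) $$ (0, j) =
          (wd * As * quat.adj P) $$ (0, j) + (ws * C * quat.adj P) $$ (0, j)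
          - (of_re s * (wd * Bs * quat.adj P) $$ (0, j) + \<nu> * (ws * Bs * quat.adj P) $$ (0, j))"
        using j uc wMc c Cc
        by (simp add: ent sum_distrib_left sum_subtractf sum.distrib left_diff_distrib
            distrib_right mult.assoc u_def)
      then show ?thesis
        using eqd[OF j] assoc[OF yc] assoc[OF zc] c Cc by (simp add: A'_def B'_def C'_def ws_def wd_def)
    qed
    then have "u $$ (0, j) = 0" by (rule quat.row_zero_of_mult_adj[OF P S uc _ j])
    then show ?thesis using lt[OF j] by (simp add: u_def)
  qed
  have wsC: "(ws * C) $$ (0, j) = (ws * Ad) $$ (0, j) - of_re s * (ws * Bd) $$ (0, j)" if "j < n" for j
  proof -
    have "of_re s * (x * y) = x * (of_re s * y)" for x y
      by (simp only: mult.assoc[symmetric] of_re_commute[of s x])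
    then show ?thesis
      using wc Cc c that
      by (simp add: mult_mat_entry[of _ 1 n _ n] C_def right_diff_distrib sum_subtractf
          sum_distrib_left del: index_mult_mat)
  qed
  define w where "w = mat 1 n (\<lambda>(i, j). Dual (ws $$ (0, j)) (wd $$ (0, j)))"
  have wwc: "w \<in> carrier_mat 1 n" by (simp add: w_def)
  have stdw: "std_mat w = ws" "dual_mat w = wd"
    using wc by (auto simp: std_mat_def dual_mat_def w_def intro!: eq_matI)
  define \<mu> where "\<mu> = Dual (of_re s) \<nu>"
  have "(w * A) $$ (0, j) = \<mu> * (w * B) $$ (0, j)" if j: "j \<in> S" for j
  proof (rule iffD2[OF dual_eq_iff], intro conjI)
    have jn: "j < n" by (rule lt[OF j])
    show "std_part ((w * A) $$ (0, j)) = std_part (\<mu> * (w * B) $$ (0, j))"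
      using es[OF j] jn wwc Ac Bc
      by (simp add: std_part_mult \<mu>_def std_part_mult_mat[of _ 1 n _ n] stdw As_def Bs_def
          del: index_mult_mat)
    show "dual_part ((w * A) $$ (0, j)) = dual_part (\<mu> * (w * B) $$ (0, j))"
      using ed[OF j] wsC[OF jn] jn wwc Ac Bc
      by (simp add: dual_part_mult \<mu>_def std_part_mult_mat[of _ 1 n _ n]
          dual_part_mult_mat[of _ 1 n _ n] stdw As_def Bs_def Ad_def Bd_def algebra_simps
          del: index_mult_mat)
  qed
  moreover have "dqcnj \<mu> = \<mu>" using y(2) by (simp add: \<mu>_def dqcnj_def of_re_simps)
  moreover have "dquat.row_on n S w"
  proof -
    have r: "quat.row_on n S ws"
      unfolding ws_def by (rule quat.row_on_mult[OF quat.row_on_mono[OF y(1) I(1)] P S])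
    then obtain i where i: "i \<in> S" "unit (ws $$ (0, i))" by (auto simp: quat.row_on_def)
    then have "unit (w $$ (0, i))" using lt by (simp add: w_def unit_dquat_iff unit_quat_iff)
    moreover have "wd $$ (0, j) = 0" if j: "j < n" "j \<notin> S" for j
    proof -
      have "z $$ (0, d) * P $$ (d, j) = 0" if "d < n" for d
        using zS[OF that] elementary_prod_entry[OF P that, of j] j by (cases "d \<in> S") auto
      then show ?thesis
        unfolding wd_def using zc Pc j by (subst mult_mat_entry[of _ 1 n _ n]) auto
    qed
    ultimately show ?thesis
      using r i wwc by (auto simp: dquat.row_on_def quat.row_on_def w_def zero_dual_def)
  qed
  ultimately show ?thesis by (auto simp: dquat.eigenpair_def)
qed

section \<open>Determinants of diagonalized matrices\<close>

lemma hermitian_fun_entry: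
  assumes "dquat.hermitian n M"
  shows "dquat.hermitian_fun (entry M)"
  using assms dquat.hermitian_entry[OF assms] dquat.hermitian_carrier[OF assms]
  by (auto simp: dquat.hermitian_fun_def entry_def)

lemma set_det_congr_row_add:
  fixes M :: "dquat mat"
  assumes M: "dquat.hermitian n M" and i: "i < n" and y: "y i = 0"
  shows "set_det (entry (dquat.congr (row_add n i y) M)) {0..<n} = set_det (entry M) {0..<n}"
proof -
  let ?R = "row_add n i y" and ?T = "{0..<n} - {i}"
  let ?N = "dquat.congr ?R M"
  have Mc: "M \<in> carrier_mat n n" by (rule dquat.hermitian_carrier[OF M])
  have N: "dquat.hermitian n ?N" by (rule dquat.hermitian_congr[OF row_add_carrier M])
  have Nc: "?N \<in> carrier_mat n n" by (rule dquat.hermitian_carrier[OF N])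
  have e: "entry M a b = M $$ (a, b)" "entry ?N a b = ?N $$ (a, b)" if "a < n" "b < n" for a b
    using that Mc Nc by (auto simp: entry_def)
  have N_entry: "?N $$ (a, b) = (?R * M) $$ (a, b) +
      (if b = i then \<Sum>c<n. (?R * M) $$ (a, c) * dqcnj (y c) else 0)" if "a < n" "b < n" for a b
    unfolding dquat.congr_def using that Mc by (intro dquat.mult_adj_row_add[where k = n]) simp_all
  note RM = row_add_mult[OF Mc]
  have drop: "(\<Sum>c<n. f c) = (\<Sum>c\<in>?T. f c)" if "f i = 0" for f :: "nat \<Rightarrow> dquat"
    using that i by (intro sum.mono_neutral_right) auto
  have "set_det (entry ?N) (insert i ?T) = set_det (entry M) (insert i ?T)"
  proof (rule set_det_row_add[where y = y])
    show "entry ?N a b = entry M a b" if "a \<in> ?T" "b \<in> ?T" for a b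
      using that N_entry[of a b] RM[of a b] e by simp
    show "entry ?N i b = entry M i b + (\<Sum>c\<in>?T. y c * entry M c b)" if "b \<in> ?T" for b
      using that i N_entry[of i b] RM[of i b] e drop[of "\<lambda>c. y c * M $$ (c, b)"] y by simp
    have "?N $$ (i, i) = (M $$ (i, i) + (\<Sum>c<n. y c * M $$ (c, i))) +
        (\<Sum>c<n. (M $$ (i, c) + (\<Sum>d<n. y d * M $$ (d, c))) * dqcnj (y c))"
      using N_entry[OF i i] RM[OF i] i by simp
    also have "(\<Sum>c<n. (M $$ (i, c) + (\<Sum>d<n. y d * M $$ (d, c))) * dqcnj (y c)) =
        (\<Sum>c\<in>?T. (M $$ (i, c) + (\<Sum>d\<in>?T. y d * M $$ (d, c))) * dqcnj (y c))"
      using drop[of "\<lambda>c. (M $$ (i, c) + (\<Sum>d<n. y d * M $$ (d, c))) * dqcnj (y c)"]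
        drop[of "\<lambda>d. y d * M $$ (d, _)"] y by simp
    also have "\<dots> = (\<Sum>c\<in>?T. M $$ (i, c) * dqcnj (y c)) +
        (\<Sum>c\<in>?T. \<Sum>d\<in>?T. y c * M $$ (c, d) * dqcnj (y d))"
      unfolding distrib_right sum.distrib sum_distrib_right by (subst (2) sum.swap) simp
    also have "(\<Sum>c<n. y c * M $$ (c, i)) = (\<Sum>c\<in>?T. y c * M $$ (c, i))"
      using drop[of "\<lambda>c. y c * M $$ (c, i)"] y by simp
    finally show "entry ?N i i = entry M i i + (\<Sum>c\<in>?T. y c * entry M c i) +
        (\<Sum>c\<in>?T. entry M i c * dqcnj (y c)) +
        (\<Sum>c\<in>?T. \<Sum>d\<in>?T. y c * entry M c d * dqcnj (y d))"
      using i by (simp add: e add.assoc cong: sum.cong_simp)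
  qed (use hermitian_fun_entry[OF M] hermitian_fun_entry[OF N] in auto)
  moreover have "insert i ?T = {0..<n}" using i by auto
  ultimately show ?thesis by simp
qed

text \<open>Each factor acts as in \<open>set_det_row_add\<close>, so no determinant of \<open>P\<close> appears.\<close>

theorem set_det_congr:
  fixes M :: "dquat mat"
  assumes "elementary_prod n S P" "dquat.hermitian n M"
  shows "set_det (entry (dquat.congr P M)) {0..<n} = set_det (entry M) {0..<n}"
  using assms(1)
proof (induction rule: elementary_prod.induct)
  case one
  have "dquat.congr (1\<^sub>m n) M = M"
    using dquat.hermitian_carrier[OF assms(2)] by (simp add: dquat.congr_def)
  then show ?case by simp
next
  case (step P i y)
  have P: "P \<in> carrier_mat n n" by (rule elementary_prod_carrier[OF step.hyps(1)])
  have "dquat.congr (row_add n i y * P) M = dquat.congr (row_add n i y) (dquat.congr P M)"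
    using dquat.congr_congr[OF row_add_carrier P] dquat.hermitian_carrier[OF assms(2)] by simp
  then show ?case
    using set_det_congr_row_add[OF dquat.hermitian_congr[OF P assms(2)] step.hyps(3), of y]
      step by simp
qed

lemma set_det_diagonal:
  assumes E: "dquat.hermitian_fun E"
    and diag: "\<And>i j. i < n \<Longrightarrow> j < n \<Longrightarrow> i \<noteq> j \<Longrightarrow> E i j = 0"
  shows "set_det E {0..<n} = prod_list (map (\<lambda>i. E i i) [0..<n])"
  using diag
proof (induction n)
  case 0
  then show ?case by simp
next
  case (Suc n)
  have "set_det E (insert n {0..<n}) = E n n * set_det E {0..<n}"
    using set_det_bordered[OF E, of "{0..<n}" n] Suc.prems by simp
  also have "\<dots> = set_det E {0..<n} * E n n"
    using E by (intro dquat.selfadjoint_commute) (simp add: dquat.hermitian_fun_def)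
  also have "set_det E {0..<n} = prod_list (map (\<lambda>i. E i i) [0..<n])"
    using Suc by simp
  finally show ?case by (simp add: atLeast0_lessThan_Suc)
qed

lemma prod_list_mult_selfadjoint:
  assumes "\<And>i. i \<in> set xs \<Longrightarrow> dqcnj (f i) = f i" "\<And>i. i \<in> set xs \<Longrightarrow> dqcnj (g i) = g i"
  shows "prod_list (map (\<lambda>i. f i * g i) xs) = prod_list (map f xs) * prod_list (map g xs)"
  using assms
proof (induction xs)
  case (Cons i xs)
  have "g i * prod_list (map f xs) = prod_list (map f xs) * g i"
    using Cons.prems by (intro dquat.selfadjoint_commute) simp
  then have "f i * g i * (prod_list (map f xs) * prod_list (map g xs)) =
      f i * prod_list (map f xs) * (g i * prod_list (map g xs))"
    by (metis mult.assoc)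
  then show ?case using Cons by simp
qed simp

text \<open>Self-adjoint factors commute, so the order of the list does not matter.\<close>

lemma prod_list_mset_selfadjoint:
  assumes "mset xs = mset ys" "\<And>x. x \<in> set xs \<Longrightarrow> dqcnj x = x"
  shows "prod_list xs = prod_list ys"
  using assms
proof (induction xs arbitrary: ys)
  case (Cons x xs)
  then have "x \<in> set ys" by (metis list.set_intros(1) set_mset_mset)
  then obtain us vs where ys: "ys = us @ x # vs" by (meson split_list)
  have "mset xs = mset (us @ vs)" using Cons.prems(1) ys by simp
  then have "prod_list xs = prod_list (us @ vs)" by (rule Cons.IH) (simp add: Cons.prems(2))
  moreover have "x * prod_list us = prod_list us * x"
    using Cons.prems by (intro dquat.selfadjoint_commute) simp
  ultimately show ?case using ys by (simp flip: mult.assoc)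
qed simp

definition diag_matrix :: "nat \<Rightarrow> (nat \<Rightarrow> 'a::zero) \<Rightarrow> 'a mat" where
  "diag_matrix n d = mat n n (\<lambda>(i, j). if i = j then d i else 0)"

lemma diag_matrix_carrier [simp]: "diag_matrix n d \<in> carrier_mat n n"
  by (simp add: diag_matrix_def)

lemma mult_diag_matrix:
  fixes X :: "'a::ring_1 mat"
  assumes "X \<in> carrier_mat k n" "i < k" "j < n"
  shows "(X * diag_matrix n d) $$ (i, j) = X $$ (i, j) * d j"
proof -
  have "(X * diag_matrix n d) $$ (i, j) = (\<Sum>c<n. X $$ (i, c) * diag_matrix n d $$ (c, j))"
    using assms by (intro mult_mat_entry[of _ k n _ n]) auto
  also have "\<dots> = (\<Sum>c<n. if c = j then X $$ (i, j) * d j else 0)"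
    using assms by (intro sum.cong) (auto simp: diag_matrix_def)
  finally show ?thesis using assms by simp
qed

lemma diag_matrix_mult:
  fixes d e :: "nat \<Rightarrow> 'a::ring_1"
  shows "diag_matrix n d * diag_matrix n e = diag_matrix n (\<lambda>i. d i * e i)"
proof (rule eq_matI)
  fix i j assume "i < dim_row (diag_matrix n (\<lambda>i. d i * e i))" "j < dim_col (diag_matrix n (\<lambda>i. d i * e i))"
  then have "i < n" "j < n" by (simp_all add: diag_matrix_def)
  then show "(diag_matrix n d * diag_matrix n e) $$ (i, j) = diag_matrix n (\<lambda>i. d i * e i) $$ (i, j)"
    by (subst mult_diag_matrix[where k = n]) (auto simp: diag_matrix_def)
qed (simp_all add: diag_matrix_def)

lemma eq_diag_matrix:
  assumes "M \<in> carrier_mat n n" "\<And>i j. i < n \<Longrightarrow> j < n \<Longrightarrow> i \<noteq> j \<Longrightarrow> M $$ (i, j) = 0"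
  shows "M = diag_matrix n (\<lambda>i. M $$ (i, i))"
  using assms by (intro eq_matI) (auto simp: diag_matrix_def)

lemma posdef_one:
  assumes "S \<subseteq> {..<n}"
  shows "dquat.posdef n S (1\<^sub>m n)"
  unfolding dquat.posdef_def
proof (intro allI impI)
  fix w :: "dquat mat" assume w: "dquat.row_on n S w"
  have wc: "w \<in> carrier_mat 1 n" using w by (simp add: dquat.row_on_def)
  obtain i where i: "i \<in> S" "unit (w $$ (0, i))" using w by (auto simp: dquat.row_on_def)
  have "i < n" using i assms by auto
  define v where "v j = std_part (w $$ (0, j))" for j
  have "dquat.congr w (1\<^sub>m n) $$ (0, 0) = (\<Sum>j<n. w $$ (0, j) * dquat.adj w $$ (j, 0))"
    unfolding dquat.congr_def right_mult_one_mat[OF wc] using wc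
    by (intro mult_mat_entry[of _ 1 n _ 1]) auto
  then have "std_part (dquat.congr w (1\<^sub>m n) $$ (0, 0)) = (\<Sum>j<n. v j * qcnj (v j))"
    using wc by (simp add: std_part_sum std_part_mult dquat.adj_entry v_def dqcnj_def)
  also have "\<dots> = of_re (\<Sum>j<n. qre (v j * qcnj (v j)))"
    unfolding of_re_sum using mult_qcnj(1) by simp
  finally have eq: "qre (std_part (dquat.congr w (1\<^sub>m n) $$ (0, 0))) = (\<Sum>j<n. qre (v j * qcnj (v j)))"
    by (simp add: of_re_simps)
  have "0 \<le> qre (v j * qcnj (v j))" for j
  proof (cases "v j = 0")
    case True
    then have "v j * qcnj (v j) = 0" by simp
    then show ?thesis by (simp add: zero_quat_def)
  qed (simp add: mult_qcnj(2) less_imp_le)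
  moreover have "0 < qre (v i * qcnj (v i))"
    using i mult_qcnj(2)[of "v i"] by (simp add: v_def unit_dquat_iff)
  ultimately show "0 < qre (std_part (dquat.congr w (1\<^sub>m n) $$ (0, 0)))"
    unfolding eq using \<open>i < n\<close> by (intro sum_pos2[of _ i]) auto
qed

text \<open>The rows of \<open>P\<close> are orthogonal eigenvectors, not normalized: \<open>\<beta> i\<close> is the squared length of row \<open>i\<close>.\<close>

theorem spectral_congruence:
  assumes A: "dquat.hermitian n A"
  obtains P \<beta> \<mu> where "elementary_prod n {..<n} P"
    "\<And>i. i < n \<Longrightarrow> dqcnj (\<beta> i) = \<beta> i" "\<And>i. i < n \<Longrightarrow> dqcnj (\<mu> i) = \<mu> i"
    "dquat.congr P (1\<^sub>m n) = diag_matrix n \<beta>"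
    "A * dquat.adj P = dquat.adj P * diag_matrix n \<mu>"
proof -
  have Ac: "A \<in> carrier_mat n n" by (rule dquat.hermitian_carrier[OF A])
  have one: "dquat.hermitian n (1\<^sub>m n)" by (simp add: dquat.hermitian_def)
  have "\<exists>P. elementary_prod n {..<n} P \<and> dquat.diag_on {..<n} (dquat.congr P A) \<and>
      dquat.diag_on {..<n} (dquat.congr P (1\<^sub>m n))"
  proof (rule dquat.simultaneous_diagonalization[OF subset_refl _ A one posdef_one[OF subset_refl]])
    show "\<exists>w \<mu>. dquat.eigenpair n T A' B' w \<mu>" if "T \<subseteq> {..<n}" "T \<noteq> {}" "dquat.hermitian n A'"
      "dquat.hermitian n B'" "dquat.posdef n T B'" for T A' B'
      using that by (rule dquat_eigenpair)
  qed
  then obtain P where P: "elementary_prod n {..<n} P"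
    and dA: "dquat.diag_on {..<n} (dquat.congr P A)"
    and dB: "dquat.diag_on {..<n} (dquat.congr P (1\<^sub>m n))" by blast
  have Pc: "P \<in> carrier_mat n n" by (rule elementary_prod_carrier[OF P])
  have Sc: "dquat.adj P \<in> carrier_mat n n" using Pc by simp
  define \<alpha> where "\<alpha> i = dquat.congr P A $$ (i, i)" for i
  define \<beta> where "\<beta> i = dquat.congr P (1\<^sub>m n) $$ (i, i)" for i
  have hA: "dquat.hermitian n (dquat.congr P A)" by (rule dquat.hermitian_congr[OF Pc A])
  have hB: "dquat.hermitian n (dquat.congr P (1\<^sub>m n))" by (rule dquat.hermitian_congr[OF Pc one])
  have A': "dquat.congr P A = diag_matrix n \<alpha>"
    unfolding \<alpha>_def using dA dquat.hermitian_carrier[OF hA]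
    by (intro eq_diag_matrix) (auto simp: dquat.diag_on_def)
  have B': "dquat.congr P (1\<^sub>m n) = diag_matrix n \<beta>"
    unfolding \<beta>_def using dB dquat.hermitian_carrier[OF hB]
    by (intro eq_diag_matrix) (auto simp: dquat.diag_on_def)
  have sa: "dqcnj (\<alpha> i) = \<alpha> i" "dqcnj (\<beta> i) = \<beta> i" if "i < n" for i
    using dquat.hermitian_entry[OF hA that that] dquat.hermitian_entry[OF hB that that]
    by (simp_all add: \<alpha>_def \<beta>_def)
  have "\<exists>\<gamma>. dqcnj \<gamma> = \<gamma> \<and> \<beta> i * \<gamma> = 1" if "i < n" for i
  proof -
    have "dquat.posdef n {..<n} (dquat.congr P (1\<^sub>m n))"
      by (rule dquat.posdef_congr[OF posdef_one[OF subset_refl] _ P subset_refl]) simp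
    then have "0 < qre (std_part (\<beta> i))"
      unfolding \<beta>_def using that dquat.hermitian_carrier[OF hB] by (intro dquat.posdef_diagonal) auto
    then have "unit (\<beta> i)" by (rule dquat.pos_unit)
    then show ?thesis using dquat.selfadjoint_inverse[OF sa(2)[OF that]] by metis
  qed
  then obtain \<gamma> where g: "\<And>i. i < n \<Longrightarrow> dqcnj (\<gamma> i) = \<gamma> i" "\<And>i. i < n \<Longrightarrow> \<beta> i * \<gamma> i = 1" by metis
  define \<mu> where "\<mu> i = \<gamma> i * \<alpha> i" for i
  have mu: "dqcnj (\<mu> i) = \<mu> i" if "i < n" for i
    using g(1)[OF that] sa(1)[OF that] dquat.selfadjoint_commute[OF g(1)[OF that], of "\<alpha> i"]
    by (simp add: \<mu>_def dquat.cnj_mult)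
  have "\<beta> i * \<mu> i = \<alpha> i" if "i < n" for i
    using g(2)[OF that] by (simp add: \<mu>_def flip: mult.assoc)
  then have D: "diag_matrix n \<beta> * diag_matrix n \<mu> = diag_matrix n \<alpha>"
    unfolding diag_matrix_mult by (auto simp: diag_matrix_def intro!: eq_matI)
  obtain Q where Q: "elementary_prod n {..<n} Q" "Q * P = 1\<^sub>m n"
    using elementary_prod_inverse[OF P] by blast
  have Qc: "Q \<in> carrier_mat n n" by (rule elementary_prod_carrier[OF Q(1)])
  have undo: "M * dquat.adj P = Q * dquat.congr P M" if "M \<in> carrier_mat n n" for M
  proof -
    have "Q * dquat.congr P M = Q * P * (M * dquat.adj P)"
      unfolding dquat.congr_def using Qc Pc Sc that
      by (simp add: assoc_mult_mat[of _ n n _ n _ n] mult_carrier_mat[of _ n n _ n])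
    then show ?thesis using Q(2) Sc that by (simp add: mult_carrier_mat[of _ n n _ n])
  qed
  have "A * dquat.adj P = Q * diag_matrix n \<alpha>" using undo[OF Ac] A' by simp
  also have "\<dots> = Q * diag_matrix n \<beta> * diag_matrix n \<mu>"
    using Qc by (simp add: assoc_mult_mat[of _ n n _ n _ n] D)
  also have "Q * diag_matrix n \<beta> = dquat.adj P" using undo[of "1\<^sub>m n"] B' Sc by simp
  finally show thesis using that P sa(2) mu B' by blast
qed

lemma set_det_diag_congr:
  assumes M: "dquat.hermitian n M" and P: "elementary_prod n S P"
    and d: "dquat.congr P M = diag_matrix n d"
  shows "set_det (entry M) {0..<n} = prod_list (map d [0..<n])"
proof -
  have h: "dquat.hermitian n (dquat.congr P M)"
    by (rule dquat.hermitian_congr[OF elementary_prod_carrier[OF P] M])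
  have "set_det (entry M) {0..<n} = set_det (entry (diag_matrix n d)) {0..<n}"
    using set_det_congr[OF P M] d by simp
  also have "\<dots> = prod_list (map (\<lambda>i. entry (diag_matrix n d) i i) [0..<n])"
    using hermitian_fun_entry[OF h] unfolding d
    by (intro set_det_diagonal) (auto simp: entry_def diag_matrix_def)
  also have "map (\<lambda>i. entry (diag_matrix n d) i i) [0..<n] = map d [0..<n]"
    by (simp add: entry_def diag_matrix_def)
  finally show ?thesis .
qed

lemma hermitian_square:
  assumes "dquat.hermitian n A"
  shows "dquat.hermitian n (A * A)"
  using assms by (auto simp: dquat.hermitian_def dquat.adj_mult[of A n n A n] intro: mult_carrier_mat)

text \<open>The identity, \<open>A\<close> and \<open>A * A\<close> are all congruent to diagonal matrices by the same \<open>P\<close>. The first of these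
congruences shows that the \<open>\<beta> i\<close> have product \<open>1\<close>.\<close>

theorem set_det_eigenvalues:
  assumes A: "dquat.hermitian n A" and P: "elementary_prod n S P"
    and \<beta>: "\<And>i. i < n \<Longrightarrow> dqcnj (\<beta> i) = \<beta> i" and \<mu>: "\<And>i. i < n \<Longrightarrow> dqcnj (\<mu> i) = \<mu> i"
    and d: "dquat.congr P (1\<^sub>m n) = diag_matrix n \<beta>"
    and e: "A * dquat.adj P = dquat.adj P * diag_matrix n \<mu>"
  shows "set_det (entry A) {0..<n} = prod_list (map \<mu> [0..<n])"
    and "set_det (entry (A * A)) {0..<n} = prod_list (map (\<lambda>i. \<mu> i * \<mu> i) [0..<n])"
proof -
  have Ac: "A \<in> carrier_mat n n" by (rule dquat.hermitian_carrier[OF A])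
  have Pc: "P \<in> carrier_mat n n" by (rule elementary_prod_carrier[OF P])
  have Sc: "dquat.adj P \<in> carrier_mat n n" using Pc by simp
  have one: "dquat.hermitian n (1\<^sub>m n)" by (simp add: dquat.hermitian_def)
  have PS: "P * dquat.adj P = diag_matrix n \<beta>" using d Pc by (simp add: dquat.congr_def)
  have "set_det (entry (1\<^sub>m n :: dquat mat)) {0..<n} = prod_list (map (\<lambda>_. 1) [0..<n])"
  proof (rule set_det_diag_congr[OF one elementary_prod.one])
    show "dquat.congr (1\<^sub>m n) (1\<^sub>m n) = diag_matrix n (\<lambda>_. 1)"
      by (auto simp: dquat.congr_def diag_matrix_def intro!: eq_matI)
  qed
  then have b1: "prod_list (map \<beta> [0..<n]) = 1"
    using set_det_diag_congr[OF one P d] by (simp add: map_replicate_const)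
  have cA: "dquat.congr P A = diag_matrix n (\<lambda>i. \<beta> i * \<mu> i)"
  proof -
    have "dquat.congr P A = P * (A * dquat.adj P)"
      unfolding dquat.congr_def using Pc Ac Sc by (simp add: assoc_mult_mat[of _ n n _ n _ n])
    also have "\<dots> = P * dquat.adj P * diag_matrix n \<mu>"
      unfolding e using Pc Sc by (simp add: assoc_mult_mat[of _ n n _ n _ n])
    finally show ?thesis by (simp add: PS diag_matrix_mult)
  qed
  have cAA: "dquat.congr P (A * A) = diag_matrix n (\<lambda>i. \<beta> i * (\<mu> i * \<mu> i))"
  proof -
    have "dquat.congr P (A * A) = P * (A * (A * dquat.adj P))"
      unfolding dquat.congr_def using Pc Ac Sc
      by (simp add: assoc_mult_mat[of _ n n _ n _ n] mult_carrier_mat[of _ n n _ n])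
    also have "A * (A * dquat.adj P) = dquat.adj P * (diag_matrix n \<mu> * diag_matrix n \<mu>)"
    proof -
      have "A * (dquat.adj P * diag_matrix n \<mu>) = A * dquat.adj P * diag_matrix n \<mu>"
        using assoc_mult_mat[OF Ac Sc diag_matrix_carrier] by simp
      also have "\<dots> = dquat.adj P * (diag_matrix n \<mu> * diag_matrix n \<mu>)"
        unfolding e by (rule assoc_mult_mat[OF Sc diag_matrix_carrier diag_matrix_carrier])
      finally show ?thesis by (simp only: e)
    qed
    also have "P * \<dots> = P * dquat.adj P * (diag_matrix n \<mu> * diag_matrix n \<mu>)"
      using assoc_mult_mat[OF Pc Sc mult_carrier_mat[OF diag_matrix_carrier diag_matrix_carrier]] by simp
    finally show ?thesis by (simp add: PS diag_matrix_mult)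
  qed
  have mm: "dqcnj (\<mu> i * \<mu> i) = \<mu> i * \<mu> i" if "i < n" for i
    using \<mu>[OF that] by (simp add: dquat.cnj_mult)
  show "set_det (entry A) {0..<n} = prod_list (map \<mu> [0..<n])"
    unfolding set_det_diag_congr[OF A P cA]
    using \<beta> \<mu> b1 by (subst prod_list_mult_selfadjoint) auto
  show "set_det (entry (A * A)) {0..<n} = prod_list (map (\<lambda>i. \<mu> i * \<mu> i) [0..<n])"
    unfolding set_det_diag_congr[OF hermitian_square[OF A] P cAA]
    using \<beta> mm b1 by (subst prod_list_mult_selfadjoint) auto
qed

section \<open>Multiplicities and the main result\<close>

text \<open>Gaussian elimination over the division ring, with the unknowns on the right.\<close>

lemma quat_homogeneous_system:
  fixes M :: "'i \<Rightarrow> 'j \<Rightarrow> quat"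
  assumes "finite K" "finite J" "card K < card J"
  shows "\<exists>c. (\<exists>j\<in>J. c j \<noteq> 0) \<and> (\<forall>i\<in>K. (\<Sum>j\<in>J. M i j * c j) = 0)"
  using assms
proof (induction K arbitrary: J M rule: finite_induct)
  case empty
  then have "J \<noteq> {}" by auto
  then show ?case by (intro exI[of _ "\<lambda>_. 1"]) auto
next
  case (insert i K)
  show ?case
  proof (cases "\<forall>j\<in>J. M i j = 0")
    case True
    have "card K < card J" using insert by simp
    then obtain c where "\<exists>j\<in>J. c j \<noteq> 0" "\<forall>i\<in>K. (\<Sum>j\<in>J. M i j * c j) = 0"
      using insert.IH[OF insert.prems(1)] by blast
    then show ?thesis using True by (intro exI[of _ c]) auto
  next
    case False
    then obtain j0 where j0: "j0 \<in> J" "M i j0 \<noteq> 0" by blast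
    obtain r where r: "M i j0 * r = 1" using quat_inverse[OF j0(2)] by blast
    let ?J = "J - {j0}"
    have "card K < card ?J" using insert j0 by (simp add: card_Diff_singleton)
    moreover have "finite ?J" using insert.prems by simp
    ultimately obtain c where c: "\<exists>j\<in>?J. c j \<noteq> 0"
      "\<forall>a\<in>K. (\<Sum>j\<in>?J. (M a j - M a j0 * r * M i j) * c j) = 0"
      using insert.IH[of ?J "\<lambda>a j. M a j - M a j0 * r * M i j"] by blast
    define s where "s = (\<Sum>j\<in>?J. M i j * c j)"
    define c' where "c' = c(j0 := - (r * s))"
    have sum: "(\<Sum>j\<in>J. M a j * c' j) = (\<Sum>j\<in>?J. M a j * c j) - M a j0 * r * s" for a
      using j0(1) insert.prems(1) by (simp add: sum.remove[of J j0] c'_def mult.assoc)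
    have "(\<Sum>j\<in>J. M i j * c' j) = 0" using sum[of i] r by (simp add: s_def)
    moreover have "(\<Sum>j\<in>J. M a j * c' j) = 0" if "a \<in> K" for a
      using c(2) that sum[of a]
      by (simp add: left_diff_distrib sum_subtractf s_def sum_distrib_left mult.assoc)
    moreover have "\<exists>j\<in>J. c' j \<noteq> 0" using c(1) by (auto simp: c'_def)
    ultimately show ?thesis by (intro exI[of _ c']) auto
  qed
qed

lemma mult_mat_vec_entry:
  assumes "A \<in> carrier_mat m n" "x \<in> carrier_vec n" "i < m"
  shows "(A *\<^sub>v x) $ i = (\<Sum>j<n. A $$ (i, j) * x $ j)"
  using assms by (auto simp: scalar_prod_def lessThan_atLeast0 intro!: sum.cong)

text \<open>A basis of eigenvectors, the columns of \<open>X\<close>, with inverse \<open>Y\<close>; then \<open>Y *\<^sub>v x\<close> is the coordinate vector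
of \<open>x\<close>.\<close>

locale eigenbasis =
  fixes n :: nat and A X Y :: "dquat mat" and \<mu> :: "nat \<Rightarrow> dquat"
  assumes A_carrier: "A \<in> carrier_mat n n" and X_carrier: "X \<in> carrier_mat n n"
    and Y_carrier: "Y \<in> carrier_mat n n"
    and XY: "X * Y = 1\<^sub>m n" and YX: "Y * X = 1\<^sub>m n"
    and AX: "A * X = X * diag_matrix n \<mu>"
    and selfadjoint: "\<And>i. i < n \<Longrightarrow> dqcnj (\<mu> i) = \<mu> i"
begin

lemma coordinates_eigenvector:
  assumes "right_eigenvector A x \<nu>" "i < n"
  shows "\<mu> i * (Y *\<^sub>v x) $ i = (Y *\<^sub>v x) $ i * \<nu>"
proof -
  have x: "x \<in> carrier_vec n" and ex: "A *\<^sub>v x = map_vec (\<lambda>c. c * \<nu>) x"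
    using assms(1) carrier_matD(1)[OF A_carrier] by (auto simp: right_eigenvector_def)
  define y where "y = Y *\<^sub>v x"
  have y: "y \<in> carrier_vec n" unfolding y_def by (rule mult_mat_vec_carrier[OF Y_carrier x])
  have xy: "x = X *\<^sub>v y" using assoc_mult_mat_vec[OF X_carrier Y_carrier x] x by (simp add: y_def XY)
  have "diag_matrix n \<mu> = Y * (A * X)"
    unfolding AX using assoc_mult_mat[OF Y_carrier X_carrier diag_matrix_carrier] by (simp add: YX left_mult_one_mat[OF diag_matrix_carrier])
  then have "diag_matrix n \<mu> *\<^sub>v y = Y *\<^sub>v (A *\<^sub>v x)"
    using assoc_mult_mat_vec[OF Y_carrier mult_carrier_mat[OF A_carrier X_carrier] y] assoc_mult_mat_vec[OF A_carrier X_carrier y] xy by simp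
  moreover have "(diag_matrix n \<mu> *\<^sub>v y) $ i = \<mu> i * y $ i"
  proof -
    have "(diag_matrix n \<mu> *\<^sub>v y) $ i = (\<Sum>j<n. if j = i then \<mu> i * y $ i else 0)"
      unfolding mult_mat_vec_entry[OF diag_matrix_carrier y assms(2)]
      using assms(2) by (intro sum.cong) (auto simp: diag_matrix_def)
    then show ?thesis using assms(2) by simp
  qed
  moreover have "(Y *\<^sub>v (A *\<^sub>v x)) $ i = y $ i * \<nu>"
    unfolding ex y_def using x assms(2)
    by (simp add: mult_mat_vec_entry[OF Y_carrier] sum_distrib_right mult.assoc del: index_mult_mat_vec)
  ultimately show ?thesis by (simp add: y_def)
qed

text \<open>A coordinate with nonzero standard part could be cancelled from \<open>\<mu> i * y = y * \<nu>\<close>, as \<open>\<mu> i\<close> is central.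
Coordinates that are multiples of \<open>\<epsilon>\<close> need not vanish, when \<open>\<mu> i\<close> and \<open>\<nu>\<close> have the same standard part.\<close>

lemma coordinate_nonunit:
  assumes "right_eigenvector A x \<nu>" "i < n" "\<mu> i \<noteq> \<nu>"
  shows "std_part ((Y *\<^sub>v x) $ i) = 0"
proof (rule ccontr)
  assume "\<not> ?thesis"
  then obtain r where r: "r * (Y *\<^sub>v x) $ i = 1" using dquat_inverse by blast
  have "(Y *\<^sub>v x) $ i * \<mu> i = (Y *\<^sub>v x) $ i * \<nu>"
    using coordinates_eigenvector[OF assms(1,2)] dquat.selfadjoint_commute[OF selfadjoint[OF assms(2)]]
    by metis
  then have "\<mu> i = \<nu>" by (metis r mult.assoc mult_1_left)
  then show False using assms(3) by simp
qed

lemma vec_of_coordinates: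
  assumes "x \<in> carrier_vec n" "i < n"
  shows "x $ i = (\<Sum>d<n. X $$ (i, d) * (Y *\<^sub>v x) $ d)"
proof -
  have "x = X *\<^sub>v (Y *\<^sub>v x)" using assoc_mult_mat_vec[OF X_carrier Y_carrier assms(1)] assms(1) by (simp add: XY)
  then show ?thesis
    using mult_mat_vec_entry[OF X_carrier mult_mat_vec_carrier[OF Y_carrier assms(1)] assms(2)] by simp
qed

lemma column_eigenvector:
  assumes i: "i < n"
  shows "right_eigenvector A (col X i) (\<mu> i)"
  unfolding right_eigenvector_def
proof (intro conjI)
  have d: "dim_row A = n" by (rule carrier_matD(1)[OF A_carrier])
  have dX: "dim_row X = n" "dim_col X = n" using carrier_matD[OF X_carrier] by auto
  show "col X i \<in> carrier_vec (dim_row A)" by (simp add: d carrier_vecI dX)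
  show "map_vec std_part (col X i) \<noteq> 0\<^sub>v (dim_row A)"
  proof
    assume "map_vec std_part (col X i) = 0\<^sub>v (dim_row A)"
    then have "std_part (X $$ (c, i)) = 0" if "c < n" for c
      using that i d dX by (metis index_col index_map_vec(1) index_zero_vec(1) dim_col)
    then have "std_part ((Y * X) $$ (i, i)) = 0"
      using i by (simp add: mult_mat_entry[OF Y_carrier X_carrier] std_part_sum std_part_mult del: index_mult_mat)
    then show False using i by (simp add: YX one_dual_def)
  qed
  show "A *\<^sub>v col X i = map_vec (\<lambda>c. c * \<mu> i) (col X i)"
  proof (rule eq_vecI)
    fix a assume "a < dim_vec (map_vec (\<lambda>c. c * \<mu> i) (col X i))"
    then have a: "a < n" using dX by simp
    have "(A *\<^sub>v col X i) $ a = (A * X) $$ (a, i)" using a i d dX by simp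
    then show "(A *\<^sub>v col X i) $ a = map_vec (\<lambda>c. c * \<mu> i) (col X i) $ a"
      using mult_diag_matrix[OF X_carrier a i] a i dX by (simp add: AX)
  qed (use d dX in simp)
qed

lemma eigenvalues: "{\<nu>. right_eigenvalue A \<nu>} = \<mu> ` {..<n}"
proof
  show "\<mu> ` {..<n} \<subseteq> {\<nu>. right_eigenvalue A \<nu>}"
    using column_eigenvector by (auto simp: right_eigenvalue_def)
  show "{\<nu>. right_eigenvalue A \<nu>} \<subseteq> \<mu> ` {..<n}"
  proof
    fix \<nu> assume "\<nu> \<in> {\<nu>. right_eigenvalue A \<nu>}"
    then obtain x where x: "right_eigenvector A x \<nu>" by (auto simp: right_eigenvalue_def)
    have xc: "x \<in> carrier_vec n" and nz: "map_vec std_part x \<noteq> 0\<^sub>v n"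
      using x carrier_matD(1)[OF A_carrier] by (auto simp: right_eigenvector_def)
    show "\<nu> \<in> \<mu> ` {..<n}"
    proof (rule ccontr)
      assume "\<nu> \<notin> \<mu> ` {..<n}"
      then have "std_part ((Y *\<^sub>v x) $ i) = 0" if "i < n" for i
        using coordinate_nonunit[OF x that] that by blast
      then have "std_part (x $ i) = 0" if "i < n" for i
        unfolding vec_of_coordinates[OF xc that] by (simp add: std_part_sum std_part_mult del: index_mult_mat_vec)
      then have "map_vec std_part x = 0\<^sub>v n" using xc by (intro eq_vecI) auto
      then show False using nz by simp
    qed
  qed
qed

text \<open>The standard parts of the coordinates live on the indices with \<open>\<mu> i = \<nu>\<close>. Too many vectors satisfy a
nontrivial quaternion relation between these standard parts, and multiplying the relation by \<open>\<epsilon>\<close> makes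
it a relation between the vectors themselves.\<close>

lemma independent_eigenvectors_le:
  assumes ev: "\<And>x. x \<in> set xs \<Longrightarrow> right_eigenvector A x \<nu>" and ind: "right_lin_indep n xs"
  shows "length xs \<le> card {i. i < n \<and> \<mu> i = \<nu>}"
proof (rule ccontr)
  let ?K = "{i. i < n \<and> \<mu> i = \<nu>}" and ?J = "{..<length xs}"
  assume "\<not> ?thesis"
  then have "card ?K < card ?J" by simp
  then obtain c where c: "\<exists>j\<in>?J. c j \<noteq> 0"
    "\<forall>i\<in>?K. (\<Sum>j\<in>?J. std_part ((Y *\<^sub>v xs ! j) $ i) * c j) = 0"
    using quat_homogeneous_system[of ?K ?J "\<lambda>i j. std_part ((Y *\<^sub>v xs ! j) $ i)"] by auto
  have ev': "right_eigenvector A (xs ! j) \<nu>" if "j < length xs" for j using ev that by simp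
  have all: "(\<Sum>j<length xs. std_part ((Y *\<^sub>v xs ! j) $ i) * c j) = 0" if "i < n" for i
  proof (cases "\<mu> i = \<nu>")
    case True
    then show ?thesis using c(2) that by simp
  next
    case False
    then show ?thesis using coordinate_nonunit[OF ev' that] by simp
  qed
  have y: "(\<Sum>j<length xs. (Y *\<^sub>v xs ! j) $ i * Dual 0 (c j)) = 0" if "i < n" for i
    using all[OF that]
    by (simp add: dual_eq_iff std_part_sum dual_part_sum std_part_mult dual_part_mult
        del: index_mult_mat_vec)
  have "(\<Sum>j<length xs. (xs ! j) $ i * Dual 0 (c j)) = 0" if i: "i < n" for i
  proof -
    have xc: "xs ! j \<in> carrier_vec n" if "j < length xs" for j
      using ev'[OF that] carrier_matD(1)[OF A_carrier] by (simp add: right_eigenvector_def)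
    have "(\<Sum>j<length xs. (xs ! j) $ i * Dual 0 (c j)) =
        (\<Sum>j<length xs. \<Sum>d<n. X $$ (i, d) * ((Y *\<^sub>v xs ! j) $ d * Dual 0 (c j)))"
      using vec_of_coordinates[OF xc i]
      by (intro sum.cong) (simp_all add: sum_distrib_right mult.assoc del: index_mult_mat_vec)
    also have "\<dots> = (\<Sum>d<n. X $$ (i, d) * (\<Sum>j<length xs. (Y *\<^sub>v xs ! j) $ d * Dual 0 (c j)))"
      unfolding sum_distrib_left by (rule sum.swap)
    finally show ?thesis using y by simp
  qed
  then have "\<forall>j<length xs. Dual 0 (c j) = 0" 
    using spec[OF ind[unfolded right_lin_indep_def], of "\<lambda>j. Dual 0 (c j)"] by blast
  then show False using c(1) by (auto simp: zero_dual_def)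
qed

lemma multiplicity: "eigenvalue_mult A \<nu> = card {i. i < n \<and> \<mu> i = \<nu>}"
proof -
  let ?L = "{length xs | xs. (\<forall>x \<in> set xs. right_eigenvector A x \<nu>) \<and> right_lin_indep (dim_row A) xs}"
  have d: "dim_row A = n" by (rule carrier_matD(1)[OF A_carrier])
  have dX: "dim_row X = n" "dim_col X = n" using carrier_matD[OF X_carrier] by auto
  have le: "l \<le> card {i. i < n \<and> \<mu> i = \<nu>}" if "l \<in> ?L" for l
  proof -
    from that obtain xs where "l = length xs" "\<forall>x\<in>set xs. right_eigenvector A x \<nu>"
      "right_lin_indep n xs"
      unfolding d by blast
    then show ?thesis using independent_eigenvectors_le[of xs \<nu>] by blast
  qed
  define ks where "ks = filter (\<lambda>i. \<mu> i = \<nu>) [0..<n]"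
  have len: "length ks = card {i. i < n \<and> \<mu> i = \<nu>}"
  proof -
    have "distinct ks" "set ks = {i. i < n \<and> \<mu> i = \<nu>}" by (auto simp: ks_def)
    then show ?thesis by (metis distinct_card)
  qed
  have ks_lt: "ks ! j < n" "\<mu> (ks ! j) = \<nu>" if "j < length ks" for j
    using nth_mem[OF that] by (auto simp: ks_def)
  have "right_lin_indep n (map (col X) ks)"
    unfolding right_lin_indep_def
  proof (intro allI impI)
    fix c :: "nat \<Rightarrow> dquat" and j0
    assume z: "\<forall>i<n. (\<Sum>j<length (map (col X) ks). map (col X) ks ! j $ i * c j) = 0"
      and "j0 < length (map (col X) ks)"
    then have j0: "j0 < length ks" by simp
    have z': "(\<Sum>j<length ks. X $$ (i, ks ! j) * c j) = 0" if "i < n" for i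
      using z that ks_lt dX by (simp cong: sum.cong_simp)
    have "distinct ks" by (simp add: ks_def)
    then have inj: "ks ! j0 = ks ! j \<longleftrightarrow> j = j0" if "j < length ks" for j
      using j0 that by (auto simp: nth_eq_iff_index_eq)
    have "c j0 = (\<Sum>j<length ks. if j = j0 then c j0 else 0)" using j0 by simp
    also have "\<dots> = (\<Sum>j<length ks. (Y * X) $$ (ks ! j0, ks ! j) * c j)"
      using ks_lt j0 inj by (intro sum.cong) (auto simp: YX)
    also have "\<dots> = (\<Sum>j<length ks. \<Sum>i<n. Y $$ (ks ! j0, i) * (X $$ (i, ks ! j) * c j))"
      using ks_lt j0
      by (intro sum.cong) (auto simp: mult_mat_entry[OF Y_carrier X_carrier] sum_distrib_right mult.assoc
          simp del: index_mult_mat)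
    also have "\<dots> = (\<Sum>i<n. Y $$ (ks ! j0, i) * (\<Sum>j<length ks. X $$ (i, ks ! j) * c j))"
      unfolding sum_distrib_left by (rule sum.swap)
    also have "\<dots> = 0" using z' by simp
    finally show "c j0 = 0" .
  qed
  moreover have "\<forall>x\<in>set (map (col X) ks). right_eigenvector A x \<nu>"
    using column_eigenvector by (auto simp: ks_def)
  ultimately have mem: "card {i. i < n \<and> \<mu> i = \<nu>} \<in> ?L"
    unfolding d using len by (intro CollectI exI[of _ "map (col X) ks"]) simp
  have "?L \<subseteq> {..card {i. i < n \<and> \<mu> i = \<nu>}}" using le by blast
  then have "finite ?L" by (rule finite_subset) simp
  then show ?thesis unfolding eigenvalue_mult_def by (rule Max_eqI[OF _ le mem])
qed

lemma eigenvalue_list_mset: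
  assumes "eigenvalue_list A ls"
  shows "mset ls = mset (map \<mu> [0..<n])"
proof (rule multiset_eqI)
  fix \<nu>
  have set: "set ls = \<mu> ` {..<n}" and cnt: "\<And>\<nu>. \<nu> \<in> set ls \<Longrightarrow> count_list ls \<nu> = eigenvalue_mult A \<nu>"
    using assms eigenvalues by (auto simp: eigenvalue_list_def)
  have "count_list (map \<mu> [0..<n]) \<nu> = card {i. i < n \<and> \<mu> i = \<nu>}"
  proof -
    have "count_list (map \<mu> [0..<n]) \<nu> = length (filter (\<lambda>i. \<mu> i = \<nu>) [0..<n])"
    proof -
      have "(=) \<nu> \<circ> \<mu> = (\<lambda>i. \<mu> i = \<nu>)" by auto
      then show ?thesis by (simp add: count_list_eq_length_filter filter_map)
    qed
    also have "\<dots> = card (set (filter (\<lambda>i. \<mu> i = \<nu>) [0..<n]))"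
      by (rule distinct_card[symmetric]) simp
    also have "set (filter (\<lambda>i. \<mu> i = \<nu>) [0..<n]) = {i. i < n \<and> \<mu> i = \<nu>}" by auto
    finally show ?thesis .
  qed
  moreover have "count_list ls \<nu> = card {i. i < n \<and> \<mu> i = \<nu>}"
  proof (cases "\<nu> \<in> set ls")
    case True
    then show ?thesis using cnt multiplicity by simp
  next
    case False
    then have "{i. i < n \<and> \<mu> i = \<nu>} = {}" using set by auto
    then show ?thesis using False by (simp add: count_list_0_iff)
  qed
  ultimately show "count (mset ls) \<nu> = count (mset (map \<mu> [0..<n])) \<nu>"
    by (simp only: count_mset)
qed

end

lemma dq_adjoint_eq_adj: "dq_adjoint A = dquat.adj A"
  by (simp add: dq_adjoint_def dquat.adj_def)

theorem theorem3p9: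
  fixes A :: "dquat mat" and n :: nat and ls :: "dquat list"
  assumes "n \<ge> 1"
    and "A \<in> carrier_mat n n"
    and "dq_hermitian A"
    and "eigenvalue_list A ls"
  shows "Cdet A = prod_list ls \<and>
    Cdet (dq_adjoint A * A) = (Cdet A)\<^sup>2 \<and>
    (Cdet A)\<^sup>2 = prod_list (map (\<lambda>\<mu>. \<mu>\<^sup>2) ls)"
proof -
  have A: "dquat.hermitian n A" and AA: "dq_adjoint A = A"
    using assms(2,3) by (simp_all add: dq_hermitian_def dquat.hermitian_def dq_adjoint_eq_adj)
  obtain P \<beta> \<mu> where P: "elementary_prod n {..<n} P"
    and \<beta>: "\<And>i. i < n \<Longrightarrow> dqcnj (\<beta> i) = \<beta> i" and \<mu>: "\<And>i. i < n \<Longrightarrow> dqcnj (\<mu> i) = \<mu> i"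
    and one: "dquat.congr P (1\<^sub>m n) = diag_matrix n \<beta>"
    and AP: "A * dquat.adj P = dquat.adj P * diag_matrix n \<mu>"
    using spectral_congruence[OF A] by metis
  obtain Q where Q: "elementary_prod n {..<n} Q" "P * Q = 1\<^sub>m n" "Q * P = 1\<^sub>m n"
    using elementary_prod_inverse[OF P] by blast
  have c: "P \<in> carrier_mat n n" "Q \<in> carrier_mat n n"
    using P Q elementary_prod_carrier by auto
  interpret eigenbasis n A "dquat.adj P" "dquat.adj Q" \<mu>
  proof
    show "dquat.adj P * dquat.adj Q = 1\<^sub>m n" "dquat.adj Q * dquat.adj P = 1\<^sub>m n"
      using Q c by (simp_all flip: dquat.adj_mult[of _ n n _ n])
  qed (use assms(2) c AP \<mu> in auto)
  note ms = eigenvalue_list_mset[OF assms(4)]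
  have "set ls = set (map \<mu> [0..<n])" using ms by (metis set_mset_mset)
  then have sa: "dqcnj x = x" if "x \<in> set ls" for x using that \<mu> by auto
  have det: "Cdet A = prod_list ls"
    using set_det_eigenvalues(1)[OF A P \<beta> \<mu> one AP] Cdet_eq_set_det[OF assms(2)]
      prod_list_mset_selfadjoint[OF ms sa] by simp
  have sq: "prod_list (map (\<lambda>\<mu>. \<mu>\<^sup>2) ls) = (prod_list ls)\<^sup>2"
    using prod_list_mult_selfadjoint[of ls "\<lambda>x. x" "\<lambda>x. x"] sa by (simp add: power2_eq_square)
  have "mset (map (\<lambda>\<mu>. \<mu>\<^sup>2) ls) = mset (map (\<lambda>i. \<mu> i * \<mu> i) [0..<n])"
    using arg_cong[OF ms, of "image_mset (\<lambda>\<mu>. \<mu>\<^sup>2)"] by (simp add: power2_eq_square comp_def multiset.map_comp)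
  moreover have "dqcnj x = x" if "x \<in> set (map (\<lambda>\<mu>. \<mu>\<^sup>2) ls)" for x
    using that sa by (auto simp: power2_eq_square dquat.cnj_mult)
  ultimately have "prod_list (map (\<lambda>\<mu>. \<mu>\<^sup>2) ls) = prod_list (map (\<lambda>i. \<mu> i * \<mu> i) [0..<n])"
    by (rule prod_list_mset_selfadjoint)
  then have "Cdet (A * A) = prod_list (map (\<lambda>\<mu>. \<mu>\<^sup>2) ls)"
    using set_det_eigenvalues(2)[OF A P \<beta> \<mu> one AP] Cdet_eq_set_det[OF mult_carrier_mat[OF assms(2,2)]]
    by simp
  then show ?thesis using det sq AA by simp
qed

end
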